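(* Let $\mathcal H$ be a class of colored graphs. The following statements are equivalent: (1) There is a constant $c$ such that for every $H\in\mathcal H$, every graph in $\mathrm{Spasm}(H)$ has treewidth at most $c$. (2) There is a constant $c$ such that for every $H\in\mathcal H$, the graph $\widehat H$ has treewidth at most $c$ and there is no $c$-flower centered at any color class of $H$. (3) There is a constant $c$ such that for every $H\in\mathcal H$ there is a guarded cutvertex decomposition of $H$ with guard size at most $c$ whose bags each contain vertices of at most $c$ colors.
   Context: A colored graph is a finite simple graph $H$ with a (not necessarily proper) vertex coloring; the color classes are $C_i$. $\mathrm{Spasm}(H)$ is the set of (colored) graphs obtained from $H$ by choosing a partition of $V(H)$ in which each block is a monochromatic independent set and identifying each block into a single vertex of that color. $\widehat H$ is the simple graph with one vertex $v_i$ per color class $C_i$, with $v_iv_j$ an edge iff $H$ has an edge between $C_i$ and $C_j$. $H^{\bullet}$ is obtained from $H$ by making every color class a clique; $H^{\bullet\setminus i}$ is obtained from $H$ by making every color class except $C_i$ a clique. A $c$-flower centered at class $C_i$ is a collection of $c$ pairwise vertex-disjoint paths of length at least $1$ in $H^{\bullet\setminus i}$, each having both endpoints in $C_i$. For a rooted tree decomposition $(T,\beta)$, let $\sigma(t)=\beta(t)\cap\beta(s)$ where $s$ is the parent of $t$ ($\sigma(\text{root})=\emptyset$). A guarded cutvertex decomposition of $H$ is a triple $(T,\beta,g)$ where $(T,\beta)$ is a rooted tree decomposition of $H^{\bullet}$ and $g:V(T)\to2^{V(H)}$ satisfies $\sigma(t)\subseteq g(t)\subseteq\beta(t)$, such that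 (i) for every $t$, $g(t)$ is a vertex cover of $H[\beta(t)]$, and (ii) for every $t$ and every child $t'$ of $t$, $|\sigma(t')\setminus g(t)|\le1$. Its guard size is $\max_t|g(t)|$. *)

theory Defs
  imports "Graph_Theory.Graph_Theory" "HOL-Library.Disjoint_Sets"
begin

(* Finite simple graphs are the pair_graphs of Graph_Theory: finite vertex set, symmetric
   irreflexive set of arcs. An undirected edge uv is the pair of arcs (u,v), (v,u). *)

(* Graph_Theory.tree is unsuitable here: in a symmetric digraph every edge u-v-u is already
   a cycle of length 2, so only cycles of length at least 3 are excluded. The library's
   connected includes that the vertex set is nonempty. *)
definition undirected_tree :: "'t pair_pre_digraph \<Rightarrow> bool" where
  "undirected_tree T \<longleftrightarrow> pair_graph T \<and> connected T \<and>
     \<not> (\<exists>p. pre_digraph.cycle T p \<and> 3 \<le> length p)"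

definition tree_decomposition ::
  "'a pair_pre_digraph \<Rightarrow> 't pair_pre_digraph \<Rightarrow> ('t \<Rightarrow> 'a set) \<Rightarrow> bool" where
  "tree_decomposition G T \<beta> \<longleftrightarrow> undirected_tree T \<and>
     (\<Union>t\<in>pverts T. \<beta> t) = pverts G \<and>
     (\<forall>u v. (u, v) \<in> parcs G \<longrightarrow> (\<exists>t\<in>pverts T. u \<in> \<beta> t \<and> v \<in> \<beta> t)) \<and>
     (\<forall>v\<in>pverts G. connected (with_proj T \<restriction> {t \<in> pverts T. v \<in> \<beta> t}))"

(* Subtraction on nat: the graph without vertices gets width 0 instead of -1. *)
definition width :: "'t pair_pre_digraph \<Rightarrow> ('t \<Rightarrow> 'a set) \<Rightarrow> nat" where
  "width T \<beta> = (MAX t\<in>pverts T. card (\<beta> t)) - 1"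

(* Every finite tree is isomorphic to one with nodes in nat. *)
definition treewidth :: "'a pair_pre_digraph \<Rightarrow> nat" where
  "treewidth G =
     (LEAST w. \<exists>(T :: nat pair_pre_digraph) \<beta>. tree_decomposition G T \<beta> \<and> width T \<beta> = w)"

(* In the tree T rooted at r, s is the last vertex but one on the path from r to t. *)
definition is_parent :: "'t pair_pre_digraph \<Rightarrow> 't \<Rightarrow> 't \<Rightarrow> 't \<Rightarrow> bool" where
  "is_parent T r s t \<longleftrightarrow> (\<exists>p. vpath (p @ [s, t]) T \<and> hd (p @ [s, t]) = r)"

definition adhesion :: "'t pair_pre_digraph \<Rightarrow> 't \<Rightarrow> ('t \<Rightarrow> 'a set) \<Rightarrow> 't \<Rightarrow> 'a set" where
  "adhesion T r \<beta> t = (if t = r then {} else \<beta> t \<inter> \<beta> (THE s. is_parent T r s t))"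

definition vertex_cover :: "('a, 'b) pre_digraph \<Rightarrow> 'a set \<Rightarrow> bool" where
  "vertex_cover G S \<longleftrightarrow>
     S \<subseteq> verts G \<and> (\<forall>e\<in>arcs G. tail G e \<in> S \<or> head G e \<in> S)"

(* Only the values of color on the vertex set matter. *)
record ('a, 'c) colored_graph =
  ugraph :: "'a pair_pre_digraph"
  color :: "'a \<Rightarrow> 'c"

definition colored_graph :: "('a, 'c) colored_graph \<Rightarrow> bool" where
  "colored_graph H \<longleftrightarrow> pair_graph (ugraph H)"

definition colors :: "('a, 'c) colored_graph \<Rightarrow> 'c set" where
  "colors H = color H ` pverts (ugraph H)"

definition color_class :: "('a, 'c) colored_graph \<Rightarrow> 'c \<Rightarrow> 'a set" where
  "color_class H i = {v \<in> pverts (ugraph H). color H v = i}"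

definition monochromatic :: "('a, 'c) colored_graph \<Rightarrow> 'a set \<Rightarrow> bool" where
  "monochromatic H B \<longleftrightarrow> (\<exists>i. B \<subseteq> color_class H i)"

definition independent_set :: "'a pair_pre_digraph \<Rightarrow> 'a set \<Rightarrow> bool" where
  "independent_set G B \<longleftrightarrow> (\<forall>u\<in>B. \<forall>v\<in>B. (u, v) \<notin> parcs G)"

(* The vertex obtained by identifying a block is the block itself. *)
definition identify :: "('a, 'c) colored_graph \<Rightarrow> 'a set set \<Rightarrow> ('a set, 'c) colored_graph" where
  "identify H P =
     \<lparr>ugraph = \<lparr>pverts = P,
                parcs = {(A, B). A \<in> P \<and> B \<in> P \<and> (\<exists>u\<in>A. \<exists>v\<in>B. (u, v) \<in> parcs (ugraph H))}\<rparr>,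
      color = (\<lambda>B. THE i. B \<subseteq> color_class H i)\<rparr>"

definition Spasm :: "('a, 'c) colored_graph \<Rightarrow> ('a set, 'c) colored_graph set" where
  "Spasm H = {identify H P | P. partition_on (pverts (ugraph H)) P \<and>
     (\<forall>B\<in>P. monochromatic H B \<and> independent_set (ugraph H) B)}"

(* The graph written H with a hat; its vertex for the color class of i is the color i. *)
definition class_graph :: "('a, 'c) colored_graph \<Rightarrow> 'c pair_pre_digraph" where
  "class_graph H =
     \<lparr>pverts = colors H,
      parcs = {(i, j). i \<noteq> j \<and>
        (\<exists>u\<in>color_class H i. \<exists>v\<in>color_class H j. (u, v) \<in> parcs (ugraph H))}\<rparr>"

definition make_cliques :: "('a, 'c) colored_graph \<Rightarrow> 'c set \<Rightarrow> 'a pair_pre_digraph" where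
  "make_cliques H I =
     \<lparr>pverts = pverts (ugraph H),
      parcs = parcs (ugraph H) \<union>
        {(u, v). u \<noteq> v \<and> (\<exists>i\<in>I. u \<in> color_class H i \<and> v \<in> color_class H i)}\<rparr>"

definition bullet :: "('a, 'c) colored_graph \<Rightarrow> 'a pair_pre_digraph" where
  "bullet H = make_cliques H (colors H)"

definition bullet_except :: "('a, 'c) colored_graph \<Rightarrow> 'c \<Rightarrow> 'a pair_pre_digraph" where
  "bullet_except H i = make_cliques H (colors H - {i})"

(* A path is the list of its vertices. Inner vertices may lie in the color class of i. *)
definition flower :: "nat \<Rightarrow> ('a, 'c) colored_graph \<Rightarrow> 'c \<Rightarrow> 'a list set \<Rightarrow> bool" where
  "flower c H i F \<longleftrightarrow> finite F \<and> card F = c \<and>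
     (\<forall>p\<in>F. vpath p (bullet_except H i) \<and> 1 \<le> vwalk_length p \<and>
        hd p \<in> color_class H i \<and> last p \<in> color_class H i) \<and>
     (\<forall>p\<in>F. \<forall>q\<in>F. p \<noteq> q \<longrightarrow> set p \<inter> set q = {})"

definition guarded_cutvertex_decomposition ::
  "('a, 'c) colored_graph \<Rightarrow> 't pair_pre_digraph \<Rightarrow> 't \<Rightarrow>
   ('t \<Rightarrow> 'a set) \<Rightarrow> ('t \<Rightarrow> 'a set) \<Rightarrow> bool" where
  "guarded_cutvertex_decomposition H T r \<beta> g \<longleftrightarrow>
     tree_decomposition (bullet H) T \<beta> \<and> r \<in> pverts T \<and>
     (\<forall>t\<in>pverts T. adhesion T r \<beta> t \<subseteq> g t \<and> g t \<subseteq> \<beta> t) \<and>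
     (\<forall>t\<in>pverts T. vertex_cover (with_proj (ugraph H) \<restriction> \<beta> t) (g t)) \<and>
     (\<forall>t\<in>pverts T. \<forall>t'\<in>pverts T. is_parent T r t t' \<longrightarrow>
        card (adhesion T r \<beta> t' - g t) \<le> 1)"

definition guard_size :: "'t pair_pre_digraph \<Rightarrow> ('t \<Rightarrow> 'a set) \<Rightarrow> nat" where
  "guard_size T g = (MAX t\<in>pverts T. card (g t))"

end

theory Submission
  imports Defs
begin

text \<open>From (1) to (2): identifying as much as possible inside the color classes makes every class a
  clique of blocks, so the class graph inherits the tree decomposition, and every class has a
  partition into boundedly many independent sets. A large flower at \<open>C\<^sub>i\<close> consists of disjoint
  paths joining two of these sets; arranging the paths in a square grid and identifying their starts
  along rows and their ends along columns gives a quotient with a large clique minor.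

  From (2) to (3): since \<open>C\<^sub>i\<close> has no large flower, boundedly many vertices \<open>S\<^sub>i\<close> hit all
  \<open>C\<^sub>i\<close>-paths (a weak form of Gallai's theorem), hence every connected set that avoids \<open>S\<^sub>i\<close> and
  \<open>C\<^sub>i\<close> has at most one neighbour in \<open>C\<^sub>i\<close> outside \<open>S\<^sub>i\<close>. So the classes of a bag of the class
  graph can be split off one after the other, each as a bag whose guard is the current
  neighbourhood. Bags that balance this neighbourhood keep it bounded.

  From (3) to (1): splitting every node into a star with one leaf per block turns a guarded
  cutvertex decomposition into a tree decomposition of any quotient, of width at most the guard
  size.\<close>

section \<open>Connected sets and subtrees\<close>

text \<open>The obstacle on the way to (3) is that a narrow decomposition of the class graph bounds
  colors, not vertices: classes are cliques in \<open>bullet H\<close>, so bags must hold whole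
  classes while guards stay small. Absence of flowers helps because a part with at most one further
  neighbour in a class is exactly what condition (ii) tolerates. Guards are neighbourhoods, and
  their size obeys a recursion: with hitting sets of size \<open>s = 4 * c\<close>, a bound
  \<open>z\<close> becomes \<open>z / 2 + (c + 2) * s + (c + 2)\<close>, and \<open>z\<close> is
  chosen as its fixed point. The factor \<open>c + 2\<close> counts the at most \<open>c + 1\<close>
  colors of a bag and one color of the part itself, added to force progress. From (1), a class
  splits into \<open>c + 1\<close> independent sets, so \<open>(c + 2)^2 * (c + 1)^2\<close> paths
  contain \<open>(c + 2)^2\<close> whose ends lie in the same pair of sets; a clique minor on
  \<open>c + 2\<close> vertices then needs a bag larger than \<open>c + 1\<close>. Trees are encoded
  by parent functions that decrease indices, so the top of a subtree is its least index and Helly's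
  property is a statement about the largest top.\<close>

definition connected_in :: "'a rel \<Rightarrow> 'a set \<Rightarrow> bool" where
  "connected_in E D \<longleftrightarrow> (\<forall>u\<in>D. \<forall>v\<in>D. (u, v) \<in> (E \<inter> D \<times> D)\<^sup>*)"

lemma connected_in_empty [simp]: "connected_in E {}"
  by (simp add: connected_in_def)

lemma connected_in_singleton [simp]: "connected_in E {x}"
  by (simp add: connected_in_def)

lemma rtrancl_restrict_mono:
  "(u, v) \<in> (E \<inter> C \<times> C)\<^sup>* \<Longrightarrow> C \<subseteq> D \<Longrightarrow> (u, v) \<in> (E \<inter> D \<times> D)\<^sup>*"
  by (rule set_mp[OF rtrancl_mono, of "E \<inter> C \<times> C"]) auto

lemma connected_in_mono:
  assumes "connected_in E D" "E \<inter> D \<times> D \<subseteq> E'"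
  shows "connected_in E' D"
proof -
  have "(E \<inter> D \<times> D)\<^sup>* \<subseteq> (E' \<inter> D \<times> D)\<^sup>*"
    by (rule rtrancl_mono) (use assms(2) in auto)
  then show ?thesis
    using assms(1) unfolding connected_in_def by blast
qed

lemma connected_in_Un_adjacent:
  assumes "connected_in E C" "connected_in E D" "sym E" "x \<in> C" "y \<in> D" "x = y \<or> (x, y) \<in> E"
  shows "connected_in E (C \<union> D)"
proof -
  let ?R = "E \<inter> (C \<union> D) \<times> (C \<union> D)"
  have C: "(u, v) \<in> ?R\<^sup>*" if "u \<in> C" "v \<in> C" for u v
    using assms(1) that unfolding connected_in_def by (intro rtrancl_restrict_mono[OF _ Un_upper1]) blast
  have D: "(u, v) \<in> ?R\<^sup>*" if "u \<in> D" "v \<in> D" for u v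
    using assms(2) that unfolding connected_in_def by (intro rtrancl_restrict_mono[OF _ Un_upper2]) blast
  have "(x, y) \<in> ?R\<^sup>*" "(y, x) \<in> ?R\<^sup>*"
    using assms(3-6) by (auto dest: symD)
  then have "(u, v) \<in> ?R\<^sup>*" "(v, u) \<in> ?R\<^sup>*" if "u \<in> C" "v \<in> D" for u v
    using C[OF that(1) assms(4)] D[OF assms(5) that(2)] D[OF that(2) assms(5)] C[OF assms(4) that(1)]
    by (blast intro: rtrancl_trans)+
  then show ?thesis
    unfolding connected_in_def using C D by blast
qed

lemma connected_in_insert:
  assumes "connected_in E D" "sym E" "x \<in> D" "(x, y) \<in> E"
  shows "connected_in E (insert y D)"
  using connected_in_Un_adjacent[OF assms(1) connected_in_singleton assms(2,3), of y y] assms(4)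
  by simp

abbreviation walk :: "'a rel \<Rightarrow> 'a list \<Rightarrow> bool" where
  "walk E \<equiv> successively (\<lambda>u v. (u, v) \<in> E)"

lemma connected_in_walk:
  assumes "sym E" "walk E xs"
  shows "connected_in E (set xs)"
  using assms(2)
proof (induction xs rule: rev_induct)
  case (snoc x xs)
  show ?case
  proof (cases "xs = []")
    case False
    then have "connected_in E (insert x (set xs))"
      using snoc by (intro connected_in_insert[of _ _ "last xs"] assms(1))
        (auto simp: successively_append_iff)
    then show ?thesis by simp
  qed simp
qed simp

text \<open>If the vertex to be put in front already occurs on the path, everything before that
  occurrence is dropped.\<close>

lemma rtrancl_imp_distinct_path:
  assumes "(u, v) \<in> R\<^sup>*"
  shows "\<exists>xs. xs \<noteq> [] \<and> hd xs = u \<and> last xs = v \<and> distinct xs \<and>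
    walk R xs"
  using assms
proof (induction rule: converse_rtrancl_induct)
  case base
  show ?case by (rule exI[of _ "[v]"]) auto
next
  case (step u y)
  then obtain xs where xs: "xs \<noteq> []" "hd xs = y" "last xs = v" "distinct xs"
    "walk R xs" by blast
  show ?case
  proof (cases "u \<in> set xs")
    case True
    then obtain as bs where "xs = as @ u # bs" by (meson split_list)
    with xs show ?thesis
      by (intro exI[of _ "u # bs"]) (auto simp: successively_append_iff)
  next
    case False
    with xs step(1) show ?thesis
      by (intro exI[of _ "u # xs"]) (auto simp: successively_Cons)
  qed
qed

lemma successively_restrict_subset:
  "walk (E \<inter> S \<times> S) xs \<Longrightarrow> hd xs \<in> S \<Longrightarrow> set xs \<subseteq> S"
  by (induction xs rule: induct_list012) auto

lemma connected_in_imp_path: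
  assumes "connected_in E S" "u \<in> S" "v \<in> S"
  obtains xs where "xs \<noteq> []" "hd xs = u" "last xs = v" "distinct xs" "set xs \<subseteq> S"
    "walk E xs"
proof -
  have "(u, v) \<in> (E \<inter> S \<times> S)\<^sup>*"
    using assms unfolding connected_in_def by blast
  from rtrancl_imp_distinct_path[OF this]
  obtain xs where xs: "xs \<noteq> []" "hd xs = u" "last xs = v" "distinct xs"
    "walk (E \<inter> S \<times> S) xs"
    by blast
  moreover have "set xs \<subseteq> S"
    using successively_restrict_subset[OF xs(5)] xs(2) assms(2) by auto
  moreover have "walk E xs"
    using xs(5) by (rule successively_mono) auto
  ultimately show ?thesis using that by blast
qed

definition component_of :: "'a rel \<Rightarrow> 'a set \<Rightarrow> 'a \<Rightarrow> 'a set" where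
  "component_of E D x = {y \<in> D. (x, y) \<in> (E \<inter> D \<times> D)\<^sup>*}"

lemma component_of_self: "x \<in> D \<Longrightarrow> x \<in> component_of E D x"
  by (simp add: component_of_def)

lemma component_of_subset: "component_of E D x \<subseteq> D"
  by (auto simp: component_of_def)

lemma component_of_closed:
  "y \<in> component_of E D x \<Longrightarrow> (y, z) \<in> E \<Longrightarrow> z \<in> D \<Longrightarrow> z \<in> component_of E D x"
  unfolding component_of_def by (auto intro: rtrancl_into_rtrancl)

lemma sym_restrict: "sym E \<Longrightarrow> sym (E \<inter> D \<times> D)"
  by (auto simp: sym_def)

lemma component_of_eq:
  assumes "sym E" "y \<in> component_of E D x"
  shows "component_of E D y = component_of E D x"
  using assms(2) symD[OF sym_rtrancl[OF sym_restrict[OF assms(1), of D]]]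
  unfolding component_of_def by (auto intro: rtrancl_trans)

lemma connected_in_component_of:
  assumes "sym E" "x \<in> D"
  shows "connected_in E (component_of E D x)"
proof -
  let ?C = "component_of E D x"
  have *: "y \<in> ?C \<and> (x, y) \<in> (E \<inter> ?C \<times> ?C)\<^sup>*" if "(x, y) \<in> (E \<inter> D \<times> D)\<^sup>*" for y
    using that
  proof induction
    case base
    then show ?case using assms(2) by (simp add: component_of_self)
  next
    case (step y z)
    then have "z \<in> ?C" by (auto intro: component_of_closed)
    with step show ?case by (auto intro: rtrancl_into_rtrancl)
  qed
  have fwd: "(x, y) \<in> (E \<inter> ?C \<times> ?C)\<^sup>*" if "y \<in> ?C" for y
    using *[of y] that by (simp add: component_of_def)
  have "(y, x) \<in> (E \<inter> ?C \<times> ?C)\<^sup>*" if "y \<in> ?C" for y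
    using symD[OF sym_rtrancl[OF sym_restrict[OF assms(1)]] fwd[OF that]] .
  then show ?thesis
    unfolding connected_in_def using fwd by (blast intro: rtrancl_trans)
qed

section \<open>Subtrees of a rooted tree as sets of indices\<close>

text \<open>A connected set of tree nodes, described by its top \<open>m\<close>: climbing from any
  other member stays inside until \<open>m\<close> is reached. The value of \<open>p\<close> at the
  top is left open, which covers the root.\<close>

definition subtree_set :: "(nat \<Rightarrow> nat) \<Rightarrow> nat set \<Rightarrow> bool" where
  "subtree_set p S \<longleftrightarrow> (\<exists>m\<in>S. \<forall>k\<in>S. k \<noteq> m \<longrightarrow> p k \<in> S \<and> p k < k)"

lemma subtree_set_top_le:
  fixes m :: nat
  assumes "\<forall>k\<in>S. k \<noteq> m \<longrightarrow> p k \<in> S \<and> p k < k" "k \<in> S"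
  shows "m \<le> k"
  using assms(2)
proof (induction k rule: less_induct)
  case (less k)
  show ?case
  proof (cases "k = m")
    case False
    then have "p k \<in> S" "p k < k" using assms(1) less.prems by auto
    then show ?thesis using less.IH[of "p k"] by simp
  qed simp
qed

text \<open>Climbing from a common element \<open>x\<close> stays in both sets until the larger of
  the two tops is met. Unions and Helly's property both rest on this fact.\<close>

lemma subtree_set_tops:
  fixes a b :: nat
  assumes S: "\<forall>k\<in>S. k \<noteq> a \<longrightarrow> p k \<in> S \<and> p k < k"
    and S': "\<forall>k\<in>S'. k \<noteq> b \<longrightarrow> p k \<in> S' \<and> p k < k"
    and "a \<le> b" "x \<in> S" "x \<in> S'"
  shows "b \<in> S"
  using assms(4,5)
proof (induction x rule: less_induct)
  case (less x)
  show ?case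
  proof (cases "x = b")
    case False
    moreover have "b \<le> x"
      using subtree_set_top_le[OF S'] less.prems by blast
    ultimately have "x \<noteq> a" using assms(3) by linarith
    then show ?thesis using less S S' False by blast
  qed (use less in simp)
qed

lemma subtree_set_Un:
  assumes "subtree_set p S" "subtree_set p S'" "S \<inter> S' \<noteq> {}"
  shows "subtree_set p (S \<union> S')"
proof -
  obtain a where a: "a \<in> S" "\<forall>k\<in>S. k \<noteq> a \<longrightarrow> p k \<in> S \<and> p k < k"
    using assms(1) unfolding subtree_set_def by blast
  obtain b where b: "b \<in> S'" "\<forall>k\<in>S'. k \<noteq> b \<longrightarrow> p k \<in> S' \<and> p k < k"
    using assms(2) unfolding subtree_set_def by blast
  obtain x where x: "x \<in> S" "x \<in> S'" using assms(3) by blast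
  show ?thesis
  proof (cases "a \<le> b")
    case True
    have "b \<in> S" using subtree_set_tops[OF a(2) b(2) True x] .
    then show ?thesis using a b unfolding subtree_set_def by (intro bexI[of _ a]) auto
  next
    case False
    have "a \<in> S'" using subtree_set_tops[OF b(2) a(2) _ x(2,1)] False by simp
    then show ?thesis using a b unfolding subtree_set_def by (intro bexI[of _ b]) auto
  qed
qed

text \<open>The least element of \<open>U\<close> is the only possible top. A subtree inside
  \<open>U\<close> that contains it and \<open>k\<close> has the same top, and therefore supplies
  the parent of \<open>k\<close>.\<close>

lemma subtree_setI_pairs:
  assumes "U \<noteq> {}"
    and "\<And>x y. x \<in> U \<Longrightarrow> y \<in> U \<Longrightarrow> \<exists>S\<subseteq>U. subtree_set p S \<and> x \<in> S \<and> y \<in> S"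
  shows "subtree_set p U"
proof -
  define m where "m = (LEAST x. x \<in> U)"
  have m: "m \<in> U" "\<And>x. x \<in> U \<Longrightarrow> m \<le> x"
    using assms(1) unfolding m_def by (auto intro: LeastI Least_le)
  have "p k \<in> U \<and> p k < k" if k: "k \<in> U" "k \<noteq> m" for k
  proof -
    obtain S where S: "S \<subseteq> U" "subtree_set p S" "m \<in> S" "k \<in> S"
      using assms(2)[OF m(1) k(1)] by blast
    then obtain t where t: "t \<in> S" "\<forall>k\<in>S. k \<noteq> t \<longrightarrow> p k \<in> S \<and> p k < k"
      unfolding subtree_set_def by blast
    have "t = m"
      using m(2)[of t] subtree_set_top_le[OF t(2) S(3)] t(1) S(1) by (simp add: subset_iff)
    then show ?thesis using t S k by blast
  qed
  then show ?thesis using m(1) unfolding subtree_set_def by blast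
qed

text \<open>The familiar fact that a connected vertex set occupies a connected part of a tree
  decomposition. Here \<open>E\<close> can be any relation between indices whose sets meet, in
  particular \<open>UNIV\<close> when all of them meet pairwise.\<close>

lemma subtree_set_UN:
  assumes "connected_in E D" "D \<noteq> {}"
    and B: "\<And>v. v \<in> D \<Longrightarrow> subtree_set p (B v)"
    and meet: "\<And>u v. u \<in> D \<Longrightarrow> v \<in> D \<Longrightarrow> (u, v) \<in> E \<Longrightarrow> B u \<inter> B v \<noteq> {}"
  shows "subtree_set p (\<Union>v\<in>D. B v)"
proof (rule subtree_setI_pairs)
  show "(\<Union>v\<in>D. B v) \<noteq> {}"
    using assms(2) B unfolding subtree_set_def by blast
  fix x y assume "x \<in> (\<Union>v\<in>D. B v)" "y \<in> (\<Union>v\<in>D. B v)"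
  then obtain u v where uv: "u \<in> D" "v \<in> D" "x \<in> B u" "y \<in> B v" by blast
  have "(u, v) \<in> (E \<inter> D \<times> D)\<^sup>*" using assms(1) uv unfolding connected_in_def by blast
  then have "\<exists>S\<subseteq>(\<Union>v\<in>D. B v). subtree_set p S \<and> B u \<subseteq> S \<and> B v \<subseteq> S"
  proof induction
    case base
    show ?case using B[OF uv(1)] uv(1) by blast
  next
    case (step v w)
    then obtain S where S: "S \<subseteq> (\<Union>v\<in>D. B v)" "subtree_set p S" "B u \<subseteq> S" "B v \<subseteq> S"
      by blast
    have "subtree_set p (S \<union> B w)"
      using S step B[of w] meet[of v w] by (intro subtree_set_Un) auto
    moreover have "S \<union> B w \<subseteq> (\<Union>v\<in>D. B v)" using S step(2) by auto
    ultimately show ?case using S by (intro exI[of _ "S \<union> B w"]) blast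
  qed
  then show "\<exists>S\<subseteq>(\<Union>v\<in>D. B v). subtree_set p S \<and> x \<in> S \<and> y \<in> S"
    using uv by blast
qed

text \<open>The largest of the tops lies in every \<open>S i\<close>, by
  \<open>subtree_set_tops\<close>.\<close>

lemma subtree_set_Helly:
  assumes "finite I" "I \<noteq> {}"
    and "\<And>i. i \<in> I \<Longrightarrow> subtree_set p (S i)"
    and "\<And>i j. i \<in> I \<Longrightarrow> j \<in> I \<Longrightarrow> S i \<inter> S j \<noteq> {}"
  shows "\<exists>k. \<forall>i\<in>I. k \<in> S i"
proof -
  have "\<forall>i\<in>I. \<exists>m\<in>S i. \<forall>k\<in>S i. k \<noteq> m \<longrightarrow> p k \<in> S i \<and> p k < k"
    using assms(3) unfolding subtree_set_def by blast
  then obtain m where m: "\<And>i. i \<in> I \<Longrightarrow> m i \<in> S i"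
      "\<And>i. i \<in> I \<Longrightarrow> \<forall>k\<in>S i. k \<noteq> m i \<longrightarrow> p k \<in> S i \<and> p k < k"
    by metis
  obtain j where j: "j \<in> I" "\<And>i. i \<in> I \<Longrightarrow> m i \<le> m j"
  proof -
    have "Max (m ` I) \<in> m ` I" using assms(1,2) by simp
    then obtain j where "j \<in> I" "m j = Max (m ` I)" by auto
    moreover have "m i \<le> Max (m ` I)" if "i \<in> I" for i using assms(1) that by simp
    ultimately show ?thesis using that by simp
  qed
  have "m j \<in> S i" if i: "i \<in> I" for i
  proof -
    obtain x where "x \<in> S i" "x \<in> S j" using assms(4)[OF i j(1)] by blast
    then show ?thesis using subtree_set_tops[OF m(2)[OF i] m(2)[OF j(1)] j(2)[OF i]] by blast
  qed
  then show ?thesis by blast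
qed

abbreviation nodes :: "nat \<Rightarrow> (nat \<Rightarrow> 'a set) \<Rightarrow> 'a \<Rightarrow> nat set" where
  "nodes n \<beta> v \<equiv> {k. k < n \<and> v \<in> \<beta> k}"

text \<open>Tree decompositions whose tree has the nodes \<open>0, \<dots>, n - 1\<close>, where \<open>p k < k\<close> is the
  parent of \<open>k > 0\<close>.\<close>

definition parent_fun :: "nat \<Rightarrow> (nat \<Rightarrow> nat) \<Rightarrow> bool" where
  "parent_fun n p \<longleftrightarrow> 0 < n \<and> (\<forall>k. 0 < k \<and> k < n \<longrightarrow> p k < k)"

definition parent_decomposition ::
  "nat \<Rightarrow> (nat \<Rightarrow> nat) \<Rightarrow> (nat \<Rightarrow> 'a set) \<Rightarrow> 'a set \<Rightarrow> 'a rel \<Rightarrow> bool" where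
  "parent_decomposition n p \<beta> V E \<longleftrightarrow> parent_fun n p \<and> (\<forall>k<n. \<beta> k \<subseteq> V) \<and>
     (\<forall>v\<in>V. subtree_set p (nodes n \<beta> v)) \<and>
     (\<forall>u v. (u, v) \<in> E \<longrightarrow> (\<exists>k<n. u \<in> \<beta> k \<and> v \<in> \<beta> k))"

section \<open>Undirected trees as parent functions\<close>

lemma pair_graph_iff:
  "pair_graph G \<longleftrightarrow> finite (pverts G) \<and> parcs G \<subseteq> pverts G \<times> pverts G \<and> sym (parcs G) \<and>
     (\<forall>u. (u, u) \<notin> parcs G)" (is "_ \<longleftrightarrow> ?R")
proof
  assume "pair_graph G"
  then interpret pair_graph G .
  have "parcs G \<subseteq> pverts G \<times> pverts G" by (auto dest: in_arcsD1 in_arcsD2)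
  moreover have "(u, u) \<notin> parcs G" for u using pair_no_loops[of "(u, u)"] by auto
  ultimately show ?R
    using pair_finite_verts pair_sym_arcs unfolding symmetric_def by simp
next
  assume R: ?R
  then have "finite (parcs G)" by (meson finite_SigmaI finite_subset)
  then show "pair_graph G"
    using R by unfold_locales (auto simp: symmetric_def)
qed

lemmas colored_graph_iff = colored_graph_def pair_graph_iff

text \<open>Reachability in the library is \<open>rtrancl_on\<close>; this translates it into the
  closure of a restricted relation on which \<open>connected_in\<close> is based.\<close>

lemma rtrancl_on_conv: "(u, v) \<in> rtrancl_on F R \<longleftrightarrow> u \<in> F \<and> (u, v) \<in> (R \<inter> F \<times> F)\<^sup>*"
proof
  assume "(u, v) \<in> rtrancl_on F R"
  then have "u \<in> F \<and> v \<in> F \<and> (u, v) \<in> (R \<inter> F \<times> F)\<^sup>*"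
  proof induction
    case (step x y)
    then show ?case by (auto intro: converse_rtrancl_into_rtrancl[of x y])
  qed auto
  then show "u \<in> F \<and> (u, v) \<in> (R \<inter> F \<times> F)\<^sup>*" by blast
next
  assume "u \<in> F \<and> (u, v) \<in> (R \<inter> F \<times> F)\<^sup>*"
  then have u: "u \<in> F" and uv: "(u, v) \<in> (R \<inter> F \<times> F)\<^sup>*" by auto
  from uv show "(u, v) \<in> rtrancl_on F R"
  proof induction
    case (step x y)
    then show ?case by (auto intro: rtrancl_on_into_rtrancl_on[of u x])
  qed (use u in simp)
qed

lemma connected_conv:
  "connected G \<longleftrightarrow> verts G \<noteq> {} \<and> connected_in (parcs (mk_symmetric G)) (verts G)"
  unfolding connected_def strongly_connected_def reachable_def rtrancl_on_conv connected_in_def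
  by (simp add: mk_symmetric_def)

lemma connected_restrict_iff:
  assumes "sym (parcs T)"
  shows "connected (with_proj T \<restriction> S) \<longleftrightarrow> S \<noteq> {} \<and> connected_in (parcs T) S"
proof -
  have "parcs (mk_symmetric (with_proj T \<restriction> S)) = parcs T \<inter> S \<times> S"
    using assms by (auto simp: mk_symmetric_def sym_def)
  then show ?thesis by (simp add: connected_conv connected_in_def)
qed

lemma connected_with_proj_iff:
  assumes "sym (parcs T)"
  shows "connected (with_proj T) \<longleftrightarrow> pverts T \<noteq> {} \<and> connected_in (parcs T) (pverts T)"
proof -
  have "parcs (mk_symmetric (with_proj T)) = parcs T"
    using assms by (force simp: mk_symmetric_def sym_def)
  then show ?thesis by (simp add: connected_conv)
qed

lemma vwalk_arcs_walk:
  assumes "walk E xs" "xs \<noteq> []"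
  shows "pcas (hd xs) (vwalk_arcs xs) (last xs)" "set (vwalk_arcs xs) \<subseteq> E"
    "pawalk_verts (hd xs) (vwalk_arcs xs) = xs"
  using assms by (induction xs rule: vwalk_arcs.induct) auto

lemma set_vwalk_arcs_subset_iff:
  "set (vwalk_arcs xs) \<subseteq> E \<longleftrightarrow> walk E xs"
  by (induction xs rule: vwalk_arcs.induct) auto

lemma vpath_iff:
  "vpath xs (with_proj G) \<longleftrightarrow>
     xs \<noteq> [] \<and> distinct xs \<and> set xs \<subseteq> pverts G \<and> walk (parcs G) xs"
  unfolding vpath_def vwalk_def by (auto simp: set_vwalk_arcs_subset_iff)

lemma pcas_walk:
  assumes "pcas u q v" "set q \<subseteq> E"
  shows "walk E (pawalk_verts u q) \<and> hd (pawalk_verts u q) = u \<and>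
    last (pawalk_verts u q) = v \<and> length (pawalk_verts u q) = Suc (length q)"
  using assms
proof (induction q arbitrary: u)
  case (Cons a q)
  have "pawalk_verts (snd a) q \<noteq> []" by (cases q) auto
  with Cons show ?case by (cases a) (auto simp: successively_Cons)
qed simp

text \<open>A library cycle is a closed list of arcs. Its vertex list repeats the first vertex;
  without the repetition it is as long as the arc list, so the bound 3 is the same on both
  sides.\<close>

lemma cycle_iff_list:
  assumes "pair_graph T"
  shows "(\<exists>q. pre_digraph.cycle T q \<and> 3 \<le> length q) \<longleftrightarrow>
    (\<exists>xs. distinct xs \<and> 3 \<le> length xs \<and> walk (parcs T) xs \<and>
      (last xs, hd xs) \<in> parcs T)" (is "?L \<longleftrightarrow> ?R")
proof
  interpret pair_graph T by fact
  assume ?L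
  then obtain q u where q: "3 \<le> length q" "awalk u q u" "distinct (tl (pawalk_verts u q))"
    unfolding cycle_def by blast
  then have *: "walk (parcs T) (pawalk_verts u q) \<and>
      hd (pawalk_verts u q) = u \<and> last (pawalk_verts u q) = u \<and>
      length (pawalk_verts u q) = Suc (length q)"
    by (intro pcas_walk) (auto simp: awalk_def)
  then obtain xs where xs: "pawalk_verts u q = u # xs" by (metis length_Suc_conv list.sel(1))
  have "xs \<noteq> []" using * xs q(1) by auto
  then show ?R
    using * xs q by (intro exI[of _ xs]) (auto simp: successively_Cons)
next
  interpret pair_graph T by fact
  assume ?R
  then obtain xs where xs: "distinct xs" "3 \<le> length xs"
    "walk (parcs T) xs" "(last xs, hd xs) \<in> parcs T" by blast
  then have ne: "xs \<noteq> []" by auto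
  let ?ys = "xs @ [hd xs]"
  have s: "walk (parcs T) ?ys" "?ys \<noteq> []"
    using xs by (auto simp: successively_append_iff)
  have hl: "hd ?ys = hd xs" "last ?ys = hd xs" using ne by auto
  have "awalk (hd xs) (vwalk_arcs ?ys) (hd xs)"
    using vwalk_arcs_walk[OF s] xs(4) hl by (auto simp: awalk_def intro: in_arcsD2)
  moreover have "distinct (tl (pawalk_verts (hd xs) (vwalk_arcs ?ys)))"
    using vwalk_arcs_walk(3)[OF s] hl(1) ne xs(1) by (cases xs) auto
  moreover have "length (vwalk_arcs ?ys) = length xs"
    using vwalk_length_simp[of ?ys] unfolding vwalk_length_def by simp
  ultimately show ?L using xs(2) ne
    unfolding cycle_def by (intro exI[of _ "vwalk_arcs ?ys"]) (auto intro!: exI[of _ "hd xs"])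
qed

text \<open>An isomorphism from the tree of the parent function \<open>p\<close>, with root 0, to
  \<open>T\<close>.\<close>

definition tree_enumeration ::
  "'t pair_pre_digraph \<Rightarrow> nat \<Rightarrow> (nat \<Rightarrow> 't) \<Rightarrow> (nat \<Rightarrow> nat) \<Rightarrow> bool" where
  "tree_enumeration T n e p \<longleftrightarrow> parent_fun n p \<and> bij_betw e {..<n} (pverts T) \<and>
     (\<forall>i<n. \<forall>j<n. (e i, e j) \<in> parcs T \<longleftrightarrow> 0 < i \<and> j = p i \<or> 0 < j \<and> i = p j)"

lemma connected_in_exit:
  assumes "connected_in E D" "u \<in> D" "u \<in> S" "v \<in> D" "v \<notin> S"
  obtains x y where "(x, y) \<in> E" "x \<in> S" "y \<in> D" "y \<notin> S"
proof -
  have "(u, v) \<in> (E \<inter> D \<times> D)\<^sup>*" using assms unfolding connected_in_def by blast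
  then have "v \<in> S \<or> (\<exists>x y. (x, y) \<in> E \<and> x \<in> S \<and> x \<in> D \<and> y \<in> D \<and> y \<notin> S)"
    by induction (use assms(3) in blast)+
  then show ?thesis using that assms(5) by blast
qed

text \<open>The enumerated vertices form a growing connected set. A vertex reached by an edge
  leaving this set has no second neighbour in it, as that would close a cycle of length at least 3;
  its only neighbour becomes its parent.\<close>

lemma undirected_tree_enumeration:
  assumes "undirected_tree T" "r \<in> pverts T"
  obtains n e p where "tree_enumeration T n e p" "e 0 = r"
proof -
  have pg: "pair_graph T" and con: "connected T"
    and nocyc: "\<not> (\<exists>q. pre_digraph.cycle T q \<and> 3 \<le> length q)"
    using assms(1) by (auto simp: undirected_tree_def)
  have fin: "finite (pverts T)" and sub: "parcs T \<subseteq> pverts T \<times> pverts T"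
    and sy: "sym (parcs T)" and irr: "\<And>u. (u, u) \<notin> parcs T"
    using pg by (auto simp: pair_graph_iff)
  have con': "connected_in (parcs T) (pverts T)"
    using con by (simp add: connected_with_proj_iff[OF sy])
  define Q where "Q m e p \<longleftrightarrow> parent_fun m p \<and> inj_on e {..<m} \<and> e ` {..<m} \<subseteq> pverts T \<and> e 0 = r \<and>
      connected_in (parcs T) (e ` {..<m}) \<and>
      (\<forall>i<m. \<forall>j<m. (e i, e j) \<in> parcs T \<longleftrightarrow> 0 < i \<and> j = p i \<or> 0 < j \<and> i = p j)"
    for m e p
  have "\<exists>e p. Q m e p" if "1 \<le> m" "m \<le> card (pverts T)" for m
    using that
  proof (induction m rule: dec_induct)
    case base
    have "Q 1 (\<lambda>_. r) (\<lambda>_. 0)"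
      unfolding Q_def using assms(2) irr by (auto simp: parent_fun_def lessThan_Suc)
    then show ?case by blast
  next
    case (step m)
    have "m \<le> card (pverts T)" using step.prems by simp
    from step.IH[OF this] obtain e p where Q: "Q m e p" by blast
    have ep: "parent_fun m p" "inj_on e {..<m}" "e ` {..<m} \<subseteq> pverts T"
      "e 0 = r" "connected_in (parcs T) (e ` {..<m})"
      using Q unfolding Q_def by simp_all
    have ep6: "(e i, e j) \<in> parcs T \<longleftrightarrow> 0 < i \<and> j = p i \<or> 0 < j \<and> i = p j"
      if "i < m" "j < m" for i j
      using Q that unfolding Q_def by simp
    let ?S = "e ` {..<m}"
    have "card ?S = m" using ep(2) by (simp add: card_image)
    then have "?S \<noteq> pverts T" using step.prems by auto
    then obtain v where v: "v \<in> pverts T" "v \<notin> ?S" using ep(3) by blast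
    have "r \<in> ?S" using step.hyps ep(4) by (auto intro: image_eqI[of _ _ 0])
    from connected_in_exit[OF con' assms(2) this v]
    obtain x y where xy: "(x, y) \<in> parcs T" "x \<in> ?S" "y \<in> pverts T" "y \<notin> ?S" .
    then obtain i where i: "i < m" "x = e i" by blast
    have uniq: "j = i" if "j < m" "(e j, y) \<in> parcs T" for j
    proof (rule ccontr)
      assume "j \<noteq> i"
      then have "e j \<noteq> x" using i that ep(2) by (auto dest: inj_onD)
      have "e j \<in> ?S" using that(1) by blast
      from connected_in_imp_path[OF ep(5) this xy(2)]
      obtain xs where xs: "xs \<noteq> []" "hd xs = e j" "last xs = x" "distinct xs" "set xs \<subseteq> ?S"
        "walk (parcs T) xs" .
      have "length xs \<noteq> Suc 0" using xs(1-3) \<open>e j \<noteq> x\<close> by (auto simp: length_Suc_conv)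
      then have "3 \<le> length (xs @ [y])" using xs(1) by (cases xs) (auto simp: Suc_le_eq)
      moreover have "distinct (xs @ [y])" using xs(4,5) xy(4) by auto
      moreover have "walk (parcs T) (xs @ [y])"
        using xs xy(1) by (auto simp: successively_append_iff)
      moreover have "(last (xs @ [y]), hd (xs @ [y])) \<in> parcs T"
        using xs(1,2) symD[OF sy that(2)] by simp
      ultimately show False using nocyc unfolding cycle_iff_list[OF pg] by blast
    qed
    let ?e = "e(m := y)" and ?p = "p(m := i)"
    have "?e ` {..<Suc m} = insert y ?S" by (auto simp: lessThan_Suc)
    then have "connected_in (parcs T) (?e ` {..<Suc m})"
      using connected_in_insert[OF ep(5) sy xy(2,1)] by (simp only:)
    moreover have "parent_fun (Suc m) ?p" using ep(1) i by (auto simp: parent_fun_def less_Suc_eq)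
    moreover have "inj_on ?e {..<Suc m}"
      using ep(2) xy(4) by (auto simp: lessThan_Suc inj_on_def)
    moreover have "(?e a, ?e b) \<in> parcs T \<longleftrightarrow> 0 < a \<and> b = ?p a \<or> 0 < b \<and> a = ?p b"
      if ab: "a < Suc m" "b < Suc m" for a b
    proof -
      have pm: "p k \<noteq> m" if "0 < k" "k < m" for k
        using ep(1) that unfolding parent_fun_def by (metis less_asym)
      have yb: "(y, e b) \<in> parcs T \<longleftrightarrow> b = i" "(e b, y) \<in> parcs T \<longleftrightarrow> b = i" if "b < m" for b
        using uniq[OF that] xy(1) symD[OF sy, of y "e b"] symD[OF sy, of "e b" y]
          symD[OF sy xy(1)] i by blast+
      have pa: "a < m \<Longrightarrow> 0 < a \<Longrightarrow> p a \<noteq> m" and pb: "b < m \<Longrightarrow> 0 < b \<Longrightarrow> p b \<noteq> m"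
        using pm by blast+
      consider "a < m" "b < m" | "a = m" "b < m" | "a < m" "b = m" | "a = m" "b = m"
        using ab by linarith
      then show ?thesis
      proof cases
        case 1
        then show ?thesis using ep6[OF 1] by simp
      next
        case 2
        then show ?thesis using yb[OF 2(2)] pb i(1) by auto
      next
        case 3
        then show ?thesis using yb[OF 3(1)] pa i(1) by auto
      next
        case 4
        then show ?thesis using irr[of y] i(1) by auto
      qed
    qed
    moreover have "?e ` {..<Suc m} \<subseteq> pverts T" using ep(3) xy(3) by (auto simp: lessThan_Suc)
    moreover have "?e 0 = r" using ep(4) step.hyps by simp
    ultimately have "Q (Suc m) ?e ?p" unfolding Q_def by (metis (no_types, lifting))
    then show ?case by blast
  qed
  moreover have "1 \<le> card (pverts T)"
    using assms(2) fin by (metis One_nat_def Suc_leI card_gt_0_iff empty_iff)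
  ultimately obtain e p where Q: "Q (card (pverts T)) e p" by blast
  have "e ` {..<card (pverts T)} = pverts T"
    using Q card_image[of e "{..<card (pverts T)}"] unfolding Q_def
    by (intro card_subset_eq[OF fin]) simp_all
  then have "tree_enumeration T (card (pverts T)) e p" "e 0 = r"
    using Q unfolding tree_enumeration_def bij_betw_def Q_def by simp_all
  then show ?thesis by (rule that)
qed

definition index_tree :: "nat \<Rightarrow> (nat \<Rightarrow> nat) \<Rightarrow> nat pair_pre_digraph" where
  "index_tree n p = \<lparr>pverts = {..<n},
     parcs = {(i, j). i < n \<and> j < n \<and> (0 < i \<and> j = p i \<or> 0 < j \<and> i = p j)}\<rparr>"

lemma tree_enumeration_index_tree:
  "parent_fun n p \<Longrightarrow> tree_enumeration (index_tree n p) n id p"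
  by (auto simp: tree_enumeration_def index_tree_def)

lemma pair_graph_index_tree:
  assumes "parent_fun n p"
  shows "pair_graph (index_tree n p)"
  using assms by (auto simp: pair_graph_iff index_tree_def parent_fun_def sym_def)

text \<open>A subtree is connected since all its members climb to the top. Conversely, the top of a
  connected set can only be its least index, because parents have smaller indices.\<close>

lemma subtree_set_iff_connected:
  assumes T: "tree_enumeration T n e p" and S: "S \<subseteq> {..<n}" and sy: "sym (parcs T)"
  shows "subtree_set p S \<longleftrightarrow> S \<noteq> {} \<and> connected_in (parcs T) (e ` S)"
proof
  have pf: "\<And>k. 0 < k \<Longrightarrow> k < n \<Longrightarrow> p k < k" and inj: "inj_on e {..<n}"
    and adj: "\<And>i j. i < n \<Longrightarrow> j < n \<Longrightarrow>
      (e i, e j) \<in> parcs T \<longleftrightarrow> 0 < i \<and> j = p i \<or> 0 < j \<and> i = p j"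
    using T by (auto simp: tree_enumeration_def parent_fun_def bij_betw_def)
  {
    assume "subtree_set p S"
    then obtain m where m: "m \<in> S" "\<forall>k\<in>S. k \<noteq> m \<longrightarrow> p k \<in> S \<and> p k < k"
      unfolding subtree_set_def by blast
    let ?R = "parcs T \<inter> e ` S \<times> e ` S"
    have up: "(e k, e m) \<in> ?R\<^sup>*" if "k \<in> S" for k
      using that
    proof (induction k rule: less_induct)
      case (less k)
      show ?case
      proof (cases "k = m")
        case False
        then have pk: "p k \<in> S" "p k < k" using m(2) less.prems by auto
        then have "(e k, e (p k)) \<in> ?R" using adj[of k "p k"] less.prems S by auto
        then show ?thesis using less.IH[OF pk(2,1)] by (rule converse_rtrancl_into_rtrancl)
      qed simp
    qed
    have down: "(e m, e k) \<in> ?R\<^sup>*" if "k \<in> S" for k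
      using symD[OF sym_rtrancl[OF sym_restrict[OF sy]] up[OF that]] .
    have "connected_in (parcs T) (e ` S)"
      unfolding connected_in_def using up down by (blast intro: rtrancl_trans)
    then show "S \<noteq> {} \<and> connected_in (parcs T) (e ` S)" using m(1) by blast
  }
  assume "S \<noteq> {} \<and> connected_in (parcs T) (e ` S)"
  then have ne: "S \<noteq> {}" and con: "connected_in (parcs T) (e ` S)" by auto
  define m where "m = (LEAST x. x \<in> S)"
  have m: "m \<in> S" "\<And>x. x \<in> S \<Longrightarrow> m \<le> x"
    using ne unfolding m_def by (auto intro: LeastI Least_le)
  have "p k \<in> S \<and> p k < k" if k: "k \<in> S" "k \<noteq> m" for k
  proof -
    \<comment> \<open>Walking from \<open>k\<close> to \<open>m\<close>, one leaves the subtree below \<open>k\<close> through the edge to \<open>p k\<close>.\<close>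
    define R where "R = {(a, b). 0 < a \<and> a < n \<and> b = p a}"
    define Below where "Below = {x. x < n \<and> (x, k) \<in> R\<^sup>*}"
    have lt: "k < n" "m < k" using k m S by (auto simp: le_neq_implies_less)
    have le: "k \<le> x" if "(x, k) \<in> R\<^sup>*" for x
      using that
    proof (induction rule: converse_rtrancl_induct)
      case (step x y)
      then show ?case using pf[of x] by (auto simp: R_def)
    qed simp
    have kB: "k \<in> Below" unfolding Below_def using lt by auto
    have mB: "m \<notin> Below" using le[of m] lt(2) unfolding Below_def by fastforce
    have "e k \<in> e ` Below" "e m \<notin> e ` Below"
      using kB mB inj S m(1) unfolding Below_def by (auto dest: inj_onD)
    with k(1) m(1) have "e k \<in> e ` S" "e m \<in> e ` S" by blast+
    from connected_in_exit[OF con this(1) \<open>e k \<in> e ` Below\<close> this(2) \<open>e m \<notin> e ` Below\<close>]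
    obtain x y where xy: "(x, y) \<in> parcs T" "x \<in> e ` Below" "y \<in> e ` S" "y \<notin> e ` Below" .
    then obtain i j where ij: "i \<in> Below" "j \<in> S" "x = e i" "y = e j" by blast
    have "i < n" "j < n" "j \<notin> Below" using ij S xy unfolding Below_def by auto
    then have or: "0 < i \<and> j = p i \<or> 0 < j \<and> i = p j" using adj xy ij by auto
    have ik: "(i, k) \<in> R\<^sup>*" using ij(1) unfolding Below_def by blast
    have "\<not> (0 < j \<and> i = p j)"
    proof
      assume "0 < j \<and> i = p j"
      then have "(j, i) \<in> R" using \<open>j < n\<close> by (auto simp: R_def)
      then have "(j, k) \<in> R\<^sup>*" using ik by (rule converse_rtrancl_into_rtrancl)
      then show False using \<open>j \<notin> Below\<close> \<open>j < n\<close> unfolding Below_def by blast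
    qed
    then have ji: "0 < i" "j = p i" using or by auto
    have "i = k"
      using ik
    proof (cases rule: converse_rtranclE)
      case (step b)
      then have "b = j" using ji by (simp add: R_def)
      with step have "(j, k) \<in> R\<^sup>*" by simp
      then show ?thesis using \<open>j \<notin> Below\<close> \<open>j < n\<close> unfolding Below_def by blast
    qed
    then show ?thesis using ji ij pf \<open>i < n\<close> by simp
  qed
  then show "subtree_set p S" unfolding subtree_set_def using m(1) by blast
qed

text \<open>On a cycle, both neighbours of the largest index \<open>M\<close> would be smaller,
  hence both equal to \<open>p M\<close>.\<close>

lemma undirected_tree_index_tree:
  assumes "parent_fun n p"
  shows "undirected_tree (index_tree n p)"
proof -
  let ?T = "index_tree n p"
  have pg: "pair_graph ?T" using pair_graph_index_tree[OF assms] .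
  then have sy: "sym (parcs ?T)" by (simp add: pair_graph_iff)
  have pv: "pverts ?T = {..<n}" by (simp add: index_tree_def)
  have "subtree_set p {..<n}"
    unfolding subtree_set_def
    by (rule bexI[of _ 0]) (use assms in \<open>auto simp: parent_fun_def intro: less_trans\<close>)
  then have "connected ?T"
    using subtree_set_iff_connected[OF tree_enumeration_index_tree[OF assms] _ sy, of "{..<n}"]
    by (simp add: connected_with_proj_iff[OF sy] pv)
  moreover have "\<not> (\<exists>xs. distinct xs \<and> 3 \<le> length xs \<and>
      walk (parcs ?T) xs \<and> (last xs, hd xs) \<in> parcs ?T)"
  proof
    assume "\<exists>xs. distinct xs \<and> 3 \<le> length xs \<and>
      walk (parcs ?T) xs \<and> (last xs, hd xs) \<in> parcs ?T"
    then obtain xs where xs: "distinct xs" "3 \<le> length xs"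
      "walk (parcs ?T) xs" "(last xs, hd xs) \<in> parcs ?T" by blast
    define M where "M = Max (set xs)"
    have "xs \<noteq> []" using xs(2) by auto
    then have "M \<in> set xs" unfolding M_def by simp
    then obtain as bs where split: "xs = as @ M # bs" by (meson split_list)
    \<comment> \<open>The cycle is rotated so that it starts at its maximum; the two ends of
      \<open>ys\<close> are then the neighbours of \<open>M\<close>.\<close>
    define ys where "ys = bs @ as"
    have ys: "distinct (M # ys)" "2 \<le> length ys" "set (M # ys) = set xs"
      using xs(1,2) by (auto simp: ys_def split)
    have "ys \<noteq> []" using ys(2) by auto
    have first: "(M, hd ys) \<in> parcs ?T"
      using xs(3,4) \<open>ys \<noteq> []\<close> unfolding split ys_def
      by (cases bs) (auto simp: successively_append_iff successively_Cons)
    have last: "(last ys, M) \<in> parcs ?T"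
      using xs(3,4) \<open>ys \<noteq> []\<close> unfolding split ys_def
      by (cases as rule: rev_cases) (auto simp: successively_append_iff successively_Cons)
    have down: "y = p M" if "y \<in> set ys" "(M, y) \<in> parcs ?T" for y
    proof -
      have "y \<in> set xs" using that(1) ys(3) by auto
      then have "y \<le> M" unfolding M_def by simp
      then show ?thesis
        using that(2) assms unfolding index_tree_def parent_fun_def by (auto simp: not_less)
    qed
    have "hd ys = p M" using down[OF hd_in_set[OF \<open>ys \<noteq> []\<close>] first] .
    moreover have "last ys = p M" using down[OF last_in_set[OF \<open>ys \<noteq> []\<close>] symD[OF sy last]] .
    ultimately have "hd ys = last ys" by simp
    then show False using ys(1,2) by (cases ys) (auto split: if_splits)
  qed
  ultimately show ?thesis
    unfolding undirected_tree_def cycle_iff_list[OF pg] using pg by blast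
qed

lemma is_parent_iff:
  assumes T: "tree_enumeration T n e p"
  shows "is_parent T (e 0) s t \<longleftrightarrow> (\<exists>k. 0 < k \<and> k < n \<and> t = e k \<and> s = e (p k))"
proof
  have pf: "\<And>k. 0 < k \<Longrightarrow> k < n \<Longrightarrow> p k < k" and n: "0 < n" and inj: "inj_on e {..<n}"
    and img: "e ` {..<n} = pverts T"
    and adj: "\<And>i j. i < n \<Longrightarrow> j < n \<Longrightarrow>
      (e i, e j) \<in> parcs T \<longleftrightarrow> 0 < i \<and> j = p i \<or> 0 < j \<and> i = p j"
    using T by (auto simp: tree_enumeration_def parent_fun_def bij_betw_def)
  {
    assume "is_parent T (e 0) s t"
    then obtain q where "vpath (q @ [s, t]) T" and hd: "hd (q @ [s, t]) = e 0"
      unfolding is_parent_def by blast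
    define xs where "xs = q @ [s, t]"
    have xs: "distinct xs" "set xs \<subseteq> pverts T" "hd xs = e 0"
      "walk (parcs T) xs"
      using \<open>vpath (q @ [s, t]) T\<close> hd unfolding xs_def vpath_iff by auto
    \<comment> \<open>A path from the root never goes back to a parent, so it only descends.\<close>
    have "\<exists>k. 0 < k \<and> k < n \<and> xs ! Suc j = e k \<and> xs ! j = e (p k)" if "Suc j < length xs" for j
      using that
    proof (induction j)
      case 0
      have e: "(xs ! 0, xs ! 1) \<in> parcs T" using xs(4) 0 by (auto simp: successively_conv_nth)
      have "xs ! 1 \<in> pverts T" using xs(2) 0 by auto
      then obtain k where k: "k < n" "xs ! 1 = e k" using img by auto
      have "xs ! 0 = e 0" using xs(3) 0 by (metis hd_conv_nth length_0_conv not_less_zero)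
      then show ?case using e k adj[OF n k(1)] by auto
    next
      case (Suc j)
      then obtain k where k: "0 < k" "k < n" "xs ! Suc j = e k" "xs ! j = e (p k)" by auto
      have e: "(xs ! Suc j, xs ! Suc (Suc j)) \<in> parcs T"
        using xs(4) Suc.prems by (auto simp: successively_conv_nth)
      have "xs ! Suc (Suc j) \<in> pverts T" using xs(2) Suc.prems by auto
      then obtain l where l: "l < n" "xs ! Suc (Suc j) = e l" using img by auto
      have "xs ! Suc (Suc j) \<noteq> xs ! j"
        using xs(1) Suc.prems by (simp add: nth_eq_iff_index_eq)
      then have "l \<noteq> p k" using k l by auto
      then have "0 < l \<and> k = p l" using e k l adj[OF k(2) l(1)] by auto
      then show ?case using k l by auto
    qed
    from this[of "length q"]
    show "\<exists>k. 0 < k \<and> k < n \<and> t = e k \<and> s = e (p k)"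
      by (simp add: xs_def nth_append)
  }
  assume "\<exists>k. 0 < k \<and> k < n \<and> t = e k \<and> s = e (p k)"
  then obtain k where k: "0 < k" "k < n" "t = e k" "s = e (p k)" by blast
  have path: "\<exists>q. vpath (q @ [e k]) T \<and> hd (q @ [e k]) = e 0 \<and> set q \<subseteq> e ` {..<k} \<and>
      (0 < k \<longrightarrow> q \<noteq> [] \<and> last q = e (p k))"
    if "k < n" for k
    using that
  proof (induction k rule: less_induct)
    case (less k)
    show ?case
    proof (cases "k = 0")
      case True
      then show ?thesis using img n by (intro exI[of _ "[]"]) (auto simp: vpath_iff)
    next
      case False
      then have pk: "p k < k" using pf less.prems by simp
      then obtain q where q: "vpath (q @ [e (p k)]) T" "hd (q @ [e (p k)]) = e 0"
        "set q \<subseteq> e ` {..<p k}"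
        using less.IH[of "p k"] less.prems by auto
      have sub: "set (q @ [e (p k)]) \<subseteq> e ` {..<k}" using q(3) pk by auto
      moreover have "e k \<notin> e ` {..<k}" using inj less.prems by (auto dest: inj_onD)
      moreover have "(e (p k), e k) \<in> parcs T"
        using adj[of "p k" k] pk less.prems False by simp
      moreover have "e k \<in> pverts T" using img less.prems by auto
      ultimately have "vpath ((q @ [e (p k)]) @ [e k]) T"
        using q(1) unfolding vpath_iff by (auto simp: successively_append_iff)
      moreover have "hd ((q @ [e (p k)]) @ [e k]) = e 0" using q(2) by (cases q) auto
      ultimately show ?thesis using sub by (intro exI[of _ "q @ [e (p k)]"]) auto
    qed
  qed
  obtain q where q: "vpath (q @ [e k]) T" "hd (q @ [e k]) = e 0" "q \<noteq> []" "last q = e (p k)"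
    using path[OF k(2)] k(1) by auto
  have "q @ [e k] = butlast q @ [s, t]"
    using append_butlast_last_id[OF q(3)] q(4) k(3,4)
    by (metis append.assoc append_Cons append_Nil)
  then show "is_parent T (e 0) s t"
    using q(1,2) unfolding is_parent_def by metis
qed

lemma adhesion_enumeration:
  assumes "tree_enumeration T n e p" "k < n"
  shows "adhesion T (e 0) \<beta> (e k) = (if k = 0 then {} else \<beta> (e k) \<inter> \<beta> (e (p k)))"
proof -
  have inj: "inj_on e {..<n}" and n: "0 < n"
    using assms by (auto simp: tree_enumeration_def bij_betw_def)
  have k0: "e k = e 0 \<longleftrightarrow> k = 0" using inj_onD[OF inj, of k 0] assms(2) n by auto
  have "(THE s. is_parent T (e 0) s (e k)) = e (p k)" if "0 < k"
  proof (rule the_equality)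
    show "is_parent T (e 0) (e (p k)) (e k)"
      using is_parent_iff[OF assms(1)] that assms(2) by blast
  next
    fix s assume "is_parent T (e 0) s (e k)"
    then obtain l where "0 < l" "l < n" "e k = e l" "s = e (p l)"
      using is_parent_iff[OF assms(1)] by blast
    then show "s = e (p k)" using inj_onD[OF inj, of k l] assms(2) by simp
  qed
  then show ?thesis unfolding adhesion_def k0 by simp
qed

lemma parent_decomposition_of_tree_decomposition:
  assumes "tree_decomposition G T \<beta>" "tree_enumeration T n e p"
  shows "parent_decomposition n p (\<lambda>k. \<beta> (e k)) (pverts G) (parcs G)"
proof -
  have img: "e ` {..<n} = pverts T" and pf: "parent_fun n p"
    using assms(2) by (auto simp: tree_enumeration_def bij_betw_def)
  have sy: "sym (parcs T)"
    using assms(1) by (auto simp: tree_decomposition_def undirected_tree_def pair_graph_iff)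
  have bags: "(\<Union>t\<in>pverts T. \<beta> t) = pverts G"
    and edges: "\<And>u v. (u, v) \<in> parcs G \<Longrightarrow> \<exists>t\<in>pverts T. u \<in> \<beta> t \<and> v \<in> \<beta> t"
    and con: "\<And>v. v \<in> pverts G \<Longrightarrow> connected (with_proj T \<restriction> {t \<in> pverts T. v \<in> \<beta> t})"
    using assms(1) by (auto simp: tree_decomposition_def)
  have "subtree_set p {k. k < n \<and> v \<in> \<beta> (e k)}" if v: "v \<in> pverts G" for v
  proof -
    have "e ` {k. k < n \<and> v \<in> \<beta> (e k)} = {t \<in> pverts T. v \<in> \<beta> t}" using img by auto
    moreover have "{k. k < n \<and> v \<in> \<beta> (e k)} \<subseteq> {..<n}" by auto
    ultimately show ?thesis
      using con[OF v] subtree_set_iff_connected[OF assms(2) _ sy]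
      unfolding connected_restrict_iff[OF sy] by auto
  qed
  moreover have "\<exists>k<n. u \<in> \<beta> (e k) \<and> v \<in> \<beta> (e k)" if "(u, v) \<in> parcs G" for u v
    using edges[OF that] unfolding img[symmetric] by blast
  moreover have "\<beta> (e k) \<subseteq> pverts G" if "k < n" for k
    using that bags img by auto
  ultimately show ?thesis unfolding parent_decomposition_def using pf by blast
qed

lemma tree_decomposition_index_tree:
  assumes "parent_decomposition n p \<beta> (pverts G) (parcs G)"
  shows "tree_decomposition G (index_tree n p) \<beta>"
proof -
  have pf: "parent_fun n p" and sub: "\<And>k. k < n \<Longrightarrow> \<beta> k \<subseteq> pverts G"
    and st: "\<And>v. v \<in> pverts G \<Longrightarrow> subtree_set p (nodes n \<beta> v)"
    and edges: "\<And>u v. (u, v) \<in> parcs G \<Longrightarrow> \<exists>k<n. u \<in> \<beta> k \<and> v \<in> \<beta> k"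
    using assms by (auto simp: parent_decomposition_def)
  let ?T = "index_tree n p"
  have pv: "pverts ?T = {..<n}" by (simp add: index_tree_def)
  have sy: "sym (parcs ?T)" using pair_graph_index_tree[OF pf] by (simp add: pair_graph_iff)
  have "\<exists>k<n. v \<in> \<beta> k" if "v \<in> pverts G" for v
    using st[OF that] unfolding subtree_set_def by blast
  then have "(\<Union>t\<in>pverts ?T. \<beta> t) = pverts G" using sub unfolding pv by (auto simp: Bex_def)
  moreover have "connected (with_proj ?T \<restriction> {t \<in> pverts ?T. v \<in> \<beta> t})" if "v \<in> pverts G" for v
  proof -
    have "{t \<in> pverts ?T. v \<in> \<beta> t} = nodes n \<beta> v" by (auto simp: pv)
    moreover have "nodes n \<beta> v \<subseteq> {..<n}" by auto
    ultimately show ?thesis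
      using st[OF that] subtree_set_iff_connected[OF tree_enumeration_index_tree[OF pf] _ sy]
      unfolding connected_restrict_iff[OF sy] by simp
  qed
  ultimately show ?thesis
    unfolding tree_decomposition_def using undirected_tree_index_tree[OF pf] edges
    by (simp add: pv Bex_def lessThan_iff)
qed

lemma width_le_iff:
  assumes "finite (pverts T)" "pverts T \<noteq> {}"
  shows "width T \<beta> \<le> c \<longleftrightarrow> (\<forall>t\<in>pverts T. card (\<beta> t) \<le> Suc c)"
  using assms unfolding width_def by (subst le_diff_conv) (auto simp: Max_le_iff)

text \<open>The decomposition with a single bag shows that the \<open>LEAST\<close> in
  \<open>treewidth\<close> is attained. The rest is an enumeration of the tree; \<open>Suc c\<close>
  undoes the subtraction in \<open>width\<close>.\<close>

lemma treewidth_le_iff: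
  assumes "pair_graph G"
  shows "treewidth G \<le> c \<longleftrightarrow>
    (\<exists>n p \<beta>. parent_decomposition n p \<beta> (pverts G) (parcs G) \<and> (\<forall>k<n. card (\<beta> k) \<le> Suc c))"
proof
  have sub: "parcs G \<subseteq> pverts G \<times> pverts G" using assms by (simp add: pair_graph_iff)
  let ?P = "\<lambda>w. \<exists>(T :: nat pair_pre_digraph) \<beta>. tree_decomposition G T \<beta> \<and> width T \<beta> = w"
  {
    assume le: "treewidth G \<le> c"
    have "subtree_set (\<lambda>_. 0) {k. k < (1::nat) \<and> v \<in> pverts G}" if "v \<in> pverts G" for v
      unfolding subtree_set_def using that by auto
    then have "parent_decomposition 1 (\<lambda>_. 0) (\<lambda>_. pverts G) (pverts G) (parcs G)"
      unfolding parent_decomposition_def parent_fun_def using sub by auto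
    then have "\<exists>w. ?P w" using tree_decomposition_index_tree by blast
    then have "?P (treewidth G)" unfolding treewidth_def by (rule LeastI_ex)
    then obtain T :: "nat pair_pre_digraph" and \<beta>
      where T: "tree_decomposition G T \<beta>" "width T \<beta> \<le> c" using le by auto
    then have ut: "undirected_tree T" by (simp add: tree_decomposition_def)
    then have pg: "pair_graph T" and "connected T" by (auto simp: undirected_tree_def)
    then have ne: "pverts T \<noteq> {}" by (simp add: connected_conv)
    have fin: "finite (pverts T)" using pg by (simp add: pair_graph_iff)
    from ne obtain r where "r \<in> pverts T" by blast
    from undirected_tree_enumeration[OF ut this] obtain n e p
      where e: "tree_enumeration T n e p" "e 0 = r" .
    have "parent_decomposition n p (\<lambda>k. \<beta> (e k)) (pverts G) (parcs G)"
      using parent_decomposition_of_tree_decomposition[OF T(1) e(1)] .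
    moreover have "card (\<beta> (e k)) \<le> Suc c" if "k < n" for k
      using T(2) e(1) that unfolding width_le_iff[OF fin ne]
      by (auto simp: tree_enumeration_def bij_betw_def)
    ultimately show "\<exists>n p \<beta>. parent_decomposition n p \<beta> (pverts G) (parcs G) \<and>
        (\<forall>k<n. card (\<beta> k) \<le> Suc c)" by blast
  }
  assume "\<exists>n p \<beta>. parent_decomposition n p \<beta> (pverts G) (parcs G) \<and>
    (\<forall>k<n. card (\<beta> k) \<le> Suc c)"
  then obtain n p \<beta> where d: "parent_decomposition n p \<beta> (pverts G) (parcs G)"
    "\<forall>k<n. card (\<beta> k) \<le> Suc c" by blast
  have "0 < n" using d(1) by (simp add: parent_decomposition_def parent_fun_def)
  then have "width (index_tree n p) \<beta> \<le> c"
    using d(2) by (subst width_le_iff) (auto simp: index_tree_def)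
  moreover have "treewidth G \<le> width (index_tree n p) \<beta>"
    unfolding treewidth_def
    by (rule Least_le) (use tree_decomposition_index_tree[OF d(1)] in blast)
  ultimately show "treewidth G \<le> c" by simp
qed

section \<open>Quotients of guarded decompositions\<close>

text \<open>A node \<open>k\<close> is split into a centre \<open>k * M\<close>, whose bag is the image of the guard, and one leaf
  \<open>k * M + i\<close> for every block, whose bag contains in addition the \<open>i\<close>-th block if that block
  meets the old bag. The child of \<open>k\<close> whose adhesion exceeds the guard of \<open>k\<close> by a vertex \<open>v\<close> is
  attached to the leaf of the block of \<open>v\<close>.\<close>

lemma guarded_decomposition_quotient:
  fixes blk :: "'a \<Rightarrow> 'b"
  assumes dec: "parent_decomposition n p b V E'" and fin: "finite V" and E: "E \<subseteq> V \<times> V"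
    and hb: "\<And>k. k < n \<Longrightarrow> h k \<subseteq> b k"
    and adh: "\<And>k. 0 < k \<Longrightarrow> k < n \<Longrightarrow> b k \<inter> b (p k) \<subseteq> h k"
    and cut: "\<And>k. 0 < k \<Longrightarrow> k < n \<Longrightarrow> card (b k \<inter> b (p k) - h (p k)) \<le> 1"
    and cover: "\<And>u v. (u, v) \<in> E \<Longrightarrow> \<exists>k<n. u \<in> b k \<and> v \<in> b k \<and> (u \<in> h k \<or> v \<in> h k)"
    and same: "\<And>u v. u \<in> V \<Longrightarrow> v \<in> V \<Longrightarrow> blk u = blk v \<Longrightarrow> \<exists>k<n. u \<in> b k \<and> v \<in> b k"
    and c: "\<And>k. k < n \<Longrightarrow> card (h k) \<le> c"
  shows "\<exists>n' p' bag. parent_decomposition n' p' bag (blk ` V) {(blk u, blk v) | u v. (u, v) \<in> E} \<and>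
    (\<forall>x<n'. card (bag x) \<le> Suc c)"
proof -
  have pf: "\<And>k. 0 < k \<Longrightarrow> k < n \<Longrightarrow> p k < k" and n: "0 < n"
    and bV: "\<And>k. k < n \<Longrightarrow> b k \<subseteq> V"
    and st: "\<And>v. v \<in> V \<Longrightarrow> subtree_set p (nodes n b v)"
    using dec by (auto simp: parent_decomposition_def parent_fun_def)
  \<comment> \<open>Number of slots per node: slot 0 is the centre and the blocks use the slots from
    1 on, so \<open>i v\<close> is never 0.\<close>
  define M where "M = Suc (card (blk ` V))"
  obtain f where f: "bij_betw f (blk ` V) {0..<card (blk ` V)}"
    using ex_bij_betw_finite_nat[of "blk ` V"] fin by blast
  define i where "i v = Suc (f (blk v))" for v
  have iM: "i v < M" if "v \<in> V" for v
    using f that unfolding i_def M_def bij_betw_def by fastforce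
  have i_pos: "0 < i v" for v by (simp add: i_def)
  have i_eq: "i u = i v \<longleftrightarrow> blk u = blk v" if "u \<in> V" "v \<in> V" for u v
    using f that unfolding i_def bij_betw_def by (auto dest: inj_onD)
  have M: "0 < M" by (simp add: M_def)
  \<comment> \<open>The new nodes whose bag receives \<open>v\<close>: the whole star if
    \<open>v\<close> is in the guard, otherwise only the leaf of its block.\<close>
  define B where "B v = {x. x < n * M \<and> (v \<in> h (x div M) \<or> v \<in> b (x div M) \<and> x mod M = i v)}" for v
  \<comment> \<open>The slot in the star of \<open>p k\<close> to which the centre of
    \<open>k\<close> is attached. By \<open>cut\<close> at most one vertex of the adhesion is
    outside the guard, so the choice is unambiguous.\<close>
  define j where "j k = (if b k \<inter> b (p k) \<subseteq> h (p k) then 0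
    else i (SOME v. v \<in> b k \<inter> b (p k) - h (p k)))" for k
  define q where "q x = (if x mod M \<noteq> 0 then x div M * M else p (x div M) * M + j (x div M))" for x
  have divn: "x div M < n" if "x < n * M" for x
    using that by (simp add: less_mult_imp_div_less)
  have nodeM: "k * M + l < n * M" if "k < n" "l < M" for k l
  proof -
    have "k * M + l < Suc k * M" using that by simp
    also have "\<dots> \<le> n * M" using that by (intro mult_le_mono1) simp
    finally show ?thesis .
  qed
  have j_unique: "j k = i v" if "0 < k" "k < n" "v \<in> b k \<inter> b (p k) - h (p k)" for k v
  proof -
    have "finite (b k)" using bV[OF that(2)] fin by (rule finite_subset)
    then have "finite (b k \<inter> b (p k) - h (p k))" by blast
    then have eq: "x = v" if "x \<in> b k \<inter> b (p k) - h (p k)" for x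
      using cut[OF \<open>0 < k\<close> \<open>k < n\<close>] that \<open>v \<in> _\<close> by (auto simp: card_le_Suc0_iff_eq)
    have "(SOME x. x \<in> b k \<inter> b (p k) - h (p k)) = v"
      using eq that(3) by (metis (no_types, lifting) someI)
    then show ?thesis using that(3) unfolding j_def by auto
  qed
  have jM: "j k < M" if "0 < k" "k < n" for k
  proof (cases "b k \<inter> b (p k) \<subseteq> h (p k)")
    case True
    then show ?thesis using M by (simp add: j_def)
  next
    case False
    then obtain v where v: "v \<in> b k \<inter> b (p k) - h (p k)" by blast
    then have "v \<in> V" using bV[OF that(2)] by blast
    then show ?thesis using j_unique[OF that v] iM by simp
  qed
  have q_less: "q x < x" if x: "0 < x" "x < n * M" for x
  proof (cases "x mod M = 0")
    case False
    then have "x div M * M < x" using div_mult_mod_eq[of x M] by linarith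
    then show ?thesis using False by (simp add: q_def)
  next
    case True
    define k where "k = x div M"
    have xk: "x = k * M" using True div_mult_mod_eq[of x M] by (simp add: k_def)
    have "0 < k" using x xk by (cases k) auto
    moreover have kn: "k < n" using x divn by (simp add: k_def)
    ultimately have "p k < k" "j k < M" using pf jM by auto
    then have "p k * M + j k < Suc (p k) * M" by simp
    also have "\<dots> \<le> k * M" using \<open>p k < k\<close> by (intro mult_le_mono1) simp
    finally have "p k * M + j k < x" by (simp only: xk)
    moreover have "q x = p k * M + j k" using True by (simp add: q_def k_def)
    ultimately show ?thesis by simp
  qed
  have stB: "subtree_set q (B v)" if v: "v \<in> V" for v
  proof -
    obtain k0 where k0: "k0 < n" "v \<in> b k0"
      "\<And>k. k < n \<Longrightarrow> v \<in> b k \<Longrightarrow> k \<noteq> k0 \<Longrightarrow> v \<in> b (p k) \<and> p k < n \<and> p k < k"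
      using st[OF v] unfolding subtree_set_def by auto
    \<comment> \<open>At every node other than its topmost one, \<open>k0\<close>, the vertex lies
      in the adhesion and so in the guard. Only at \<open>k0\<close> can it be restricted to a
      leaf.\<close>
    define top where "top = (if v \<in> h k0 then k0 * M else k0 * M + i v)"
    have "top \<in> B v"
      using k0 iM[OF v] M nodeM[OF k0(1) M] nodeM[OF k0(1) iM[OF v]] by (simp add: top_def B_def)
    moreover have "q x \<in> B v \<and> q x < x" if x: "x \<in> B v" "x \<noteq> top" for x
    proof -
      define k where "k = x div M"
      have xM: "x < n * M" and kn: "k < n" using x(1) divn by (auto simp: B_def k_def)
      have xk: "x = k * M + x mod M" by (simp add: k_def)
      have vb: "v \<in> b k" using x(1) hb[OF kn] by (auto simp: B_def k_def)
      show ?thesis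
      proof (cases "x mod M = 0")
        case False
        have "v \<in> h k"
        proof (rule ccontr)
          assume nh: "v \<notin> h k"
          then have xi: "x = k * M + i v" using x(1) xk by (simp add: B_def k_def)
          show False
          proof (cases "k = k0")
            case True
            then show False using x(2) xi nh by (simp add: top_def)
          next
            case False
            then have "v \<in> b (p k)" "p k < k" using k0(3)[OF kn vb] by auto
            then have "v \<in> h k" using adh[of k] kn vb by auto
            then show False using nh by simp
          qed
        qed
        moreover have "q x = k * M" using False by (simp add: q_def k_def)
        moreover have "0 < x" using False by (cases x) auto
        ultimately show ?thesis using M nodeM[OF kn M] q_less[OF _ xM] by (simp add: B_def)
      next
        case True
        then have vh: "v \<in> h k" using x(1) i_pos[of v] by (simp add: B_def k_def)
        then have "k \<noteq> k0" using x(2) xk True by (auto simp: top_def)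
        then have pk: "v \<in> b (p k)" "p k < n" "p k < k" using k0(3)[OF kn vb] by auto
        then have k_pos: "0 < k" by simp
        have qx: "q x = p k * M + j k" using True by (simp add: q_def k_def)
        have "q x div M = p k" "q x mod M = j k"
          using qx jM[OF k_pos kn] by auto
        moreover have "v \<in> h (p k) \<or> j k = i v"
          using j_unique[OF k_pos kn] vb pk(1) by blast
        moreover have "q x < n * M" using qx nodeM[OF pk(2) jM[OF k_pos kn]] by simp
        moreover have "0 < x" using k_pos by (cases x) (auto simp: k_def)
        then have "q x < x" using q_less xM by blast
        ultimately show ?thesis using pk(1) by (auto simp: B_def)
      qed
    qed
    ultimately show ?thesis unfolding subtree_set_def by blast
  qed
  define bag where "bag x = blk ` {v \<in> V. x \<in> B v}" for x
  have "parent_fun (n * M) q" unfolding parent_fun_def using n M q_less by simp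
  moreover have "bag x \<subseteq> blk ` V" for x by (auto simp: bag_def)
  moreover have "subtree_set q {x. x < n * M \<and> l \<in> bag x}" if "l \<in> blk ` V" for l
  proof -
    define C where "C = {v \<in> V. blk v = l}"
    have "{x. x < n * M \<and> l \<in> bag x} = (\<Union>v\<in>C. B v)"
      by (auto simp: bag_def C_def B_def)
    moreover have "subtree_set q (\<Union>v\<in>C. B v)"
    \<comment> \<open>Two members of a block share an old bag by \<open>same\<close>, and there they
      meet in the leaf of their common block.\<close>
    proof (rule subtree_set_UN[where E = UNIV])
      show "connected_in UNIV C" by (auto simp: connected_in_def)
      show "C \<noteq> {}" using that by (auto simp: C_def)
      show "subtree_set q (B v)" if "v \<in> C" for v using that stB by (simp add: C_def)
      fix u v assume uv: "u \<in> C" "v \<in> C"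
      then have V: "u \<in> V" "v \<in> V" and eq: "blk u = blk v" by (auto simp: C_def)
      obtain k where k: "k < n" "u \<in> b k" "v \<in> b k" using same[OF V eq] by blast
      have "i u = i v" using i_eq[OF V] eq by simp
      then have "k * M + i v \<in> B u \<inter> B v"
        using k iM[OF V(2)] nodeM[OF k(1) iM[OF V(2)]] by (simp add: B_def)
      then show "B u \<inter> B v \<noteq> {}" by blast
    qed
    ultimately show ?thesis by simp
  qed
  moreover have "\<exists>x<n * M. l \<in> bag x \<and> l' \<in> bag x"
    if "(l, l') \<in> {(blk u, blk v) | u v. (u, v) \<in> E}" for l l'
  proof -
    obtain u v where uv: "(u, v) \<in> E" "l = blk u" "l' = blk v" using \<open>(l, l') \<in> _\<close> by auto
    then have V: "u \<in> V" "v \<in> V" using E by auto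
    obtain k where k: "k < n" "u \<in> b k" "v \<in> b k" "u \<in> h k \<or> v \<in> h k"
      using cover[OF uv(1)] by blast
    have "\<exists>x. x \<in> B u \<and> x \<in> B v"
    proof (cases "u \<in> h k")
      case True
      then have "k * M + i v \<in> B u \<and> k * M + i v \<in> B v"
        using k iM[OF V(2)] nodeM[OF k(1) iM[OF V(2)]] by (simp add: B_def)
      then show ?thesis by blast
    next
      case False
      then have "k * M + i u \<in> B u \<and> k * M + i u \<in> B v"
        using k iM[OF V(1)] nodeM[OF k(1) iM[OF V(1)]] by (simp add: B_def)
      then show ?thesis by blast
    qed
    then obtain x where "x \<in> B u" "x \<in> B v" by blast
    moreover from this have "x < n * M" by (simp add: B_def)
    ultimately show ?thesis using V uv by (auto simp: bag_def)
  qed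
  moreover have "card (bag x) \<le> Suc c" if "x < n * M" for x
  proof -
    define k where "k = x div M"
    have kn: "k < n" using divn[OF that] by (simp add: k_def)
    have finh: "finite (h k)" using hb[OF kn] bV[OF kn] fin by (meson finite_subset)
    \<comment> \<open>The block that owns the slot of \<open>x\<close>, if there is one; it is the
      one element beyond the guard in \<open>Suc c\<close>.\<close>
    define L where "L = {l \<in> blk ` V. Suc (f l) = x mod M}"
    have "l = l'" if "l \<in> L" "l' \<in> L" for l l'
      using f that unfolding L_def bij_betw_def by (auto intro: inj_onD[of f "blk ` V"])
    moreover have "finite L" using fin by (simp add: L_def)
    ultimately have "card L \<le> Suc 0" by (simp add: card_le_Suc0_iff_eq)
    have "bag x \<subseteq> blk ` h k \<union> L"
      by (auto simp: bag_def B_def L_def k_def i_def)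
    then have "card (bag x) \<le> card (blk ` h k \<union> L)"
      using fin finh by (intro card_mono) (auto simp: L_def)
    also have "\<dots> \<le> card (blk ` h k) + card L" by (rule card_Un_le)
    also have "\<dots> \<le> c + 1"
      using card_image_le[OF finh, of blk] c[OF kn] \<open>card L \<le> Suc 0\<close> by simp
    finally show ?thesis by simp
  qed
  ultimately show ?thesis
    unfolding parent_decomposition_def by (intro exI[of _ "n * M"] exI[of _ q] exI[of _ bag]) blast
qed

lemma parcs_make_cliques:
  "parcs (make_cliques H I) = parcs (ugraph H) \<union>
     {(u, v). u \<noteq> v \<and> u \<in> pverts (ugraph H) \<and> v \<in> pverts (ugraph H) \<and> color H u = color H v \<and>
       color H u \<in> I}"
  by (auto simp: make_cliques_def color_class_def)

lemma pverts_make_cliques [simp]: "pverts (make_cliques H I) = pverts (ugraph H)"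
  by (simp add: make_cliques_def)

lemma parcs_bullet:
  "parcs (bullet H) = parcs (ugraph H) \<union>
     {(u, v). u \<noteq> v \<and> u \<in> pverts (ugraph H) \<and> v \<in> pverts (ugraph H) \<and> color H u = color H v}"
  unfolding bullet_def parcs_make_cliques by (auto simp: colors_def)

lemma pverts_bullet [simp]: "pverts (bullet H) = pverts (ugraph H)"
  by (simp add: bullet_def)

lemma pair_graph_make_cliques:
  assumes "colored_graph H"
  shows "pair_graph (make_cliques H I)"
  using assms unfolding colored_graph_def pair_graph_iff parcs_make_cliques
  by (auto simp: sym_def)

lemma pair_graph_identify:
  assumes "colored_graph H" "partition_on (pverts (ugraph H)) P"
    "\<forall>B\<in>P. independent_set (ugraph H) B"
  shows "pair_graph (ugraph (identify H P))"
proof -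
  have "finite (pverts (ugraph H))" and sy: "sym (parcs (ugraph H))"
    using assms(1) by (auto simp: colored_graph_iff)
  then have "finite P" using assms(2) by (metis finite_UnionD partition_onD1)
  then show ?thesis
    using assms(3) sy unfolding pair_graph_iff identify_def independent_set_def
    by (auto simp: sym_def) blast
qed

lemma partition_on_block_of:
  assumes "partition_on V P"
  obtains blk where "blk ` V = P" "\<forall>B\<in>P. \<forall>v. v \<in> B \<longleftrightarrow> v \<in> V \<and> blk v = B"
proof
  define blk where "blk v = (THE B. B \<in> P \<and> v \<in> B)" for v
  have blk: "blk v = B" if "B \<in> P" "v \<in> B" for v B
    unfolding blk_def
    by (rule the_equality) (use that assms in \<open>auto simp: partition_on_def disjoint_def\<close>)
  have iff: "v \<in> B \<longleftrightarrow> v \<in> V \<and> blk v = B" if "B \<in> P" for v B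
  proof
    assume "v \<in> B"
    then show "v \<in> V \<and> blk v = B" using blk that partition_onD1[OF assms] by blast
  next
    assume v: "v \<in> V \<and> blk v = B"
    then obtain B' where "B' \<in> P" "v \<in> B'" using partition_onD1[OF assms] by blast
    then show "v \<in> B" using blk v by blast
  qed
  then show "\<forall>B\<in>P. \<forall>v. v \<in> B \<longleftrightarrow> v \<in> V \<and> blk v = B" by blast
  show "blk ` V = P"
  proof
    show "blk ` V \<subseteq> P" using blk partition_onD1[OF assms] by auto
    show "P \<subseteq> blk ` V"
    proof
      fix B assume B: "B \<in> P"
      then obtain v where "v \<in> B" using partition_onD3[OF assms] by (metis ex_in_conv)
      then show "B \<in> blk ` V" using iff[OF B] by blast
    qed
  qed
qed

text \<open>The class cliques of \<open>bullet\<close> enter here: two vertices of one block have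
  the same color, hence are equal or adjacent and share a bag, as the construction of the quotient
  decomposition requires.\<close>

lemma spasm_treewidth_le_guard_size:
  assumes H: "colored_graph H" and F: "F \<in> Spasm H"
    and dec: "guarded_cutvertex_decomposition H T r \<beta> g" and size: "guard_size T g \<le> c"
  shows "treewidth (ugraph F) \<le> c"
proof -
  let ?V = "pverts (ugraph H)" and ?E = "parcs (ugraph H)"
  have fin: "finite ?V" and E: "?E \<subseteq> ?V \<times> ?V"
    using H by (auto simp: colored_graph_iff)
  obtain P where P: "F = identify H P" "partition_on ?V P"
    "\<forall>B\<in>P. monochromatic H B \<and> independent_set (ugraph H) B"
    using F unfolding Spasm_def by blast
  have td: "tree_decomposition (bullet H) T \<beta>" and r: "r \<in> pverts T"
    and guards: "\<And>t. t \<in> pverts T \<Longrightarrow> adhesion T r \<beta> t \<subseteq> g t \<and> g t \<subseteq> \<beta> t"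
    and cover: "\<And>t. t \<in> pverts T \<Longrightarrow> vertex_cover (with_proj (ugraph H) \<restriction> \<beta> t) (g t)"
    and cut: "\<And>t t'. t \<in> pverts T \<Longrightarrow> t' \<in> pverts T \<Longrightarrow> is_parent T r t t' \<Longrightarrow>
        card (adhesion T r \<beta> t' - g t) \<le> 1"
    using dec unfolding guarded_cutvertex_decomposition_def by auto
  have ut: "undirected_tree T" using td by (simp add: tree_decomposition_def)
  from undirected_tree_enumeration[OF ut r] obtain n e p
    where e: "tree_enumeration T n e p" "e 0 = r" .
  have pd: "parent_decomposition n p (\<lambda>k. \<beta> (e k)) ?V (parcs (bullet H))"
    using parent_decomposition_of_tree_decomposition[OF td e(1)] by simp
  have img: "e k \<in> pverts T" if "k < n" for k
    using e(1) that by (auto simp: tree_enumeration_def bij_betw_def)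
  have pf: "p k < k" if "0 < k" "k < n" for k
    using e(1) that by (auto simp: tree_enumeration_def parent_fun_def)
  have finT: "finite (pverts T)"
    using ut by (auto simp: undirected_tree_def pair_graph_iff)
  have adh: "adhesion T r \<beta> (e k) = \<beta> (e k) \<inter> \<beta> (e (p k))" if "0 < k" "k < n" for k
    using adhesion_enumeration[OF e(1) that(2)] that(1) e(2) by simp
  from partition_on_block_of[OF P(2)] obtain blk
    where blk: "blk ` ?V = P" "\<forall>B\<in>P. \<forall>v. v \<in> B \<longleftrightarrow> v \<in> ?V \<and> blk v = B" .
  have "\<exists>n' p' bag. parent_decomposition n' p' bag (blk ` ?V) {(blk u, blk v) | u v. (u, v) \<in> ?E} \<and>
    (\<forall>x<n'. card (bag x) \<le> Suc c)"
  proof (rule guarded_decomposition_quotient[OF pd fin E, where h = "\<lambda>k. g (e k)"])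
    show "g (e k) \<subseteq> \<beta> (e k)" if "k < n" for k using guards[OF img[OF that]] by blast
    show "\<beta> (e k) \<inter> \<beta> (e (p k)) \<subseteq> g (e k)" if "0 < k" "k < n" for k
      using guards[OF img[OF that(2)]] adh[OF that] by simp
    show "card (\<beta> (e k) \<inter> \<beta> (e (p k)) - g (e (p k))) \<le> 1" if "0 < k" "k < n" for k
    proof -
      have "is_parent T r (e (p k)) (e k)" using is_parent_iff[OF e(1)] e(2) that by auto
      moreover have "p k < n" using pf[OF that] that(2) by simp
      ultimately show ?thesis using cut[of "e (p k)" "e k"] img that adh[OF that] by simp
    qed
    show "\<exists>k<n. u \<in> \<beta> (e k) \<and> v \<in> \<beta> (e k) \<and> (u \<in> g (e k) \<or> v \<in> g (e k))"
      if uv: "(u, v) \<in> ?E" for u v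
    proof -
      have "(u, v) \<in> parcs (bullet H)" using uv by (simp add: parcs_bullet)
      then obtain k where k: "k < n" "u \<in> \<beta> (e k)" "v \<in> \<beta> (e k)"
        using pd unfolding parent_decomposition_def by blast
      then show ?thesis
        using cover[OF img[OF k(1)]] uv unfolding vertex_cover_def by fastforce
    qed
    show "\<exists>k<n. u \<in> \<beta> (e k) \<and> v \<in> \<beta> (e k)"
      if uv: "u \<in> ?V" "v \<in> ?V" "blk u = blk v" for u v
    proof (cases "u = v")
      case True
      then show ?thesis
        using pd uv(1) unfolding parent_decomposition_def subtree_set_def by blast
    next
      case False
      have "blk u \<in> P" using blk(1) uv(1) by blast
      then obtain i where "blk u \<subseteq> color_class H i" using P(3) unfolding monochromatic_def by blast
      moreover have "u \<in> blk u" "v \<in> blk u" using bspec[OF blk(2) \<open>blk u \<in> P\<close>] uv by auto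
      ultimately have "color H u = color H v" by (auto simp: color_class_def)
      then have "(u, v) \<in> parcs (bullet H)" using uv False by (simp add: parcs_bullet)
      then show ?thesis using pd unfolding parent_decomposition_def by blast
    qed
    show "card (g (e k)) \<le> c" if "k < n" for k
    proof -
      have "card (g (e k)) \<le> (MAX t\<in>pverts T. card (g t))"
        by (rule Max_ge) (use finT img[OF that] in auto)
      then show ?thesis using size unfolding guard_size_def by simp
    qed
  qed
  moreover have "pverts (ugraph F) = blk ` ?V" using P(1) blk(1) by (simp add: identify_def)
  moreover have "parcs (ugraph F) = {(blk u, blk v) | u v. (u, v) \<in> ?E}"
  proof -
    have iff: "(A, B) \<in> parcs (ugraph F) \<longleftrightarrow> (\<exists>u v. (u, v) \<in> ?E \<and> A = blk u \<and> B = blk v)" for A B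
    proof
      assume "(A, B) \<in> parcs (ugraph F)"
      then obtain u v where "A \<in> P" "B \<in> P" "u \<in> A" "v \<in> B" "(u, v) \<in> ?E"
        unfolding P(1) identify_def by auto
      then show "\<exists>u v. (u, v) \<in> ?E \<and> A = blk u \<and> B = blk v" using blk(2) by metis
    next
      assume "\<exists>u v. (u, v) \<in> ?E \<and> A = blk u \<and> B = blk v"
      then obtain u v where uv: "(u, v) \<in> ?E" "A = blk u" "B = blk v" by blast
      then have V: "u \<in> ?V" "v \<in> ?V" using E by auto
      then have "A \<in> P" "B \<in> P" using uv blk(1) by auto
      moreover from this have "u \<in> A" "v \<in> B" using blk(2) V uv by auto
      ultimately show "(A, B) \<in> parcs (ugraph F)" using uv(1) unfolding P(1) identify_def by auto
    qed
    show ?thesis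
    proof (rule set_eqI)
      fix x :: "'a set \<times> 'a set"
      show "x \<in> parcs (ugraph F) \<longleftrightarrow> x \<in> {(blk u, blk v) | u v. (u, v) \<in> ?E}"
        using iff[of "fst x" "snd x"] by (cases x) auto
    qed
  qed
  moreover have "pair_graph (ugraph F)" using pair_graph_identify[OF H P(2)] P(1,3) by blast
  ultimately show ?thesis by (simp only: treewidth_le_iff)
qed

section \<open>Quotients of small treewidth\<close>

text \<open>Blocks may be named by labels of any type, namely as the fibres of \<open>f\<close>.
  This allows quotients to be defined by case distinction instead of by a set of sets.\<close>

lemma spasm_label_decomposition:
  fixes f :: "'a \<Rightarrow> 'l"
  assumes H: "colored_graph H" and tw: "\<forall>F\<in>Spasm H. treewidth (ugraph F) \<le> c"
    and f: "\<And>u v. u \<in> pverts (ugraph H) \<Longrightarrow> v \<in> pverts (ugraph H) \<Longrightarrow> f u = f v \<Longrightarrow>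
      color H u = color H v \<and> (u, v) \<notin> parcs (ugraph H)"
  obtains n p bag where "parent_decomposition n p bag (f ` pverts (ugraph H))
      {(f u, f v) | u v. (u, v) \<in> parcs (ugraph H)}"
    "\<forall>k<n. card (bag k) \<le> Suc c"
proof -
  let ?V = "pverts (ugraph H)" and ?E = "parcs (ugraph H)"
  have fin: "finite ?V" and E: "?E \<subseteq> ?V \<times> ?V"
    using H by (auto simp: colored_graph_iff)
  define fib where "fib l = {v \<in> ?V. f v = l}" for l
  define P where "P = fib ` f ` ?V"
  have part: "partition_on ?V P"
    by (rule partition_onI) (auto simp: P_def fib_def disjnt_def)
  have mono: "monochromatic H B \<and> independent_set (ugraph H) B" if B: "B \<in> P" for B
  proof -
    obtain w where w: "w \<in> ?V" "B = fib (f w)" using B unfolding P_def by blast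
    have B': "x \<in> ?V \<and> f x = f w" if "x \<in> B" for x using that w by (simp add: fib_def)
    then have "x \<in> color_class H (color H w)" if "x \<in> B" for x
      using f[of x w] that w(1) by (simp add: color_class_def)
    then have "B \<subseteq> color_class H (color H w)" by blast
    moreover have "(x, y) \<notin> ?E" if "x \<in> B" "y \<in> B" for x y
      using f[of x y] B'[OF that(1)] B'[OF that(2)] by simp
    then have "independent_set (ugraph H) B" unfolding independent_set_def by blast
    ultimately show ?thesis unfolding monochromatic_def by blast
  qed
  let ?F = "identify H P"
  have "?F \<in> Spasm H" unfolding Spasm_def using part mono by blast
  then have "treewidth (ugraph ?F) \<le> c" using tw by blast
  moreover have "pair_graph (ugraph ?F)" using pair_graph_identify[OF H part] mono by blast
  ultimately obtain n p \<beta> where \<beta>: "parent_decomposition n p \<beta> (pverts (ugraph ?F)) (parcs (ugraph ?F))"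
    "\<forall>k<n. card (\<beta> k) \<le> Suc c"
    using treewidth_le_iff by blast
  have pF: "pverts (ugraph ?F) = P" by (simp add: identify_def)
  define bag where "bag k = {l \<in> f ` ?V. fib l \<in> \<beta> k}" for k
  have "parent_decomposition n p bag (f ` ?V) {(f u, f v) | u v. (u, v) \<in> ?E}"
    unfolding parent_decomposition_def
  proof (intro conjI ballI allI impI)
    show "parent_fun n p" using \<beta>(1) by (simp add: parent_decomposition_def)
    show "bag k \<subseteq> f ` ?V" for k by (auto simp: bag_def)
    show "subtree_set p (nodes n bag l)" if "l \<in> f ` ?V" for l
    proof -
      have "fib l \<in> P" using that by (simp add: P_def)
      then have "subtree_set p (nodes n \<beta> (fib l))"
        using \<beta>(1) pF by (simp add: parent_decomposition_def)
      then show ?thesis using that by (simp add: bag_def)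
    qed
    fix l l' assume "(l, l') \<in> {(f u, f v) | u v. (u, v) \<in> ?E}"
    then obtain u v where uv: "(u, v) \<in> ?E" "l = f u" "l' = f v" by auto
    then have V: "u \<in> ?V" "v \<in> ?V" using E by auto
    then have "fib l \<in> P" "fib l' \<in> P" "u \<in> fib l" "v \<in> fib l'"
      using uv by (auto simp: P_def fib_def)
    then have "(fib l, fib l') \<in> parcs (ugraph ?F)" using uv(1) by (auto simp: identify_def)
    then obtain k where "k < n" "fib l \<in> \<beta> k" "fib l' \<in> \<beta> k"
      using \<beta>(1) unfolding parent_decomposition_def by blast
    then show "\<exists>k<n. l \<in> bag k \<and> l' \<in> bag k" using uv V by (auto simp: bag_def)
  qed
  moreover have "card (bag k) \<le> Suc c" if k: "k < n" for k
  proof -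
    have "\<beta> k \<subseteq> P" using \<beta>(1) k pF by (simp add: parent_decomposition_def)
    moreover have "finite P" using fin by (simp add: P_def)
    ultimately have "finite (\<beta> k)" by (rule finite_subset)
    moreover have "inj_on fib (bag k)"
      by (rule inj_onI) (auto simp: bag_def fib_def)
    moreover have "fib ` bag k \<subseteq> \<beta> k" by (auto simp: bag_def)
    ultimately have "card (bag k) \<le> card (\<beta> k)" by (metis card_inj_on_le)
    then show ?thesis using \<beta>(2) k by fastforce
  qed
  ultimately show ?thesis using that by blast
qed

text \<open>A quotient with as few blocks as possible has this property.\<close>

lemma minimal_quotient:
  assumes H: "colored_graph H"
  obtains f :: "'a \<Rightarrow> 'a" where
    "\<forall>u\<in>pverts (ugraph H). \<forall>v\<in>pverts (ugraph H). f u = f v \<longrightarrow>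
      color H u = color H v \<and> (u, v) \<notin> parcs (ugraph H)"
    "\<forall>u\<in>pverts (ugraph H). \<forall>v\<in>pverts (ugraph H). color H u = color H v \<longrightarrow> f u \<noteq> f v \<longrightarrow>
      (\<exists>u' v'. f u' = f u \<and> f v' = f v \<and> (u', v') \<in> parcs (ugraph H))"
proof -
  let ?V = "pverts (ugraph H)" and ?E = "parcs (ugraph H)"
  have fin: "finite ?V" and E: "?E \<subseteq> ?V \<times> ?V" and sy: "sym ?E" and irr: "\<And>u. (u, u) \<notin> ?E"
    using H by (auto simp: colored_graph_iff)
  define Q where "Q f \<longleftrightarrow> (\<forall>u\<in>?V. \<forall>v\<in>?V. f u = f v \<longrightarrow> color H u = color H v \<and> (u, v) \<notin> ?E)"
    for f :: "'a \<Rightarrow> 'a"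
  have "Q id" using irr by (auto simp: Q_def)
  then obtain f where f: "Q f" "\<And>g. Q g \<Longrightarrow> card (f ` ?V) \<le> card (g ` ?V)"
    using ex_has_least_nat[of Q id "\<lambda>f. card (f ` ?V)"] by blast
  have "\<exists>u' v'. f u' = f u \<and> f v' = f v \<and> (u', v') \<in> ?E"
    if uv: "u \<in> ?V" "v \<in> ?V" "color H u = color H v" "f u \<noteq> f v" for u v
  proof (rule ccontr)
    assume no: "\<not> ?thesis"
    then have no': "(w, w') \<notin> ?E" if "f w = f u" "f w' = f v" for w w' using that by blast
    have no'': "(w, w') \<notin> ?E" if "f w = f v" "f w' = f u" for w w'
      using no'[OF that(2,1)] symD[OF sy] by blast
    \<comment> \<open>Merging two blocks of one color without an edge between them gives an
      admissible quotient with fewer blocks.\<close>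
    define g where "g w = (if f w = f v then f u else f w)" for w
    have fQ: "color H w = color H w' \<and> (w, w') \<notin> ?E" if "w \<in> ?V" "w' \<in> ?V" "f w = f w'" for w w'
      using f(1) that unfolding Q_def by blast
    have "Q g"
      unfolding Q_def
    proof (intro ballI impI)
      fix w w' assume w: "w \<in> ?V" "w' \<in> ?V" "g w = g w'"
      consider "f w = f w'" | "f w = f v" "f w' = f u" | "f w = f u" "f w' = f v"
        using w(3) by (auto simp: g_def split: if_splits)
      then show "color H w = color H w' \<and> (w, w') \<notin> ?E"
      proof cases
        case 1
        then show ?thesis using fQ w by blast
      next
        case 2
        then show ?thesis using fQ[OF w(1) uv(2)] fQ[OF w(2) uv(1)] uv(3) no'' by simp
      next
        case 3
        then show ?thesis using fQ[OF w(1) uv(1)] fQ[OF w(2) uv(2)] uv(3) no' by simp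
      qed
    qed
    have "g ` ?V \<subseteq> f ` ?V - {f v}" using uv by (auto simp: g_def)
    then have "g ` ?V \<subset> f ` ?V" using uv(2) by blast
    then have "card (g ` ?V) < card (f ` ?V)" using fin by (intro psubset_card_mono) auto
    then show False using f(2)[OF \<open>Q g\<close>] by simp
  qed
  then show ?thesis using that f(1) unfolding Q_def by blast
qed

lemma pair_graph_class_graph:
  assumes "colored_graph H"
  shows "pair_graph (class_graph H)"
proof -
  have fin: "finite (pverts (ugraph H))" and sy: "sym (parcs (ugraph H))"
    using assms by (auto simp: colored_graph_iff)
  have "(j, i) \<in> parcs (class_graph H)" if "(i, j) \<in> parcs (class_graph H)" for i j
    using that symD[OF sy] unfolding class_graph_def by auto
  then have "sym (parcs (class_graph H))" by (rule symI)
  then show ?thesis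
    using fin unfolding pair_graph_iff
    by (auto simp: class_graph_def colors_def color_class_def)
qed

context
  fixes H :: "('a, 'c) colored_graph" and c :: nat
  assumes H: "colored_graph H" and tw: "\<forall>F\<in>Spasm H. treewidth (ugraph F) \<le> c"
begin

text \<open>The last clause is what remains of the adjacency of any two blocks of one color in a
  minimal quotient; it also covers equal blocks, whose node set is nonempty.\<close>

definition clique_quotient ::
  "('a \<Rightarrow> 'a) \<Rightarrow> nat \<Rightarrow> (nat \<Rightarrow> nat) \<Rightarrow> (nat \<Rightarrow> 'a set) \<Rightarrow> bool" where
  "clique_quotient f n p bag \<longleftrightarrow>
     (\<forall>u\<in>pverts (ugraph H). \<forall>v\<in>pverts (ugraph H). f u = f v \<longrightarrow>
       color H u = color H v \<and> (u, v) \<notin> parcs (ugraph H)) \<and>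
     parent_decomposition n p bag (f ` pverts (ugraph H))
       {(f u, f v) | u v. (u, v) \<in> parcs (ugraph H)} \<and>
     (\<forall>k<n. card (bag k) \<le> Suc c) \<and>
     (\<forall>u\<in>pverts (ugraph H). \<forall>v\<in>pverts (ugraph H). color H u = color H v \<longrightarrow>
       nodes n bag (f u) \<inter> nodes n bag (f v) \<noteq> {})"

lemma clique_quotient_exists: "\<exists>f n p bag. clique_quotient f n p bag"
proof -
  let ?V = "pverts (ugraph H)" and ?E = "parcs (ugraph H)"
  obtain f :: "'a \<Rightarrow> 'a" where f: "\<forall>u\<in>?V. \<forall>v\<in>?V. f u = f v \<longrightarrow> color H u = color H v \<and> (u, v) \<notin> ?E"
    and adj: "\<forall>u\<in>?V. \<forall>v\<in>?V. color H u = color H v \<longrightarrow> f u \<noteq> f v \<longrightarrow>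
      (\<exists>u' v'. f u' = f u \<and> f v' = f v \<and> (u', v') \<in> ?E)"
    by (rule minimal_quotient[OF H])
  have "\<And>u v. u \<in> ?V \<Longrightarrow> v \<in> ?V \<Longrightarrow> f u = f v \<Longrightarrow> color H u = color H v \<and> (u, v) \<notin> ?E"
    using f by blast
  from spasm_label_decomposition[OF H tw this] obtain n p bag
    where d: "parent_decomposition n p bag (f ` ?V) {(f u, f v) | u v. (u, v) \<in> ?E}"
      "\<forall>k<n. card (bag k) \<le> Suc c" .
  have "nodes n bag (f u) \<inter> nodes n bag (f v) \<noteq> {}"
    if uv: "u \<in> ?V" "v \<in> ?V" "color H u = color H v" for u v
  proof (cases "f u = f v")
    case True
    then show ?thesis
      using d(1) uv(1) unfolding parent_decomposition_def subtree_set_def by fastforce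
  next
    case False
    then obtain u' v' where eq: "f u' = f u" "f v' = f v" and "(u', v') \<in> ?E" using adj uv by blast
    then have "(f u', f v') \<in> {(f u, f v) | u v. (u, v) \<in> ?E}" by blast
    then have "(f u, f v) \<in> {(f u, f v) | u v. (u, v) \<in> ?E}" unfolding eq .
    then obtain k where "k < n" "f u \<in> bag k" "f v \<in> bag k"
      using d(1) unfolding parent_decomposition_def by blast
    then show ?thesis by blast
  qed
  then have "clique_quotient f n p bag" unfolding clique_quotient_def using f d by blast
  then show ?thesis by blast
qed

text \<open>Every block in a bag is replaced by its color. The nodes of a color are a union of
  pairwise meeting subtrees, and bags do not grow since a block has only one color.\<close>

lemma treewidth_class_graph_le: "treewidth (class_graph H) \<le> c"
proof -
  let ?V = "pverts (ugraph H)" and ?E = "parcs (ugraph H)"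
  have E: "?E \<subseteq> ?V \<times> ?V" and fin: "finite ?V"
    using H by (auto simp: colored_graph_iff)
  obtain f n p bag where cq: "clique_quotient f n p bag" using clique_quotient_exists by blast
  note f = cq[unfolded clique_quotient_def, THEN conjunct1]
    and d = cq[unfolded clique_quotient_def, THEN conjunct2, THEN conjunct1]
    and card = cq[unfolded clique_quotient_def, THEN conjunct2, THEN conjunct2, THEN conjunct1]
    and meet = cq[unfolded clique_quotient_def, THEN conjunct2, THEN conjunct2, THEN conjunct2]
  define \<delta> where "\<delta> k = color H ` {v \<in> ?V. f v \<in> bag k}" for k
  have "parent_decomposition n p \<delta> (pverts (class_graph H)) (parcs (class_graph H))"
    unfolding parent_decomposition_def
  proof (intro conjI ballI allI impI)
    show "parent_fun n p" using d by (simp add: parent_decomposition_def)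
    show "\<delta> k \<subseteq> pverts (class_graph H)" for k
      by (auto simp: \<delta>_def class_graph_def colors_def)
    show "subtree_set p (nodes n \<delta> i)" if "i \<in> pverts (class_graph H)" for i
    proof -
      have "nodes n \<delta> i = (\<Union>v\<in>color_class H i. nodes n bag (f v))"
        by (auto simp: \<delta>_def color_class_def)
      moreover have "subtree_set p (\<Union>v\<in>color_class H i. nodes n bag (f v))"
      proof (rule subtree_set_UN[where E = UNIV])
        show "connected_in UNIV (color_class H i)" by (auto simp: connected_in_def)
        show "color_class H i \<noteq> {}"
          using that by (auto simp: class_graph_def colors_def color_class_def)
        show "subtree_set p (nodes n bag (f v))" if "v \<in> color_class H i" for v
          using d that by (simp add: parent_decomposition_def color_class_def)
        show "nodes n bag (f u) \<inter> nodes n bag (f v) \<noteq> {}"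
          if "u \<in> color_class H i" "v \<in> color_class H i" for u v
          using meet that by (simp add: color_class_def)
      qed
      ultimately show ?thesis by simp
    qed
    fix i j assume "(i, j) \<in> parcs (class_graph H)"
    then obtain u v where uv: "u \<in> ?V" "v \<in> ?V" "color H u = i" "color H v = j" "(u, v) \<in> ?E"
      by (auto simp: class_graph_def color_class_def)
    then have "(f u, f v) \<in> {(f u, f v) | u v. (u, v) \<in> ?E}" by blast
    then obtain k where "k < n" "f u \<in> bag k" "f v \<in> bag k"
      using d unfolding parent_decomposition_def by blast
    then show "\<exists>k<n. i \<in> \<delta> k \<and> j \<in> \<delta> k" using uv by (auto simp: \<delta>_def)
  qed
  moreover have "card (\<delta> k) \<le> Suc c" if k: "k < n" for k
  proof -
    have sub: "bag k \<subseteq> f ` ?V" using d k by (simp add: parent_decomposition_def)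
    then have fin': "finite (bag k)" using fin by (meson finite_imageI finite_subset)
    have "\<delta> k \<subseteq> (\<lambda>l. color H (inv_into ?V f l)) ` bag k"
    proof
      fix i assume "i \<in> \<delta> k"
      then obtain v where v: "v \<in> ?V" "f v \<in> bag k" "i = color H v" by (auto simp: \<delta>_def)
      have "inv_into ?V f (f v) \<in> ?V" "f (inv_into ?V f (f v)) = f v"
        using v(1) by (auto intro: inv_into_into f_inv_into_f)
      then have "color H (inv_into ?V f (f v)) = color H v" using f v(1) by blast
      then show "i \<in> (\<lambda>l. color H (inv_into ?V f l)) ` bag k" using v by force
    qed
    then have "card (\<delta> k) \<le> card (bag k)"
      using fin' by (meson card_image_le card_mono finite_imageI order_trans)
    then show ?thesis using card k by fastforce
  qed
  ultimately show ?thesis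
    unfolding treewidth_le_iff[OF pair_graph_class_graph[OF H]] by blast
qed

text \<open>By Helly's property one bag contains all blocks of the class, so there are at most
  \<open>c + 1\<close> of them. These blocks, numbered by \<open>h\<close>, are the independent
  parts.\<close>

lemma color_class_independent_parts:
  obtains h :: "'a \<Rightarrow> nat" where
    "\<forall>v\<in>color_class H i. h v < Suc c"
    "\<forall>u\<in>color_class H i. \<forall>v\<in>color_class H i. h u = h v \<longrightarrow> (u, v) \<notin> parcs (ugraph H)"
proof -
  let ?V = "pverts (ugraph H)" and ?E = "parcs (ugraph H)"
  have fin: "finite ?V" using H by (auto simp: colored_graph_iff)
  obtain f n p bag where cq: "clique_quotient f n p bag" using clique_quotient_exists by blast
  note f = cq[unfolded clique_quotient_def, THEN conjunct1]
    and d = cq[unfolded clique_quotient_def, THEN conjunct2, THEN conjunct1]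
    and card = cq[unfolded clique_quotient_def, THEN conjunct2, THEN conjunct2, THEN conjunct1]
    and meet = cq[unfolded clique_quotient_def, THEN conjunct2, THEN conjunct2, THEN conjunct2]
  let ?C = "color_class H i"
  have finC: "finite ?C" using fin by (simp add: color_class_def)
  have cardC: "card (f ` ?C) \<le> Suc c"
  proof (cases "?C = {}")
    case False
    have "\<exists>k. \<forall>v\<in>?C. k \<in> nodes n bag (f v)"
    proof (rule subtree_set_Helly[OF finC False])
      show "subtree_set p (nodes n bag (f v))" if "v \<in> ?C" for v
        using d that by (simp add: parent_decomposition_def color_class_def)
      show "nodes n bag (f u) \<inter> nodes n bag (f v) \<noteq> {}"
        if "u \<in> ?C" "v \<in> ?C" for u v
        using meet that by (simp add: color_class_def)
    qed
    then obtain k where k: "k < n" "f ` ?C \<subseteq> bag k" using False by blast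
    have "bag k \<subseteq> f ` ?V" using d k(1) by (simp add: parent_decomposition_def)
    then have "finite (bag k)" using fin by (meson finite_imageI finite_subset)
    then have "card (f ` ?C) \<le> card (bag k)" using k(2) by (rule card_mono)
    then show ?thesis using card k(1) by fastforce
  qed simp
  obtain e where e: "bij_betw e (f ` ?C) {0..<card (f ` ?C)}"
    using ex_bij_betw_finite_nat[of "f ` ?C"] finC by blast
  show ?thesis
  proof (rule that[of "e \<circ> f"]; intro ballI impI)
    fix v assume "v \<in> ?C"
    then have "e (f v) \<in> {0..<card (f ` ?C)}" using e by (auto simp: bij_betw_def)
    then show "(e \<circ> f) v < Suc c" using cardC by simp
  next
    fix u v assume uv: "u \<in> ?C" "v \<in> ?C" "(e \<circ> f) u = (e \<circ> f) v"
    then have "f u = f v" using e by (auto simp: bij_betw_def dest: inj_onD)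
    moreover have "u \<in> ?V" "v \<in> ?V" using uv by (auto simp: color_class_def)
    ultimately show "(u, v) \<notin> ?E" using f by blast
  qed
qed

end

section \<open>Large flowers force large clique minors\<close>

text \<open>Paths without shortcuts: only the ends lie in the class of \<open>i\<close>, and any
  other color occurs at most twice, in consecutive positions. Hence the ends of a step inside a
  class are the only vertices of their color on the path.\<close>

definition induced_class_path :: "('a, 'c) colored_graph \<Rightarrow> 'c \<Rightarrow> 'a list \<Rightarrow> bool" where
  "induced_class_path H i q \<longleftrightarrow> distinct q \<and> set q \<subseteq> pverts (ugraph H) \<and> 2 \<le> length q \<and>
     walk (parcs (bullet_except H i)) q \<and>
     color H (hd q) = i \<and> color H (last q) = i \<and>
     (\<forall>x<length q. color H (q ! x) = i \<longrightarrow> x = 0 \<or> Suc x = length q) \<and>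
     (\<forall>x y. x < y \<longrightarrow> y < length q \<longrightarrow> color H (q ! x) = color H (q ! y) \<longrightarrow>
       color H (q ! x) \<noteq> i \<longrightarrow> y = Suc x)"

text \<open>A shortest path within \<open>set p\<close>. It could be stopped at an inner vertex of
  the class, and since vertices of another color are adjacent in \<open>bullet_except\<close>, any
  longer stretch between two of them could be skipped.\<close>

lemma minimal_class_path:
  assumes H: "colored_graph H" and p: "vpath p (bullet_except H i)" "1 \<le> vwalk_length p"
    "hd p \<in> color_class H i" "last p \<in> color_class H i"
  obtains q where "induced_class_path H i q" "set q \<subseteq> set p"
proof -
  let ?E = "parcs (bullet_except H i)" and ?V = "pverts (ugraph H)"
  define Q where "Q q \<longleftrightarrow> distinct q \<and> set q \<subseteq> set p \<and> 2 \<le> length q \<and>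
    walk ?E q \<and> hd q \<in> color_class H i \<and> last q \<in> color_class H i" for q
  have pv: "set p \<subseteq> ?V" using p(1) by (simp add: vpath_iff bullet_except_def)
  have "Q p" using p by (auto simp: Q_def vpath_iff)
  then obtain q where q: "Q q" and min: "\<And>r. Q r \<Longrightarrow> length q \<le> length r"
    using ex_has_least_nat[of Q p length] by blast
  have ne: "q \<noteq> []" using q by (auto simp: Q_def)
  have qV: "q ! x \<in> ?V" if "x < length q" for x
    using q pv nth_mem[OF that] unfolding Q_def by blast
  have inner: "x = 0 \<or> Suc x = length q" if x: "x < length q" "color H (q ! x) = i" for x
  proof (rule ccontr)
    assume "\<not> ?thesis"
    then have x': "0 < x" "Suc x < length q" using x(1) by auto
    have "q ! x \<in> color_class H i" using qV[OF x(1)] x(2) by (simp add: color_class_def)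
    moreover have "last (take (Suc x) q) = q ! x" using x(1) by (simp add: take_Suc_conv_app_nth)
    moreover have "walk ?E (take (Suc x) q)"
      using q append_take_drop_id[of "Suc x" q] unfolding Q_def by (metis successively_append_iff)
    moreover have "set (take (Suc x) q) \<subseteq> set q" by (rule set_take_subset)
    ultimately have "Q (take (Suc x) q)"
      using q ne x' unfolding Q_def by (auto simp: hd_take)
    from min[OF this] show False using x' by simp
  qed
  have jump: "y = Suc x" if xy: "x < y" "y < length q" "color H (q ! x) = color H (q ! y)"
    "color H (q ! x) \<noteq> i" for x y
  proof (rule ccontr)
    assume ny: "y \<noteq> Suc x"
    let ?r = "take (Suc x) q @ drop y q"
    have V: "q ! x \<in> ?V" "q ! y \<in> ?V" using qV xy(1,2) by simp_all
    have "q ! x \<noteq> q ! y" using q xy(1,2) by (simp add: Q_def nth_eq_iff_index_eq)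
    then have e: "(q ! x, q ! y) \<in> ?E"
      using V xy(3,4) unfolding bullet_except_def parcs_make_cliques by (auto simp: colors_def)
    have s: "walk ?E q" using q by (simp add: Q_def)
    have "walk ?E (take (Suc x) q)"
      "walk ?E (drop y q)"
      using s by (metis append_take_drop_id successively_append_iff)+
    moreover have "last (take (Suc x) q) = q ! x" "hd (drop y q) = q ! y"
      using xy(1,2) by (simp_all add: take_Suc_conv_app_nth hd_drop_conv_nth)
    ultimately have "walk ?E ?r"
      using e by (auto simp: successively_append_iff)
    moreover have "set ?r \<subseteq> set p"
      using q set_take_subset[of "Suc x" q] set_drop_subset[of y q] unfolding Q_def by auto
    moreover have "distinct ?r"
      using q xy(1) unfolding Q_def by (auto simp: set_take_disj_set_drop_if_distinct)
    moreover have "hd ?r = hd q" using ne by (cases q) auto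
    moreover have "last ?r = last q" using xy(2) by simp
    moreover have "2 \<le> length ?r" using xy(1,2) by simp
    ultimately have "Q ?r" using q unfolding Q_def by simp
    from min[OF this] show False using xy(1,2) ny by simp
  qed
  have "induced_class_path H i q"
    unfolding induced_class_path_def
    using q pv inner jump by (auto simp: Q_def color_class_def)
  then show ?thesis using q that unfolding Q_def by blast
qed

text \<open>Starts are pairwise nonadjacent and so are ends, but a start may be adjacent to an end.
  So a block may collect starts or ends, but not both.\<close>

definition path_grid :: "('a, 'c) colored_graph \<Rightarrow> 'c \<Rightarrow> nat \<Rightarrow> (nat \<times> nat \<Rightarrow> 'a list) \<Rightarrow> bool" where
  "path_grid H i m q \<longleftrightarrow> (\<forall>z\<in>{..<m} \<times> {..<m}. induced_class_path H i (q z) \<and>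
     (\<forall>z'\<in>{..<m} \<times> {..<m}. (z \<noteq> z' \<longrightarrow> set (q z) \<inter> set (q z') = {}) \<and>
       (hd (q z), hd (q z')) \<notin> parcs (ugraph H) \<and> (last (q z), last (q z')) \<notin> parcs (ugraph H)))"

text \<open>Pigeonhole on the pairs of independent parts that contain the two ends of a path: some
  pair occurs for \<open>m * m\<close> paths, which are indexed by the grid in an arbitrary
  way.\<close>

lemma flower_path_grid:
  assumes H: "colored_graph H" and F: "flower N H i F" and N: "m * m * (Suc c * Suc c) \<le> N" "0 < m"
    and h: "\<forall>v\<in>color_class H i. h v < Suc c"
      "\<forall>u\<in>color_class H i. \<forall>v\<in>color_class H i. h u = h v \<longrightarrow> (u, v) \<notin> parcs (ugraph H)"
  shows "\<exists>q. path_grid H i m q"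
proof -
  let ?I = "{..<m} \<times> {..<m}"
  have Fp: "finite F" "card F = N" "\<And>p. p \<in> F \<Longrightarrow> vpath p (bullet_except H i) \<and>
      1 \<le> vwalk_length p \<and> hd p \<in> color_class H i \<and> last p \<in> color_class H i"
    "\<And>p p'. p \<in> F \<Longrightarrow> p' \<in> F \<Longrightarrow> p \<noteq> p' \<Longrightarrow> set p \<inter> set p' = {}"
    using F unfolding flower_def by blast+
  have "\<exists>q. induced_class_path H i q \<and> set q \<subseteq> set p" if "p \<in> F" for p
    using minimal_class_path[OF H, of p i] Fp(3)[OF that] by metis
  then obtain Q where Q: "\<And>p. p \<in> F \<Longrightarrow> induced_class_path H i (Q p)"
    "\<And>p. p \<in> F \<Longrightarrow> set (Q p) \<subseteq> set p"
    by metis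
  have ends: "hd (Q p) \<in> color_class H i" "last (Q p) \<in> color_class H i" if "p \<in> F" for p
  proof -
    have "Q p \<noteq> []" "set (Q p) \<subseteq> pverts (ugraph H)"
      using Q(1)[OF that] unfolding induced_class_path_def by auto
    then have "hd (Q p) \<in> pverts (ugraph H)" "last (Q p) \<in> pverts (ugraph H)" by auto
    then show "hd (Q p) \<in> color_class H i" "last (Q p) \<in> color_class H i"
      using Q(1)[OF that] unfolding induced_class_path_def color_class_def by auto
  qed
  define key where "key p = (h (hd (Q p)), h (last (Q p)))" for p
  let ?K = "{..<Suc c} \<times> {..<Suc c}"
  have key: "key p \<in> ?K" if "p \<in> F" for p
    using h(1) ends[OF that] unfolding key_def by blast
  obtain k where k: "m * m \<le> card {p \<in> F. key p = k}"
  proof (rule ccontr)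
    assume no: "\<not> thesis"
    have small: "card {p \<in> F. key p = k} \<le> m * m - 1" for k
    proof (rule ccontr)
      assume "\<not> ?thesis"
      then have "m * m \<le> card {p \<in> F. key p = k}" by simp
      then show False using no that by blast
    qed
    have "F = (\<Union>k\<in>?K. {p \<in> F. key p = k})" using key by blast
    then have "card F \<le> (\<Sum>k\<in>?K. card {p \<in> F. key p = k})"
      using card_UN_le[of ?K "\<lambda>k. {p \<in> F. key p = k}"] by simp
    also have "\<dots> \<le> of_nat (card ?K) * (m * m - 1)"
      by (rule sum_bounded_above) (rule small)
    also have "\<dots> = Suc c * Suc c * (m * m - 1)" by (simp add: card_cartesian_product)
    also have "\<dots> < Suc c * Suc c * (m * m)"
      using N(2) by (intro mult_strict_left_mono) auto
    finally show False using N(1) Fp(2) by (simp add: mult.commute)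
  qed
  then obtain G where G: "G \<subseteq> {p \<in> F. key p = k}" "card G = m * m"
    by (meson obtain_subset_with_card_n)
  have "finite G" using G(1) Fp(1) by (auto intro: finite_subset)
  moreover have "card ?I = card G" using G(2) by (simp add: card_cartesian_product)
  ultimately obtain \<pi> where \<pi>: "bij_betw \<pi> ?I G"
    by (metis finite_same_card_bij finite_SigmaI finite_lessThan)
  have \<pi>F: "\<pi> z \<in> F" "key (\<pi> z) = k" if "z \<in> ?I" for z
    using \<pi> G(1) that unfolding bij_betw_def by blast+
  have disj: "set (Q (\<pi> z)) \<inter> set (Q (\<pi> z')) = {}"
    if z: "z \<in> ?I" "z' \<in> ?I" "z \<noteq> z'" for z z'
  proof -
    have "\<pi> z \<noteq> \<pi> z'" using \<pi> z unfolding bij_betw_def by (meson inj_onD)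
    then have "set (\<pi> z) \<inter> set (\<pi> z') = {}" using Fp(4) \<pi>F z by blast
    then show ?thesis using Q(2)[OF \<pi>F(1)[OF z(1)]] Q(2)[OF \<pi>F(1)[OF z(2)]] by blast
  qed
  have indep: "(hd (Q (\<pi> z)), hd (Q (\<pi> z'))) \<notin> parcs (ugraph H) \<and>
      (last (Q (\<pi> z)), last (Q (\<pi> z'))) \<notin> parcs (ugraph H)"
    if z: "z \<in> ?I" "z' \<in> ?I" for z z'
  proof -
    have "key (\<pi> z) = key (\<pi> z')" using \<pi>F(2) z by simp
    then have "h (hd (Q (\<pi> z))) = h (hd (Q (\<pi> z')))"
      "h (last (Q (\<pi> z))) = h (last (Q (\<pi> z')))"
      by (simp_all add: key_def)
    then show ?thesis using h(2) ends[OF \<pi>F(1)[OF z(1)]] ends[OF \<pi>F(1)[OF z(2)]] by blast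
  qed
  have "path_grid H i m (\<lambda>z. Q (\<pi> z))"
    unfolding path_grid_def
    by (intro ballI conjI impI;
      (rule Q(1)[OF \<pi>F(1)] disj indep[THEN conjunct1] indep[THEN conjunct2]; assumption))
  then show ?thesis by blast
qed

lemma connected_in_UN:
  assumes "\<And>j. j \<in> J \<Longrightarrow> connected_in E (D j) \<and> a j \<in> D j"
    and "\<And>j j'. j \<in> J \<Longrightarrow> j' \<in> J \<Longrightarrow> (a j, a j') \<in> E"
  shows "connected_in E (\<Union>j\<in>J. D j)"
  unfolding connected_in_def
proof (intro ballI)
  let ?U = "\<Union>j\<in>J. D j"
  fix u v assume "u \<in> ?U" "v \<in> ?U"
  then obtain j j' where j: "j \<in> J" "j' \<in> J" "u \<in> D j" "v \<in> D j'" by blast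
  have D: "(x, y) \<in> (E \<inter> ?U \<times> ?U)\<^sup>*" if "l \<in> J" "x \<in> D l" "y \<in> D l" for x y l
  proof -
    have "(x, y) \<in> (E \<inter> D l \<times> D l)\<^sup>*" using assms(1)[OF that(1)] that unfolding connected_in_def by blast
    moreover have "D l \<subseteq> ?U" using that(1) by blast
    ultimately show ?thesis by (rule rtrancl_restrict_mono)
  qed
  have "(u, a j) \<in> (E \<inter> ?U \<times> ?U)\<^sup>*" using D[OF j(1,3)] assms(1)[OF j(1)] by blast
  also have "(a j, a j') \<in> E \<inter> ?U \<times> ?U" using assms j by blast
  also have "(a j', v) \<in> (E \<inter> ?U \<times> ?U)\<^sup>*" using D[OF j(2) _ j(4)] assms(1)[OF j(2)] by blast
  finally show "(u, v) \<in> (E \<inter> ?U \<times> ?U)\<^sup>*" .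
qed

text \<open>An \<open>m \<times> m\<close> grid of disjoint paths yields a \<open>K\<^sub>m\<close> minor of a quotient of \<open>H\<close>: the starts of
  each row and the ends of each column are identified, and so are the two vertices of any other
  color that a path contains if they are not adjacent in \<open>H\<close>. The \<open>x\<close>-th branch set consists of the
  paths in row \<open>x\<close> without their ends, and the block of the ends in column \<open>x\<close>.\<close>

lemma grid_imp_large_bag:
  fixes H :: "('a, 'c) colored_graph"
  assumes H: "colored_graph H" and tw: "\<forall>F\<in>Spasm H. treewidth (ugraph F) \<le> c" and m: "0 < m"
    and grid: "path_grid H i m q"
  shows "m \<le> Suc c"
proof -
  let ?V = "pverts (ugraph H)" and ?E = "parcs (ugraph H)" and ?I = "{..<m} \<times> {..<m}"
  have fin: "finite ?V" and sy: "sym ?E" and irr: "\<And>u. (u, u) \<notin> ?E"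
    using H by (auto simp: colored_graph_iff)
  have path: "induced_class_path H i (q z)" if "z \<in> ?I" for z
    using bspec[OF grid[unfolded path_grid_def] that] by (rule conjunct1)
  have pair: "(z \<noteq> z' \<longrightarrow> set (q z) \<inter> set (q z') = {}) \<and>
      (hd (q z), hd (q z')) \<notin> ?E \<and> (last (q z), last (q z')) \<notin> ?E"
    if "z \<in> ?I" "z' \<in> ?I" for z z'
    using bspec[OF conjunct2[OF bspec[OF grid[unfolded path_grid_def] that(1)]] that(2)] .
  note disj = pair[THEN conjunct1, rule_format] and indep = pair[THEN conjunct2]
  have ne: "q z \<noteq> []" and dist: "distinct (q z)" and len: "2 \<le> length (q z)"
    and qV: "set (q z) \<subseteq> ?V" and hdi: "color H (hd (q z)) = i" and lasti: "color H (last (q z)) = i"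
    if "z \<in> ?I" for z
    using path[OF that] by (auto simp: induced_class_path_def)
  have hl: "hd (q z) \<noteq> last (q z)" if "z \<in> ?I" for z
    using dist[OF that] len[OF that] by (cases "q z") (auto split: if_splits)
  define own where "own v = (SOME z. z \<in> ?I \<and> v \<in> set (q z))" for v
  have own: "own v = z" if "z \<in> ?I" "v \<in> set (q z)" for v z
  proof -
    have "own v \<in> ?I \<and> v \<in> set (q (own v))"
      unfolding own_def by (rule someI[of _ z]) (use that in blast)
    then show ?thesis using disj[of "own v" z] that by (metis disjoint_iff)
  qed
  define K where "K z j = {v \<in> set (q z). color H v = j}" for z j
  define covered where "covered v \<longleftrightarrow> (\<exists>z\<in>?I. v \<in> set (q z))" for v
  \<comment> \<open>\<open>Inl (Inl x)\<close> labels the starts in row \<open>x\<close>,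
    \<open>Inl (Inr y)\<close> the ends in column \<open>y\<close>, \<open>Inr (Inr (z, j))\<close>
    the vertices of color \<open>j\<close> on path \<open>z\<close> if they are independent, and
    \<open>Inr (Inl v)\<close> a vertex that stays alone.\<close>
  define f :: "'a \<Rightarrow> (nat + nat) + ('a + ((nat \<times> nat) \<times> 'c))"
    where "f v = (if covered v then
        (if v = hd (q (own v)) then Inl (Inl (fst (own v)))
         else if v = last (q (own v)) then Inl (Inr (snd (own v)))
         else if independent_set (ugraph H) (K (own v) (color H v))
           then Inr (Inr (own v, color H v))
         else Inr (Inl v))
      else Inr (Inl v))" for v
  have covered: "covered v" if "z \<in> ?I" "v \<in> set (q z)" for v z
    using that unfolding covered_def by (rule bexI[rotated])
  have coveredE: "\<exists>z. z \<in> ?I \<and> v \<in> set (q z) \<and> own v = z" if "covered v" for v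
    using that own unfolding covered_def by metis
  have f_hd: "f (hd (q z)) = Inl (Inl (fst z))" if "z \<in> ?I" for z
    using covered[OF that hd_in_set[OF ne[OF that]]] own[OF that hd_in_set[OF ne[OF that]]]
    by (simp add: f_def)
  have f_last: "f (last (q z)) = Inl (Inr (snd z))" if "z \<in> ?I" for z
    using covered[OF that last_in_set[OF ne[OF that]]] own[OF that last_in_set[OF ne[OF that]]]
      hl[OF that] by (simp add: f_def)
  have f_ll: "\<exists>z\<in>?I. v = hd (q z) \<and> fst z = x" if "f v = Inl (Inl x)" for v x
  proof -
    have "covered v \<and> v = hd (q (own v)) \<and> fst (own v) = x"
      using that by (auto simp: f_def split: if_splits)
    then show ?thesis using coveredE by metis
  qed
  have f_lr: "\<exists>z\<in>?I. v = last (q z) \<and> snd z = x" if "f v = Inl (Inr x)" for v x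
  proof -
    have "covered v \<and> v = last (q (own v)) \<and> snd (own v) = x"
      using that by (auto simp: f_def split: if_splits)
    then show ?thesis using coveredE by metis
  qed
  have f_rl: "v = w" if "f v = Inr (Inl w)" for v w
    using that unfolding f_def by (auto split: if_splits)
  have f_rr: "v \<in> K z j \<and> independent_set (ugraph H) (K z j)" if "f v = Inr (Inr (z, j))" for v z j
  proof -
    have "covered v \<and> own v = z \<and> color H v = j \<and> independent_set (ugraph H) (K z j)"
      using that by (auto simp: f_def split: if_splits)
    then show ?thesis using coveredE unfolding K_def by (metis (mono_tags, lifting) mem_Collect_eq)
  qed
  have proper: "color H u = color H v \<and> (u, v) \<notin> ?E" if uv: "f u = f v" for u v
  proof (cases "f v")
    case (Inl s)
    show ?thesis
    proof (cases s)
      case (Inl x)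
      then have "f v = Inl (Inl x)" "f u = Inl (Inl x)" using \<open>f v = Inl s\<close> uv by auto
      then obtain z z' where "z \<in> ?I" "z' \<in> ?I" "u = hd (q z)" "v = hd (q z')"
        using f_ll by meson
      then show ?thesis using indep hdi by simp
    next
      case (Inr x)
      then have "f v = Inl (Inr x)" "f u = Inl (Inr x)" using \<open>f v = Inl s\<close> uv by auto
      then obtain z z' where "z \<in> ?I" "z' \<in> ?I" "u = last (q z)" "v = last (q z')"
        using f_lr by meson
      then show ?thesis using indep lasti by simp
    qed
  next
    case (Inr s)
    show ?thesis
    proof (cases s)
      case (Inl w)
      then have "u = w" "v = w" using \<open>f v = Inr s\<close> uv f_rl by auto
      then show ?thesis using irr by simp
    next
      case (Inr zj)
      obtain z j where "zj = (z, j)" by (cases zj)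
      then have "f v = Inr (Inr (z, j))" "f u = Inr (Inr (z, j))" using \<open>f v = Inr s\<close> Inr uv by auto
      then have "u \<in> K z j" "v \<in> K z j" "independent_set (ugraph H) (K z j)"
        using f_rr by blast+
      then show ?thesis unfolding independent_set_def K_def by auto
    qed
  qed
  obtain n p bag where d: "parent_decomposition n p bag (f ` ?V) {(f u, f v) | u v. (u, v) \<in> ?E}"
    and card: "\<forall>k<n. card (bag k) \<le> Suc c"
    using spasm_label_decomposition[OF H tw, of f] proper by blast
  define B where "B v = nodes n bag (f v)" for v
  have stB: "subtree_set p (B v)" if "v \<in> ?V" for v
    using d that by (simp add: parent_decomposition_def B_def)
  have neB: "B v \<noteq> {}" if "v \<in> ?V" for v
    using stB[OF that] unfolding subtree_set_def by blast
  have B_edge: "B u \<inter> B v \<noteq> {}" if "(u, v) \<in> ?E" for u v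
  proof -
    have "(f u, f v) \<in> {(f u, f v) | u v. (u, v) \<in> ?E}" using that by blast
    then show ?thesis using d unfolding parent_decomposition_def B_def by blast
  qed
  have B_eq: "B u = B v" if "f u = f v" for u v using that by (simp add: B_def)
  \<comment> \<open>The intersection relation of the bag subtrees replaces adjacency in the
    quotient: it holds along edges of \<open>H\<close> and between vertices with the same label, and
    it is all that \<open>subtree_set_UN\<close> asks for.\<close>
  define R where "R = {(u, v). B u \<inter> B v \<noteq> {}}"
  have symR: "sym R" by (auto simp: R_def sym_def)
  \<comment> \<open>A step that is not an edge of \<open>H\<close> stays within a class. Its ends
    are the only vertices of their color on the path, so they form an independent block and carry
    the same label.\<close>
  have step: "(q z ! x, q z ! Suc x) \<in> R" if z: "z \<in> ?I" and x: "Suc x < length (q z)" for z x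
  proof (cases "(q z ! x, q z ! Suc x) \<in> ?E")
    case True
    then show ?thesis using B_edge by (simp add: R_def)
  next
    case False
    let ?u = "q z ! x" and ?v = "q z ! Suc x"
    have mem: "?u \<in> set (q z)" "?v \<in> set (q z)" using x by auto
    have "(?u, ?v) \<in> parcs (bullet_except H i)"
      using path[OF z] x unfolding induced_class_path_def by (auto simp: successively_conv_nth)
    then have col: "color H ?u = color H ?v" "color H ?v \<noteq> i"
      using False unfolding bullet_except_def parcs_make_cliques by auto
    have jump: "\<And>a b. a < b \<Longrightarrow> b < length (q z) \<Longrightarrow> color H (q z ! a) = color H (q z ! b) \<Longrightarrow>
        color H (q z ! a) \<noteq> i \<Longrightarrow> b = Suc a"
      using path[OF z] unfolding induced_class_path_def by blast
    have "w = ?u \<or> w = ?v" if w: "w \<in> K z (color H ?v)" for w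
    proof -
      obtain a where a: "a < length (q z)" "w = q z ! a" "color H w = color H ?v"
        using w unfolding K_def in_set_conv_nth by blast
      show ?thesis
      proof (cases "a \<le> x")
        case True
        then have "Suc x = Suc a" using jump[of a "Suc x"] a x col by simp
        then show ?thesis using a by simp
      next
        case False
        then have "a = Suc x" using jump[of x a] a x col by simp
        then show ?thesis using a by simp
      qed
    qed
    then have "independent_set (ugraph H) (K z (color H ?v))"
      using False irr symD[OF sy, of ?v ?u] unfolding independent_set_def by blast
    moreover have "?u \<noteq> hd (q z)" "?u \<noteq> last (q z)" "?v \<noteq> hd (q z)" "?v \<noteq> last (q z)"
      using col hdi[OF z] lasti[OF z] by auto
    ultimately have "f ?u = Inr (Inr (z, color H ?v))" "f ?v = Inr (Inr (z, color H ?v))"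
      using covered[OF z mem(1)] covered[OF z mem(2)] own[OF z mem(1)] own[OF z mem(2)] col
      by (simp_all add: f_def)
    then have "B ?u = B ?v" by (intro B_eq) simp
    then show ?thesis using neB mem(2) qV[OF z] by (auto simp: R_def)
  qed
  have succ: "walk R (q z)" if "z \<in> ?I" for z
    using step[OF that] by (simp add: successively_conv_nth)
  have bl: "butlast (q z) \<noteq> []" "q z = butlast (q z) @ [last (q z)]"
    "hd (butlast (q z)) = hd (q z)" "distinct (butlast (q z))" "last (q z) \<notin> set (butlast (q z))"
    if "z \<in> ?I" for z
  proof -
    show 1: "q z = butlast (q z) @ [last (q z)]" using ne[OF that] by simp
    show 2: "butlast (q z) \<noteq> []" using len[OF that] by (cases "q z" rule: rev_cases) auto
    show "hd (butlast (q z)) = hd (q z)" using 2 by (subst (2) 1) simp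
    show "distinct (butlast (q z))" "last (q z) \<notin> set (butlast (q z))"
      using dist[OF that] ne[OF that] by (cases "q z" rule: rev_cases; simp)+
  qed
  have succ_bl: "walk R (butlast (q z))"
    "(last (butlast (q z)), last (q z)) \<in> R" if "z \<in> ?I" for z
    using succ[OF that] bl(1)[OF that]
    by (cases "q z" rule: rev_cases; simp add: successively_append_iff)+
  \<comment> \<open>The end of the diagonal path \<open>(x, x)\<close> represents the block of all
    ends in column \<open>x\<close>.\<close>
  define D where "D x = insert (last (q (x, x))) (\<Union>y\<in>{..<m}. set (butlast (q (x, y))))" for x
  have DV: "D x \<subseteq> ?V" if x: "x < m" for x
  proof
    fix v assume "v \<in> D x"
    then obtain y where "y < m" "v \<in> set (q (x, y))"
      unfolding D_def using x last_in_set[OF ne[of "(x, x)"]] by (auto dest: in_set_butlastD)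
    then show "v \<in> ?V" using qV[of "(x, y)"] x by auto
  qed
  have conD: "connected_in R (D x)" if x: "x < m" for x
  proof -
    have "connected_in R (\<Union>y\<in>{..<m}. set (butlast (q (x, y))))"
    proof (rule connected_in_UN[where a = "\<lambda>y. hd (q (x, y))"])
      fix y assume "y \<in> {..<m}"
      then have z: "(x, y) \<in> ?I" using x by simp
      show "connected_in R (set (butlast (q (x, y)))) \<and> hd (q (x, y)) \<in> set (butlast (q (x, y)))"
        using connected_in_walk[OF symR succ_bl(1)[OF z]] bl(1,3)[OF z]
        by (metis hd_in_set)
    next
      fix y y' assume "y \<in> {..<m}" "y' \<in> {..<m}"
      then have z: "(x, y) \<in> ?I" "(x, y') \<in> ?I" using x by simp_all
      have "B (hd (q (x, y))) = B (hd (q (x, y')))"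
        using f_hd[OF z(1)] f_hd[OF z(2)] by (intro B_eq) simp
      moreover have "hd (q (x, y')) \<in> ?V" using qV[OF z(2)] hd_in_set[OF ne[OF z(2)]] by blast
      ultimately show "(hd (q (x, y)), hd (q (x, y'))) \<in> R" using neB by (simp add: R_def)
    qed
    moreover have z: "(x, x) \<in> ?I" using x by simp
    moreover have "last (butlast (q (x, x))) \<in> (\<Union>y\<in>{..<m}. set (butlast (q (x, y))))"
      using last_in_set[OF bl(1)[OF z]] x by blast
    ultimately show ?thesis
      unfolding D_def using connected_in_insert[OF _ symR _ succ_bl(2)[OF z]] by blast
  qed
  \<comment> \<open>Branch sets \<open>x\<close> and \<open>y\<close> touch through the path
    \<open>(x, y)\<close>, whose last step goes from row \<open>x\<close> to the block of the ends
    in column \<open>y\<close>.\<close>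
  have "\<exists>k. \<forall>x\<in>{..<m}. k \<in> (\<Union>v\<in>D x. B v)"
  proof (rule subtree_set_Helly)
    show "finite {..<m}" "{..<m} \<noteq> {}" using m by auto
    show "subtree_set p (\<Union>v\<in>D x. B v)" if "x \<in> {..<m}" for x
    proof (rule subtree_set_UN)
      show "connected_in R (D x)" using conD that by simp
      show "D x \<noteq> {}" by (simp add: D_def)
      show "subtree_set p (B v)" if "v \<in> D x" for v using stB DV \<open>x \<in> {..<m}\<close> that by blast
      show "B u \<inter> B v \<noteq> {}" if "(u, v) \<in> R" for u v using that by (simp add: R_def)
    qed
    fix x y assume xy: "x \<in> {..<m}" "y \<in> {..<m}"
    then have z: "(x, y) \<in> ?I" "(y, y) \<in> ?I" by auto
    have "last (butlast (q (x, y))) \<in> D x"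
      using last_in_set[OF bl(1)[OF z(1)]] xy unfolding D_def by blast
    moreover have "last (q (y, y)) \<in> D y" by (simp add: D_def)
    moreover have "B (last (q (x, y))) = B (last (q (y, y)))"
      using f_last[OF z(1)] f_last[OF z(2)] by (intro B_eq) simp
    moreover have "B (last (butlast (q (x, y)))) \<inter> B (last (q (x, y))) \<noteq> {}"
      using succ_bl(2)[OF z(1)] by (simp add: R_def)
    ultimately show "(\<Union>v\<in>D x. B v) \<inter> (\<Union>v\<in>D y. B v) \<noteq> {}" by blast
  qed
  then obtain k where k: "\<And>x. x < m \<Longrightarrow> \<exists>v\<in>D x. k \<in> B v" by auto
  have kn: "k < n" using k[OF m] by (auto simp: B_def)
  \<comment> \<open>Recovers the index of the branch set from a label, so a bag that meets all
    branch sets has at least \<open>m\<close> labels.\<close>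
  define row :: "(nat + nat) + ('a + ((nat \<times> nat) \<times> 'c)) \<Rightarrow> nat"
    where "row l = (case l of Inl (Inl x) \<Rightarrow> x | Inl (Inr x) \<Rightarrow> x | Inr (Inl v) \<Rightarrow> fst (own v)
      | Inr (Inr zj) \<Rightarrow> fst (fst zj))" for l
  have row: "row (f v) = x" if x: "x < m" and v: "v \<in> D x" for x v
  proof (cases "v = last (q (x, x))")
    case True
    then show ?thesis using f_last[of "(x, x)"] x by (simp add: row_def)
  next
    case False
    then obtain y where y: "y < m" "v \<in> set (butlast (q (x, y)))" using v by (auto simp: D_def)
    then have z: "(x, y) \<in> ?I" using x by simp
    have "own v = (x, y)" using own[OF z in_set_butlastD[OF y(2)]] .
    moreover have "v \<noteq> last (q (x, y))" using bl(5)[OF z] y(2) by metis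
    ultimately have "v \<noteq> hd (q (x, y)) \<Longrightarrow> row (f v) = x"
      using covered[OF z in_set_butlastD[OF y(2)]] by (simp add: f_def row_def)
    moreover have "v = hd (q (x, y)) \<Longrightarrow> row (f v) = x"
      using f_hd[OF z] by (simp add: row_def)
    ultimately show ?thesis by blast
  qed
  have "{..<m} \<subseteq> row ` bag k"
  proof
    fix x assume "x \<in> {..<m}"
    then have x: "x < m" by simp
    obtain v where v: "v \<in> D x" "k \<in> B v" using k[OF x] by blast
    then have "f v \<in> bag k" by (simp add: B_def)
    then show "x \<in> row ` bag k" using row[OF x v(1)] by (metis image_eqI)
  qed
  moreover have "finite (bag k)"
  proof -
    have "bag k \<subseteq> f ` ?V" using d kn by (simp add: parent_decomposition_def)
    then show ?thesis using fin by (meson finite_imageI finite_subset)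
  qed
  ultimately have "card {..<m} \<le> card (bag k)"
    by (meson card_image_le card_mono finite_imageI order_trans)
  then show ?thesis using card kn by fastforce
qed

text \<open>A grid of side \<open>c + 2\<close> would force a bag of more than \<open>c + 1\<close>
  labels; the factor \<open>Suc c * Suc c\<close> pays for the pigeonhole on the two ends.\<close>

lemma no_large_flower:
  assumes H: "colored_graph H" and tw: "\<forall>F\<in>Spasm H. treewidth (ugraph F) \<le> c"
  shows "\<not> flower ((c + 2) * (c + 2) * (Suc c * Suc c)) H i F"
proof
  assume F: "flower ((c + 2) * (c + 2) * (Suc c * Suc c)) H i F"
  obtain h :: "'a \<Rightarrow> nat" where h: "\<forall>v\<in>color_class H i. h v < Suc c"
    "\<forall>u\<in>color_class H i. \<forall>v\<in>color_class H i. h u = h v \<longrightarrow> (u, v) \<notin> parcs (ugraph H)"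
    by (rule color_class_independent_parts[OF H tw])
  obtain q where q: "path_grid H i (c + 2) q"
    using flower_path_grid[OF H F order_refl _ h] by auto
  have "c + 2 \<le> Suc c" by (rule grid_imp_large_bag[OF H tw _ q]) simp
  then show False by simp
qed

section \<open>Hitting sets for paths between terminals\<close>

text \<open>Connected sets take the place of paths: they can be merged and enlarged without
  rerouting, and a path between two terminals is extracted only at the end.\<close>

definition joins_terminals :: "'a rel \<Rightarrow> 'a set \<Rightarrow> 'a set \<Rightarrow> bool" where
  "joins_terminals E T S \<longleftrightarrow> connected_in E S \<and> (\<exists>x y. x \<in> S \<and> y \<in> S \<and> x \<in> T \<and> y \<in> T \<and> x \<noteq> y)"

definition packing :: "'a rel \<Rightarrow> 'a set \<Rightarrow> 'a set \<Rightarrow> nat \<Rightarrow> bool" where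
  "packing E T X k \<longleftrightarrow> (\<exists>\<S>. finite \<S> \<and> k \<le> card \<S> \<and> pairwise disjnt \<S> \<and> \<Union>\<S> \<subseteq> X \<and>
     (\<forall>S\<in>\<S>. joins_terminals E T S))"

lemma packingE:
  assumes "packing E T X k"
  obtains \<S> where "finite \<S>" "k \<le> card \<S>" "pairwise disjnt \<S>" "\<Union>\<S> \<subseteq> X"
    "\<forall>S\<in>\<S>. joins_terminals E T S"
  using assms unfolding packing_def by (elim exE conjE)

lemma joins_terminals_mono:
  "joins_terminals E T S \<Longrightarrow> T \<inter> S \<subseteq> T' \<Longrightarrow> joins_terminals E T' S"
  unfolding joins_terminals_def by blast

lemma packing_0: "packing E T X 0"
  unfolding packing_def by (rule exI[of _ "{}"]) auto

lemma packing_single: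
  assumes "S \<subseteq> X" "joins_terminals E T S"
  shows "packing E T X 1"
  unfolding packing_def using assms by (intro exI[of _ "{S}"]) auto

lemma packing_mono:
  assumes "packing E T X k" "X \<subseteq> Y" "T \<inter> X \<subseteq> T'"
  shows "packing E T' Y k"
  using assms(1)
proof (rule packingE)
  fix \<S> assume \<S>: "finite \<S>" "k \<le> card \<S>" "pairwise disjnt \<S>" "\<Union>\<S> \<subseteq> X"
    "\<forall>S\<in>\<S>. joins_terminals E T S"
  have "joins_terminals E T' S" if S: "S \<in> \<S>" for S
  proof (rule joins_terminals_mono)
    show "joins_terminals E T S" using \<S>(5) S by simp
    show "T \<inter> S \<subseteq> T'" using \<S>(4) S assms(3) by auto
  qed
  then show ?thesis
    unfolding packing_def using \<S>(1-4) assms(2) by (intro exI[of _ \<S>]) simp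
qed

lemma packing_le: "packing E T X k \<Longrightarrow> j \<le> k \<Longrightarrow> packing E T X j"
  unfolding packing_def using order_trans by blast

lemma packing_Un:
  assumes "packing E T X k" "packing E T Y l" "X \<inter> Y = {}"
  shows "packing E T (X \<union> Y) (k + l)"
proof -
  from packingE[OF assms(1)] obtain \<S> where \<S>: "finite \<S>" "k \<le> card \<S>" "pairwise disjnt \<S>"
    "\<Union>\<S> \<subseteq> X" "\<forall>S\<in>\<S>. joins_terminals E T S" .
  from packingE[OF assms(2)] obtain \<S>' where \<S>': "finite \<S>'" "l \<le> card \<S>'" "pairwise disjnt \<S>'"
    "\<Union>\<S>' \<subseteq> Y" "\<forall>S\<in>\<S>'. joins_terminals E T S" .
  have cross: "disjnt S S'" if "S \<in> \<S>" "S' \<in> \<S>'" for S S'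
  proof -
    have "S \<subseteq> X" "S' \<subseteq> Y" using that \<S>(4) \<S>'(4) by auto
    then show ?thesis using assms(3) unfolding disjnt_def by blast
  qed
  have "S \<notin> \<S>'" if S: "S \<in> \<S>" for S
  proof
    assume "S \<in> \<S>'"
    then have "disjnt S S" using cross[OF S] by blast
    then have "S = {}" by (simp add: disjnt_def)
    then show False using bspec[OF \<S>(5) S] by (simp add: joins_terminals_def)
  qed
  then have "\<S> \<inter> \<S>' = {}" by blast
  then have "k + l \<le> card (\<S> \<union> \<S>')" using \<S>(1,2) \<S>'(1,2) by (simp add: card_Un_disjoint)
  moreover have "pairwise disjnt (\<S> \<union> \<S>')"
  proof (rule pairwiseI)
    fix S S' assume S: "S \<in> \<S> \<union> \<S>'" "S' \<in> \<S> \<union> \<S>'" "S \<noteq> S'"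
    consider "S \<in> \<S>" "S' \<in> \<S>" | "S \<in> \<S>'" "S' \<in> \<S>'" | "S \<in> \<S>" "S' \<in> \<S>'" | "S \<in> \<S>'" "S' \<in> \<S>"
      using S(1,2) by blast
    then show "disjnt S S'"
    proof cases
      case 4
      then show ?thesis using cross disjnt_sym by metis
    qed (use \<S>(3) \<S>'(3) S(3) cross in \<open>auto dest: pairwiseD\<close>)
  qed
  moreover have "\<Union>(\<S> \<union> \<S>') \<subseteq> X \<union> Y" using \<S>(4) \<S>'(4) by auto
  moreover have "\<forall>S\<in>\<S> \<union> \<S>'. joins_terminals E T S" using \<S>(5) \<S>'(5) by auto
  ultimately show ?thesis
    unfolding packing_def using \<S>(1) \<S>'(1) by (intro exI[of _ "\<S> \<union> \<S>'"]) simp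
qed

text \<open>Here \<open>w\<close> is a provisional terminal. The member containing it, if any,
  absorbs \<open>L\<close> through the edge at \<open>w\<close> and obtains the genuine terminal
  \<open>t\<close> in exchange. It has a second terminal besides \<open>t\<close>, because one of
  its two distinct terminals is not \<open>w\<close>.\<close>

lemma packing_extend:
  assumes "packing E (insert w T) X k" "sym E" "L \<inter> X = {}" "connected_in E L"
    "t \<in> L" "t \<in> T" "l \<in> L" "(w, l) \<in> E"
  shows "packing E T (X \<union> L) k"
proof -
  from packingE[OF assms(1)] obtain \<S> where \<S>: "finite \<S>" "k \<le> card \<S>" "pairwise disjnt \<S>"
    "\<Union>\<S> \<subseteq> X" "\<forall>S\<in>\<S>. joins_terminals E (insert w T) S" .
  have avoid: "joins_terminals E T S" if S: "S \<in> \<S>" "w \<notin> S" for S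
  proof (rule joins_terminals_mono)
    show "joins_terminals E (insert w T) S" using \<S>(5) S(1) by simp
    show "insert w T \<inter> S \<subseteq> T" using S(2) by auto
  qed
  show ?thesis
  proof (cases "\<exists>S\<in>\<S>. w \<in> S")
    case False
    then show ?thesis
      unfolding packing_def using \<S>(1-4) avoid by (intro exI[of _ \<S>]) auto
  next
    case True
    then obtain S where S: "S \<in> \<S>" "w \<in> S" by blast
    have SX: "S \<subseteq> X" using \<S>(4) S(1) by auto
    have jS: "joins_terminals E (insert w T) S" using \<S>(5) S(1) by simp
    let ?S = "insert (S \<union> L) (\<S> - {S})"
    have other: "disjnt S S'" "S' \<subseteq> X" "w \<notin> S'" if S': "S' \<in> \<S> - {S}" for S'
    proof -
      show d: "disjnt S S'" using \<S>(3) S(1) S' by (auto dest: pairwiseD)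
      show "S' \<subseteq> X" using \<S>(4) S' by auto
      show "w \<notin> S'" using d S(2) unfolding disjnt_def by blast
    qed
    have "S \<union> L \<notin> \<S> - {S}" using other(2)[of "S \<union> L"] assms(3,5) by blast
    moreover have "0 < card \<S>" using \<S>(1) S(1) by (auto simp: card_gt_0_iff)
    ultimately have "k \<le> card ?S" using \<S>(1,2) S(1) by (simp add: card_Diff_singleton)
    moreover have dSL: "disjnt (S \<union> L) S'" if S': "S' \<in> \<S> - {S}" for S'
      using other(1,2)[OF S'] assms(3) unfolding disjnt_def by blast
    have "pairwise disjnt ?S"
    proof (rule pairwiseI)
      fix S1 S2 assume S12: "S1 \<in> ?S" "S2 \<in> ?S" "S1 \<noteq> S2"
      consider "S1 = S \<union> L" "S2 \<in> \<S> - {S}" | "S2 = S \<union> L" "S1 \<in> \<S> - {S}"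
        | "S1 \<in> \<S>" "S2 \<in> \<S>"
        using S12 by blast
      then show "disjnt S1 S2"
      proof cases
        case 1
        then show ?thesis using dSL by simp
      next
        case 2
        then show ?thesis using dSL disjnt_sym by blast
      next
        case 3
        then show ?thesis using \<S>(3) S12(3) by (auto dest: pairwiseD)
      qed
    qed
    moreover have "\<Union>?S \<subseteq> X \<union> L" using \<S>(4) SX by auto
    moreover have "joins_terminals E T (S \<union> L)"
    proof -
      have "connected_in E S" using jS by (simp add: joins_terminals_def)
      then have "connected_in E (S \<union> L)"
        using connected_in_Un_adjacent[OF _ assms(4,2) S(2) assms(7)] assms(8) by blast
      moreover obtain x where x: "x \<in> S" "x \<in> T"
        using jS unfolding joins_terminals_def by auto
      moreover have "x \<noteq> t" using x(1) SX assms(3,5) by blast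
      ultimately show ?thesis
        unfolding joins_terminals_def using assms(5,6) by auto
    qed
    moreover have "joins_terminals E T S'" if "S' \<in> \<S> - {S}" for S'
      using avoid other(3)[OF that] that by blast
    ultimately show ?thesis
      unfolding packing_def using \<S>(1) by (intro exI[of _ ?S]) simp
  qed
qed

text \<open>Greedy cutting along the path: \<open>L\<close> is the current final piece with at most
  one terminal, and it is split off as soon as it contains two. So every member uses up two
  terminals and at most one is left over in \<open>L\<close>.\<close>

lemma packing_path:
  assumes "sym E" "distinct xs" "walk E xs"
  shows "\<exists>k L. packing E T (set xs - L) k \<and> L \<subseteq> set xs \<and> connected_in E L \<and>
    (L = {} \<or> xs \<noteq> [] \<and> last xs \<in> L) \<and> card (T \<inter> L) \<le> 1 \<and>
    card (T \<inter> set xs) \<le> 2 * k + card (T \<inter> L)"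
  using assms(2,3)
proof (induction xs rule: rev_induct)
  case Nil
  show ?case by (rule exI[of _ 0], rule exI[of _ "{}"]) (simp add: packing_0)
next
  case (snoc x xs)
  then obtain k L where L: "packing E T (set xs - L) k" "L \<subseteq> set xs" "connected_in E L"
    "L = {} \<or> xs \<noteq> [] \<and> last xs \<in> L" "card (T \<inter> L) \<le> 1"
    "card (T \<inter> set xs) \<le> 2 * k + card (T \<inter> L)"
    by (auto simp: successively_append_iff)
  let ?L = "insert x L"
  have x: "x \<notin> set xs" using snoc.prems by simp
  have finL: "finite L" using L(2) by (rule finite_subset) simp
  have con: "connected_in E ?L"
  proof (cases "L = {}")
    case False
    then have "xs \<noteq> []" "last xs \<in> L" using L(4) by auto
    then show ?thesis
      using connected_in_insert[OF L(3) assms(1) \<open>last xs \<in> L\<close>] snoc.prems(2)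
      by (simp add: successively_append_iff)
  qed simp
  have cL: "card (T \<inter> ?L) = card (T \<inter> L) + (if x \<in> T then 1 else 0)"
  proof -
    have "x \<notin> T \<inter> L" using x L(2) by blast
    then show ?thesis using finL by (simp add: Int_insert_right)
  qed
  have cx: "card (T \<inter> set (xs @ [x])) = card (T \<inter> set xs) + (if x \<in> T then 1 else 0)"
    using x by (auto simp: Int_insert_right)
  show ?case
  proof (cases "card (T \<inter> ?L) \<le> 1")
    case True
    have "set (xs @ [x]) - ?L = set xs - L" using x by auto
    then show ?thesis
      using L con True cL cx by (intro exI[of _ k] exI[of _ ?L]) auto
  next
    case False
    have "\<not> (\<forall>y\<in>T \<inter> ?L. \<forall>z\<in>T \<inter> ?L. y = z)"
      using False finL card_le_Suc0_iff_eq[of "T \<inter> ?L"] by simp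
    then obtain y z where "y \<in> ?L \<inter> T" "z \<in> ?L \<inter> T" "y \<noteq> z" by blast
    then have "joins_terminals E T ?L" using con unfolding joins_terminals_def by blast
    then have "packing E T ?L 1" by (intro packing_single[of ?L ?L]) auto
    moreover have "(set xs - L) \<inter> ?L = {}" using x by auto
    ultimately have "packing E T (set xs - L \<union> ?L) (k + 1)" by (rule packing_Un[OF L(1)])
    moreover have "set xs - L \<union> ?L = set (xs @ [x]) - {}" using L(2) by auto
    ultimately have "packing E T (set (xs @ [x]) - {}) (k + 1)" by simp
    moreover have "card (T \<inter> set (xs @ [x])) \<le> 2 * (k + 1) + card (T \<inter> {})"
      using cx L(5,6) cL by (auto split: if_splits)
    ultimately show ?thesis by (intro exI[of _ "k + 1"] exI[of _ "{}"]) simp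
  qed
qed

text \<open>A frame is a subcubic forest whose leaves are exactly its \<open>A\<close>-vertices, built by \<open>N\<close> ears:
  \<open>U\<close> consists of the leaves and branch vertices, \<open>W\<close> of the vertices of degree 2, at which
  further ears can be attached. In a maximal frame, \<open>U\<close> meets all \<open>A\<close>-paths.\<close>

inductive frame :: "'a rel \<Rightarrow> 'a set \<Rightarrow> 'a set \<Rightarrow> nat \<Rightarrow> 'a set \<Rightarrow> 'a set \<Rightarrow> bool"
  for E A V where
  empty: "frame E A V 0 {} {}"
| path: "frame E A V N U W \<Longrightarrow> a \<in> A \<Longrightarrow> b \<in> A \<Longrightarrow> distinct (a # zs @ [b]) \<Longrightarrow>
    set (a # zs @ [b]) \<subseteq> V - (U \<union> W) \<Longrightarrow> set zs \<inter> A = {} \<Longrightarrow>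
    walk E (a # zs @ [b]) \<Longrightarrow>
    frame E A V (Suc N) (insert a (insert b U)) (W \<union> set zs)"
| ear: "frame E A V N U W \<Longrightarrow> a \<in> A \<Longrightarrow> w \<in> W \<Longrightarrow> distinct (a # zs) \<Longrightarrow>
    set (a # zs) \<subseteq> V - (U \<union> W) \<Longrightarrow> set zs \<inter> A = {} \<Longrightarrow>
    walk E (a # zs @ [w]) \<Longrightarrow>
    frame E A V (Suc N) (insert a (insert w U)) (W - {w} \<union> set zs)"

text \<open>Each ear contributes its two ends to \<open>U\<close>, hence the factor 2; an attachment
  vertex moves from \<open>W\<close> to \<open>U\<close>.\<close>

lemma frame_invariants:
  assumes "frame E A V N U W"
  shows "U \<union> W \<subseteq> V \<and> finite U \<and> finite W \<and> card U \<le> 2 * N \<and> A \<inter> W = {}"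
  using assms
proof induction
  case (path N U W a b zs)
  have "card (insert a (insert b U)) \<le> Suc (Suc (card U))"
    using card_insert_le_m1 by (metis Suc_le_mono card_insert_if finite_insert le_SucI order_refl path.IH)
  then show ?case using path by auto
next
  case (ear N U W a w zs)
  have "card (insert a (insert w U)) \<le> Suc (Suc (card U))"
    by (metis Suc_le_mono card_insert_if finite_insert le_SucI order_refl ear.IH)
  then show ?case using ear by auto
qed simp

lemma card_Int_split:
  "finite W \<Longrightarrow> finite Z \<Longrightarrow> R \<subseteq> W \<union> Z \<Longrightarrow> W \<inter> Z = {} \<Longrightarrow> card R = card (R \<inter> W) + card (R \<inter> Z)"
  using card_Un_disjoint[of "R \<inter> W" "R \<inter> Z"] by (simp add: Int_Un_distrib[symmetric] Int_absorb2 disjoint_iff)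

text \<open>The additional terminals \<open>R\<close> allow an ear to hand its last terminal over to the vertex at which
  it is attached.\<close>

lemma frame_packing:
  assumes "frame E A V N U W" "sym E"
  shows "\<forall>R\<subseteq>W. \<exists>k. packing E (A \<union> R) (U \<union> W) k \<and> N + card R \<le> 2 * k"
  using assms(1)
proof induction
  case empty
  show ?case by (auto intro!: exI[of _ 0] packing_0)
next
  case (path N U W a b zs)
  show ?case
  proof (intro allI impI)
    fix R assume R: "R \<subseteq> W \<union> set zs"
    have inv: "finite W" using frame_invariants[OF path.hyps(1)] by blast
    let ?T = "A \<union> R" and ?xs = "a # zs @ [b]"
    obtain k0 where k0: "packing E (A \<union> (R \<inter> W)) (U \<union> W) k0" "N + card (R \<inter> W) \<le> 2 * k0"
      using path.IH by (meson Int_lower2)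
    obtain k L where L: "packing E ?T (set ?xs - L) k" "card (?T \<inter> L) \<le> 1"
      "card (?T \<inter> set ?xs) \<le> 2 * k + card (?T \<inter> L)"
      using packing_path[OF assms(2) path.hyps(4,7), of ?T] by blast
    \<comment> \<open>The path has at least \<open>2 + card (R \<inter> set zs)\<close> terminals
      and wastes at most one of them. The others pay for the step from \<open>N\<close> to
      \<open>Suc N\<close> and for the new part of \<open>R\<close>.\<close>
    have "insert a (insert b (R \<inter> set zs)) \<subseteq> ?T \<inter> set ?xs" using path.hyps(2,3) by auto
    then have "card (insert a (insert b (R \<inter> set zs))) \<le> card (?T \<inter> set ?xs)"
      by (intro card_mono) auto
    moreover have "card (insert a (insert b (R \<inter> set zs))) = 2 + card (R \<inter> set zs)"
      using path.hyps(4) by auto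
    moreover have "card R = card (R \<inter> W) + card (R \<inter> set zs)"
      using R path.hyps(5) by (intro card_Int_split[OF inv]) auto
    ultimately have "Suc N + card R \<le> 2 * (k0 + k)" using k0(2) L(2,3) by presburger
    moreover have "packing E ?T (U \<union> W \<union> (set ?xs - L)) (k0 + k)"
    proof (rule packing_Un)
      show "packing E ?T (U \<union> W) k0" using k0(1) by (rule packing_mono) auto
      show "packing E ?T (set ?xs - L) k" by (rule L(1))
      show "(U \<union> W) \<inter> (set ?xs - L) = {}" using path.hyps(5) by blast
    qed
    then have "packing E ?T (insert a (insert b U) \<union> (W \<union> set zs)) (k0 + k)"
      by (rule packing_mono) auto
    ultimately show "\<exists>k. packing E ?T (insert a (insert b U) \<union> (W \<union> set zs)) k \<and>
        Suc N + card R \<le> 2 * k" by blast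
  qed
next
  case (ear N U W a w zs)
  show ?case
  proof (intro allI impI)
    fix R assume R: "R \<subseteq> W - {w} \<union> set zs"
    have finW: "finite W" and AW: "A \<inter> W = {}" using frame_invariants[OF ear.hyps(1)] by blast+
    let ?T = "A \<union> R" and ?xs = "a # zs"
    have succ: "walk E ?xs" "(last ?xs, w) \<in> E"
      using ear.hyps(7) successively_append_iff[of _ ?xs "[w]"] by auto
    obtain k L where L: "packing E ?T (set ?xs - L) k" "L \<subseteq> set ?xs" "connected_in E L"
      "L = {} \<or> last ?xs \<in> L" "card (?T \<inter> L) \<le> 1"
      "card (?T \<inter> set ?xs) \<le> 2 * k + card (?T \<inter> L)"
      using packing_path[OF assms(2) ear.hyps(4) succ(1), of ?T] by blast
    have "insert a (R \<inter> set zs) \<subseteq> ?T \<inter> set ?xs" using ear.hyps(2) by auto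
    then have "card (insert a (R \<inter> set zs)) \<le> card (?T \<inter> set ?xs)"
      by (intro card_mono) auto
    moreover have "card (insert a (R \<inter> set zs)) = 1 + card (R \<inter> set zs)"
      using ear.hyps(4) by auto
    moreover have cR: "card R = card (R \<inter> W) + card (R \<inter> set zs)"
      using R ear.hyps(5) by (intro card_Int_split[OF finW]) auto
    ultimately have cnt: "1 + card (R \<inter> set zs) \<le> 2 * k + card (?T \<inter> L)" using L(6) by linarith
    have disj: "(U \<union> W) \<inter> set ?xs = {}" using ear.hyps(5) by blast
    \<comment> \<open>An ear has only one new \<open>A\<close>-vertex to count, so no terminal may
      be wasted. If \<open>L\<close> retains one, \<open>w\<close> is made an additional terminal of
      the old frame and exchanged for it by \<open>packing_extend\<close>.\<close>
    have "\<exists>k0. packing E ?T (U \<union> W \<union> L) k0 \<and> N + card (R \<inter> W) + card (?T \<inter> L) \<le> 2 * k0"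
    proof (cases "?T \<inter> L = {}")
      case True
      obtain k0 where k0: "packing E (A \<union> (R \<inter> W)) (U \<union> W) k0" "N + card (R \<inter> W) \<le> 2 * k0"
        using ear.IH by (meson Int_lower2)
      have "packing E ?T (U \<union> W \<union> L) k0" using k0(1) by (rule packing_mono) auto
      then show ?thesis using k0(2) unfolding True by auto
    next
      case False
      then obtain t where t: "t \<in> ?T" "t \<in> L" by blast
      then have lastL: "last ?xs \<in> L" using L(4) by blast
      have "insert w (R \<inter> W) \<subseteq> W" using ear.hyps(3) by blast
      then obtain k0 where k0: "packing E (A \<union> insert w (R \<inter> W)) (U \<union> W) k0"
          "N + card (insert w (R \<inter> W)) \<le> 2 * k0"
        using ear.IH by blast
      have "packing E (insert w ?T) (U \<union> W) k0" using k0(1) by (rule packing_mono) auto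
      then have "packing E ?T (U \<union> W \<union> L) k0"
      proof (rule packing_extend[OF _ assms(2) _ L(3) t(2,1) lastL])
        show "L \<inter> (U \<union> W) = {}" using L(2) disj by blast
        show "(w, last ?xs) \<in> E" using symD[OF assms(2) succ(2)] .
      qed
      moreover have "w \<notin> R \<inter> W" using R ear.hyps(3,5) by auto
      then have "card (insert w (R \<inter> W)) = Suc (card (R \<inter> W))" using finW by simp
      ultimately show ?thesis using k0(2) L(5) by (intro exI[of _ k0]) linarith
    qed
    then obtain k0 where k0: "packing E ?T (U \<union> W \<union> L) k0"
      "N + card (R \<inter> W) + card (?T \<inter> L) \<le> 2 * k0" by blast
    have "Suc N + card R \<le> 2 * (k0 + k)" using k0(2) cnt cR by presburger
    moreover have "packing E ?T (U \<union> W \<union> L \<union> (set ?xs - L)) (k0 + k)"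
      using packing_Un[OF k0(1) L(1)] disj by blast
    then have "packing E ?T (insert a (insert w U) \<union> (W - {w} \<union> set zs)) (k0 + k)"
      by (rule packing_mono) (use L(2) in auto)
    ultimately show "\<exists>k. packing E ?T (insert a (insert w U) \<union> (W - {w} \<union> set zs)) k \<and>
        Suc N + card R \<le> 2 * k" by blast
  qed
qed

text \<open>By \<open>frame_packing\<close> with \<open>R = {}\<close>, a frame has fewer than
  \<open>2 * k\<close> ears, so one that cannot be extended exists and its \<open>U\<close> has at
  most \<open>4 * k\<close> vertices. A path between two terminals that avoids \<open>U\<close>, cut
  at the first later vertex in \<open>W\<close> or \<open>A\<close>, would be another ear.\<close>

theorem packing_or_hitting_set:
  assumes "sym E" "\<not> packing E A V k"
  obtains U where "U \<subseteq> V" "finite U" "card U \<le> 4 * k"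
    "\<And>D x y. D \<subseteq> V - U \<Longrightarrow> connected_in E D \<Longrightarrow> x \<in> D \<inter> A \<Longrightarrow> y \<in> D \<inter> A \<Longrightarrow> x = y"
proof -
  have bound: "N < 2 * k" if fr: "frame E A V N U W" for N U W
  proof (rule ccontr)
    assume "\<not> N < 2 * k"
    moreover obtain j where j: "packing E A (U \<union> W) j" "N \<le> 2 * j"
      using frame_packing[OF fr assms(1), rule_format, of "{}"] by auto
    ultimately have "k \<le> j" by simp
    then have "packing E A (U \<union> W) k" using packing_le[OF j(1)] by simp
    then have "packing E A V k"
      by (rule packing_mono) (use frame_invariants[OF fr] in auto)
    then show False using assms(2) by blast
  qed
  obtain N U W where fr: "frame E A V N U W" and max: "\<And>U' W'. \<not> frame E A V (Suc N) U' W'"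
  proof (rule ccontr)
    assume no: "\<not> thesis"
    have "\<exists>U W. frame E A V N U W" for N
    proof (induction N)
      case 0
      show ?case using frame.empty by blast
    next
      case (Suc N)
      then show ?case using that no by blast
    qed
    then show False using bound by blast
  qed
  note inv = frame_invariants[OF fr]
  have hit: "x = y" if D: "D \<subseteq> V - U" "connected_in E D" "x \<in> D \<inter> A" "y \<in> D \<inter> A" for D x y
  proof (rule ccontr)
    assume "x \<noteq> y"
    from D(3,4) have "x \<in> D" "y \<in> D" by auto
    from connected_in_imp_path[OF D(2) this]
    obtain xs where xs: "xs \<noteq> []" "hd xs = x" "last xs = y" "distinct xs" "set xs \<subseteq> D"
      "walk E xs" .
    obtain xs' where xs': "xs = x # xs'" using xs(1,2) by (cases xs) auto
    then have "y \<in> set xs'" using xs(3) \<open>x \<noteq> y\<close> by (cases xs') auto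
    then have "\<exists>v\<in>set xs'. v \<in> W \<union> A" using D(4) by blast
    then obtain zs v rest where sp: "xs' = zs @ v # rest" "v \<in> W \<union> A" "\<forall>z\<in>set zs. z \<notin> W \<union> A"
      using split_list_first_prop[of xs' "\<lambda>v. v \<in> W \<union> A"] by blast
    have eq: "xs = (x # zs @ [v]) @ rest" using xs' sp by simp
    have d: "distinct (x # zs @ [v])" using xs(4) unfolding eq by simp
    have s: "walk E (x # zs @ [v])"
      using xs(6) unfolding eq successively_append_iff by blast
    have sub: "set (x # zs @ [v]) \<subseteq> V - U" using xs(5) D(1) unfolding eq by auto
    have xA: "x \<in> A" using D(3) by blast
    then have "x \<notin> W" using inv by blast
    have zsA: "set zs \<inter> A = {}" using sp(3) by blast
    show False
    proof (cases "v \<in> W")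
      case True
      have "frame E A V (Suc N) (insert x (insert v U)) (W - {v} \<union> set zs)"
        by (rule frame.ear[OF fr xA True _ _ zsA s]) (use d sub sp(3) \<open>x \<notin> W\<close> in auto)
      then show False using max by blast
    next
      case False
      then have "v \<in> A" using sp(2) by blast
      have "frame E A V (Suc N) (insert x (insert v U)) (W \<union> set zs)"
        by (rule frame.path[OF fr xA \<open>v \<in> A\<close> d _ zsA s]) (use sub sp(3) False \<open>x \<notin> W\<close> in auto)
      then show False using max by blast
    qed
  qed
  have "card U \<le> 4 * k" using inv bound[OF fr] by linarith
  then show ?thesis using that[of U] inv hit by blast
qed

section \<open>Growing a guarded decomposition\<close>

text \<open>A packing may have surplus members, whereas a flower has an exact number of paths. So
  \<open>k\<close> members are selected, and a path is extracted from each.\<close>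

lemma packing_imp_flower:
  assumes "packing (parcs (bullet_except H i)) (color_class H i) (pverts (ugraph H)) k"
  shows "\<exists>F. flower k H i F"
proof -
  let ?E = "parcs (bullet_except H i)"
  from packingE[OF assms] obtain \<F> where \<F>: "finite \<F>" "k \<le> card \<F>" "pairwise disjnt \<F>"
    "\<Union>\<F> \<subseteq> pverts (ugraph H)" "\<forall>S\<in>\<F>. joins_terminals ?E (color_class H i) S" .
  from obtain_subset_with_card_n[OF \<F>(2)]
  obtain \<S> where sub: "\<S> \<subseteq> \<F>" and \<S>: "card \<S> = k" "finite \<S>" .
  have disjoint: "pairwise disjnt \<S>" using \<F>(3) sub by (rule pairwise_subset)
  have "\<exists>xs. vpath xs (bullet_except H i) \<and> 1 \<le> vwalk_length xs \<and> set xs \<subseteq> S \<and>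
      hd xs \<in> color_class H i \<and> last xs \<in> color_class H i" if S: "S \<in> \<S>" for S
  proof -
    obtain x y where xy: "x \<in> S" "y \<in> S" "x \<in> color_class H i" "y \<in> color_class H i" "x \<noteq> y"
      and con: "connected_in ?E S"
      using bspec[OF \<F>(5) subsetD[OF sub S]] unfolding joins_terminals_def by auto
    from connected_in_imp_path[OF con xy(1,2)]
    obtain xs where xs: "xs \<noteq> []" "hd xs = x" "last xs = y" "distinct xs" "set xs \<subseteq> S"
      "walk ?E xs" .
    have "set xs \<subseteq> pverts (bullet_except H i)"
      using xs(5) \<F>(4) subsetD[OF sub S] by (auto simp: bullet_except_def)
    then have "vpath xs (bullet_except H i)" using xs by (simp add: vpath_iff)
    moreover have "1 \<le> vwalk_length xs" using xs(1-3) xy(5) by (cases xs) (auto simp: Suc_le_eq)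
    ultimately show ?thesis using xs xy by auto
  qed
  then obtain P where P: "\<And>S. S \<in> \<S> \<Longrightarrow> vpath (P S) (bullet_except H i) \<and> 1 \<le> vwalk_length (P S) \<and>
      set (P S) \<subseteq> S \<and> hd (P S) \<in> color_class H i \<and> last (P S) \<in> color_class H i"
    by metis
  have disj: "set (P S) \<inter> set (P S') = {}" if "S \<in> \<S>" "S' \<in> \<S>" "S \<noteq> S'" for S S'
  proof -
    have "disjnt S S'" using disjoint that by (auto dest: pairwiseD)
    then show ?thesis using P[OF that(1)] P[OF that(2)] unfolding disjnt_def by blast
  qed
  have "inj_on P \<S>"
  proof (rule inj_onI, rule ccontr)
    fix S S' assume S: "S \<in> \<S>" "S' \<in> \<S>" "P S = P S'" "S \<noteq> S'"
    then have "set (P S) = {}" using disj[OF S(1,2,4)] by simp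
    then show False using P[OF S(1)] by (auto simp: vpath_iff)
  qed
  then have "card (P ` \<S>) = k" using \<S>(1) by (simp add: card_image)
  moreover have "\<forall>p\<in>P ` \<S>. \<forall>q\<in>P ` \<S>. p \<noteq> q \<longrightarrow> set p \<inter> set q = {}"
    using disj by blast
  ultimately have "flower k H i (P ` \<S>)"
    unfolding flower_def using \<S>(2) P by simp
  then show ?thesis by blast
qed

text \<open>A centroid argument: \<open>t\<close> is the largest index whose descendants contain the
  tops of at least half of \<open>Z\<close>. A subtree that avoids \<open>t\<close> either lies
  below a child of \<open>t\<close>, whose index is larger and whose share is therefore less than
  half, or contains no descendant of \<open>t\<close>.\<close>

lemma balanced_node:
  assumes pf: "parent_fun n p" and Z: "finite Z"
    and \<tau>: "\<And>z. z \<in> Z \<Longrightarrow> subtree_set p (\<tau> z) \<and> \<tau> z \<subseteq> {..<n}"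
  obtains t where "t < n"
    "\<forall>U. subtree_set p U \<longrightarrow> U \<subseteq> {..<n} \<longrightarrow> t \<notin> U \<longrightarrow> 2 * card {z \<in> Z. \<tau> z \<subseteq> U} \<le> card Z"
proof -
  have p: "\<And>k. 0 < k \<Longrightarrow> k < n \<Longrightarrow> p k < k" and n: "0 < n"
    using pf by (auto simp: parent_fun_def)
  define R where "R = {(k, p k) | k. 0 < k \<and> k < n}"
  define Below where "Below t = {k. (k, t) \<in> R\<^sup>*}" for t
  define top where "top z = (LEAST k. k \<in> \<tau> z)" for z
  have top: "top z \<in> \<tau> z" if "z \<in> Z" for z
    using \<tau>[OF that] unfolding top_def subtree_set_def by (metis LeastI)
  define w where "w t = card {z \<in> Z. top z \<in> Below t}" for t
  have below: "(k, u) \<in> R\<^sup>*"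
    if U: "\<forall>k\<in>U. k \<noteq> u \<longrightarrow> p k \<in> U \<and> p k < k" "U \<subseteq> {..<n}" "k \<in> U" for U u k
    using U(3)
  proof (induction k rule: less_induct)
    case (less k)
    show ?case
    proof (cases "k = u")
      case False
      then have pk: "p k \<in> U" "p k < k" using U(1) less.prems by auto
      then have "(k, p k) \<in> R" using U(2) less.prems unfolding R_def by fastforce
      then show ?thesis using less.IH[OF pk(2,1)] by (rule converse_rtrancl_into_rtrancl)
    qed simp
  qed
  have below0: "k \<in> Below 0" if "k < n" for k
  proof -
    have "p k < k" if "k < n" "k \<noteq> 0" for k using p[of k] that by simp
    then have "\<forall>k\<in>{..<n}. k \<noteq> 0 \<longrightarrow> p k \<in> {..<n} \<and> p k < k" using less_trans by blast
    from below[OF this] show ?thesis using that by (simp add: Below_def)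
  qed
  have "{z \<in> Z. top z \<in> Below 0} = Z" using below0 top \<tau> by blast
  then have "0 < n \<and> card Z \<le> 2 * w 0" using n by (simp add: w_def)
  then obtain t where t: "t < n" "card Z \<le> 2 * w t"
    and max: "\<And>s. s < n \<Longrightarrow> card Z \<le> 2 * w s \<Longrightarrow> s \<le> t"
    using GreatestI_nat[of "\<lambda>t. t < n \<and> card Z \<le> 2 * w t" 0 n]
      Greatest_le_nat[of "\<lambda>t. t < n \<and> card Z \<le> 2 * w t" _ n] by fastforce
  have "2 * card {z \<in> Z. \<tau> z \<subseteq> U} \<le> card Z" if U: "subtree_set p U" "U \<subseteq> {..<n}" "t \<notin> U" for U
  proof -
    obtain u where u: "u \<in> U" "\<forall>k\<in>U. k \<noteq> u \<longrightarrow> p k \<in> U \<and> p k < k"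
      using U(1) unfolding subtree_set_def by blast
    show ?thesis
    proof (cases "u \<in> Below t")
      case True
      then have "(u, t) \<in> R\<^sup>*" "u \<noteq> t" using u(1) U(3) by (auto simp: Below_def)
      then obtain s where s: "(u, s) \<in> R\<^sup>*" "(s, t) \<in> R" by (metis rtranclE)
      then have st: "t < s" "s < n" using p by (auto simp: R_def)
      have "k \<in> Below s" if "k \<in> U" for k
        using rtrancl_trans[OF below[OF u(2) U(2) that] s(1)] by (simp add: Below_def)
      then have "{z \<in> Z. \<tau> z \<subseteq> U} \<subseteq> {z \<in> Z. top z \<in> Below s}" using top by blast
      then have "card {z \<in> Z. \<tau> z \<subseteq> U} \<le> w s" unfolding w_def using Z by (intro card_mono) auto
      moreover have "\<not> card Z \<le> 2 * w s" using max[OF st(2)] st(1) by auto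
      ultimately show ?thesis by simp
    next
      case False
      have no: "k \<notin> U" if "(k, t) \<in> R\<^sup>*" for k
        using that
      proof (induction rule: converse_rtrancl_induct)
        case base
        then show ?case using U(3) .
      next
        case (step k l)
        show ?case
        proof
          assume k: "k \<in> U"
          have "(k, t) \<in> R\<^sup>*" using step(1,2) by (rule converse_rtrancl_into_rtrancl)
          then have "k \<noteq> u" using False by (auto simp: Below_def)
          then have "p k \<in> U" using u(2) k by blast
          moreover have "l = p k" using step(1) by (auto simp: R_def)
          ultimately show False using step.IH by simp
        qed
      qed
      have "{z \<in> Z. \<tau> z \<subseteq> U} \<subseteq> Z - {z \<in> Z. top z \<in> Below t}"
        using no top unfolding Below_def by blast
      then have "card {z \<in> Z. \<tau> z \<subseteq> U} \<le> card (Z - {z \<in> Z. top z \<in> Below t})"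
        using Z by (intro card_mono) auto
      also have "\<dots> = card Z - w t"
        unfolding w_def using Z by (intro card_Diff_subset) auto
      finally show ?thesis using t(2) by simp
    qed
  qed
  then show ?thesis using that t(1) by blast
qed

text \<open>\<open>Eh\<close> are the edges of \<open>H\<close>, \<open>Eb\<close> those of the graph in which every color class is a clique.
  The decomposition is grown from the root; \<open>extendable D\<close> says that it can be continued into \<open>D\<close>
  wherever \<open>D\<close> can be attached.\<close>

locale guarded_growth =
  fixes V :: "'a set" and Eh Eb :: "'a rel" and col :: "'a \<Rightarrow> 'c" and K :: nat
  assumes finV: "finite V" and symb: "sym Eb" and EbV: "Eb \<subseteq> V \<times> V"
begin

definition nbr :: "'a set \<Rightarrow> 'a set" where
  "nbr D = {u \<in> V - D. \<exists>v\<in>D. (v, u) \<in> Eb}"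

text \<open>\<open>W\<close> is the part covered so far. Connectivity of the nodes of a vertex is
  stated as the running intersection property in the order of the indices, so that adding a last
  node requires only a check of that node.\<close>

definition partial_decomposition ::
  "nat \<Rightarrow> (nat \<Rightarrow> nat) \<Rightarrow> (nat \<Rightarrow> 'a set) \<Rightarrow> (nat \<Rightarrow> 'a set) \<Rightarrow> 'a set \<Rightarrow> bool" where
  "partial_decomposition n p b g W \<longleftrightarrow> 0 < n \<and> W = (\<Union>k<n. b k) \<and> W \<subseteq> V \<and>
     (\<forall>k. 0 < k \<longrightarrow> k < n \<longrightarrow> p k < k \<and> b k \<inter> (\<Union>l<k. b l) \<subseteq> b (p k) \<and>
       b k \<inter> b (p k) \<subseteq> g k \<and> card (b k \<inter> b (p k) - g (p k)) \<le> 1) \<and>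
     (\<forall>k<n. g k \<subseteq> b k \<and> (\<forall>u\<in>b k. \<forall>v\<in>b k. (u, v) \<in> Eh \<longrightarrow> u \<in> g k \<or> v \<in> g k) \<and>
       card (g k) \<le> K \<and> card (col ` b k) \<le> K) \<and>
     (\<forall>u\<in>W. \<forall>v\<in>W. (u, v) \<in> Eb \<longrightarrow> (\<exists>k<n. u \<in> b k \<and> v \<in> b k))"

definition extendable :: "'a set \<Rightarrow> bool" where
  "extendable D \<longleftrightarrow> (\<forall>n p b g W t. partial_decomposition n p b g W \<longrightarrow> D \<inter> W = {} \<longrightarrow> t < n \<longrightarrow>
     nbr D \<subseteq> b t \<longrightarrow> card (nbr D - g t) \<le> 1 \<longrightarrow>
     (\<exists>n' p' b' g'. partial_decomposition n' p' b' g' (W \<union> D) \<and> n \<le> n' \<and>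
       (\<forall>k<n. b' k = b k \<and> g' k = g k)))"

text \<open>Edges between newly and previously covered vertices must fit into the new bag; this is
  the purpose of \<open>edges\<close>.\<close>

lemma partial_decomposition_add_node:
  assumes d: "partial_decomposition n p b g W" and t: "t < n"
    and B: "B \<subseteq> V" "B \<inter> W \<subseteq> b t" "B \<inter> W \<subseteq> G" "G \<subseteq> B" "card (B \<inter> b t - g t) \<le> 1"
    and cover: "\<And>u v. u \<in> B \<Longrightarrow> v \<in> B \<Longrightarrow> (u, v) \<in> Eh \<Longrightarrow> u \<in> G \<or> v \<in> G"
    and size: "card G \<le> K" "card (col ` B) \<le> K"
    and edges: "\<And>u v. u \<in> B - W \<Longrightarrow> v \<in> W \<Longrightarrow> (u, v) \<in> Eb \<Longrightarrow> v \<in> B"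
  shows "partial_decomposition (Suc n) (p(n := t)) (b(n := B)) (g(n := G)) (W \<union> B)"
proof -
  let ?p = "p(n := t)" and ?b = "b(n := B)" and ?g = "g(n := G)"
  have n: "0 < n" and W: "W = (\<Union>k<n. b k)" "W \<subseteq> V"
    and tree: "\<And>k. 0 < k \<Longrightarrow> k < n \<Longrightarrow> p k < k \<and> b k \<inter> (\<Union>l<k. b l) \<subseteq> b (p k) \<and>
       b k \<inter> b (p k) \<subseteq> g k \<and> card (b k \<inter> b (p k) - g (p k)) \<le> 1"
    and node: "\<And>k. k < n \<Longrightarrow> g k \<subseteq> b k \<and> (\<forall>u\<in>b k. \<forall>v\<in>b k. (u, v) \<in> Eh \<longrightarrow> u \<in> g k \<or> v \<in> g k) \<and>
       card (g k) \<le> K \<and> card (col ` b k) \<le> K"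
    and old: "\<And>u v. u \<in> W \<Longrightarrow> v \<in> W \<Longrightarrow> (u, v) \<in> Eb \<Longrightarrow> \<exists>k<n. u \<in> b k \<and> v \<in> b k"
    using d unfolding partial_decomposition_def by blast+
  have same: "(\<Union>l<k. ?b l) = (\<Union>l<k. b l)" if "k \<le> n" for k
    using that by (intro SUP_cong) auto
  have btW: "b t \<subseteq> W" using W(1) t by blast
  have A1: "W \<union> B = (\<Union>k<Suc n. ?b k)" using same[of n] W(1) by (auto simp: lessThan_Suc)
  have A2: "?p k < k \<and> ?b k \<inter> (\<Union>l<k. ?b l) \<subseteq> ?b (?p k) \<and> ?b k \<inter> ?b (?p k) \<subseteq> ?g k \<and>
      card (?b k \<inter> ?b (?p k) - ?g (?p k)) \<le> 1" if k: "0 < k" "k < Suc n" for k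
  proof (cases "k = n")
    case True
    have "B \<inter> b t \<subseteq> G" using btW B(3) by blast
    then show ?thesis using True t B(2,5) same[of n] W(1) by simp
  next
    case False
    then have "k < n" using k by simp
    then show ?thesis using tree[OF k(1) \<open>k < n\<close>] same[of k] by simp
  qed
  have A3: "?g k \<subseteq> ?b k \<and> (\<forall>u\<in>?b k. \<forall>v\<in>?b k. (u, v) \<in> Eh \<longrightarrow> u \<in> ?g k \<or> v \<in> ?g k) \<and>
      card (?g k) \<le> K \<and> card (col ` ?b k) \<le> K" if "k < Suc n" for k
    using node[of k] that B(4) cover size by (cases "k = n") auto
  have A4: "\<exists>k<Suc n. u \<in> ?b k \<and> v \<in> ?b k"
    if uv: "u \<in> W \<union> B" "v \<in> W \<union> B" "(u, v) \<in> Eb" for u v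
  proof (cases "u \<in> W \<and> v \<in> W")
    case True
    then obtain k where "k < n" "u \<in> b k" "v \<in> b k" using old uv(3) by blast
    then show ?thesis by (intro exI[of _ k]) auto
  next
    case False
    have "(v, u) \<in> Eb" using symD[OF symb uv(3)] .
    then have "u \<in> B \<and> v \<in> B" using False uv edges by blast
    then show ?thesis by (intro exI[of _ n]) auto
  qed
  have A5: "W \<union> B \<subseteq> V" using W(2) B(1) by blast
  show ?thesis
    unfolding partial_decomposition_def
  proof (intro conjI)
    show "0 < Suc n" by simp
    show "W \<union> B = (\<Union>k<Suc n. ?b k)" by (rule A1)
    show "W \<union> B \<subseteq> V" by (rule A5)
    show "\<forall>k. 0 < k \<longrightarrow> k < Suc n \<longrightarrow> ?p k < k \<and> ?b k \<inter> (\<Union>l<k. ?b l) \<subseteq> ?b (?p k) \<and>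
        ?b k \<inter> ?b (?p k) \<subseteq> ?g k \<and> card (?b k \<inter> ?b (?p k) - ?g (?p k)) \<le> 1"
      by (intro allI impI) (rule A2)
    show "\<forall>k<Suc n. ?g k \<subseteq> ?b k \<and> (\<forall>u\<in>?b k. \<forall>v\<in>?b k. (u, v) \<in> Eh \<longrightarrow> u \<in> ?g k \<or> v \<in> ?g k) \<and>
        card (?g k) \<le> K \<and> card (col ` ?b k) \<le> K"
      by (intro allI impI) (rule A3)
    show "\<forall>u\<in>W \<union> B. \<forall>v\<in>W \<union> B. (u, v) \<in> Eb \<longrightarrow> (\<exists>k<Suc n. u \<in> ?b k \<and> v \<in> ?b k)"
      by (intro ballI impI) (rule A4)
  qed
qed

lemma nbr_component_subset:
  assumes "Y \<subseteq> D" "x \<in> D - Y"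
  shows "nbr (component_of Eb (D - Y) x) \<subseteq> nbr D \<union> Y"
proof
  let ?C = "component_of Eb (D - Y) x"
  fix u assume "u \<in> nbr ?C"
  then obtain v where u: "u \<in> V" "u \<notin> ?C" "v \<in> ?C" "(v, u) \<in> Eb" unfolding nbr_def by blast
  then have "u \<notin> D - Y" using component_of_closed by metis
  moreover have "v \<in> D" using u(3) component_of_subset[of Eb "D - Y" x] by blast
  ultimately show "u \<in> nbr D \<union> Y" using u unfolding nbr_def by blast
qed

text \<open>The new node has bag \<open>nbr D \<union> Y\<close> and guard
  \<open>nbr D \<union> Y'\<close>, and every component of \<open>D - Y\<close> is attached to it.
  The components can be treated one at a time because an extension leaves earlier bags and guards
  unchanged. A color class is split off with \<open>Y' = {}\<close>, hitting vertices with
  \<open>Y' = Y\<close>.\<close>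

lemma extendable_step:
  assumes D: "D \<subseteq> V" and Y: "Y \<subseteq> D" "Y' \<subseteq> Y"
    and cover: "\<And>u v. u \<in> Y \<Longrightarrow> v \<in> Y \<Longrightarrow> (u, v) \<in> Eh \<Longrightarrow> u \<in> Y' \<or> v \<in> Y'"
    and size: "card (nbr D \<union> Y') \<le> K" "card (col ` (nbr D \<union> Y)) \<le> K"
    and comp: "\<And>x. x \<in> D - Y \<Longrightarrow> extendable (component_of Eb (D - Y) x) \<and>
      card (nbr (component_of Eb (D - Y) x) - (nbr D \<union> Y')) \<le> 1"
  shows "extendable D"
  unfolding extendable_def
proof (intro allI impI)
  let ?comp = "component_of Eb (D - Y)"
  fix n p b g W t
  assume d: "partial_decomposition n p b g W" and DW: "D \<inter> W = {}" and t: "t < n"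
    and nb: "nbr D \<subseteq> b t" and one: "card (nbr D - g t) \<le> 1"
  note d' = d[unfolded partial_decomposition_def]
  have W: "W = (\<Union>k<n. b k)" using d'[THEN conjunct2, THEN conjunct1] .
  have WV: "W \<subseteq> V" using d'[THEN conjunct2, THEN conjunct2, THEN conjunct1] .
  have btW: "b t \<subseteq> W" unfolding W using t by blast
  let ?B = "nbr D \<union> Y" and ?G = "nbr D \<union> Y'"
  let ?p = "p(n := t)" and ?b = "b(n := ?B)" and ?g = "g(n := ?G)"
  have "?B \<subseteq> V" using D Y(1) unfolding nbr_def by blast
  then have finB: "finite ?B" using finV by (rule finite_subset)
  have d1: "partial_decomposition (Suc n) ?p ?b ?g (W \<union> ?B)"
  proof (rule partial_decomposition_add_node[OF d t])
    show "?B \<subseteq> V" using D Y(1) unfolding nbr_def by blast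
    show "?B \<inter> W \<subseteq> b t" "?B \<inter> W \<subseteq> ?G" using nb DW Y(1) by blast+
    show "?G \<subseteq> ?B" using Y(2) by blast
    have "?B \<inter> b t - g t \<subseteq> nbr D - g t" using DW Y(1) btW by blast
    then have "card (?B \<inter> b t - g t) \<le> card (nbr D - g t)"
      using finB by (intro card_mono) auto
    then show "card (?B \<inter> b t - g t) \<le> 1" using one by simp
    show "u \<in> ?G \<or> v \<in> ?G" if "u \<in> ?B" "v \<in> ?B" "(u, v) \<in> Eh" for u v
      using that cover by blast
    show "card ?G \<le> K" "card (col ` ?B) \<le> K" by (rule size)+
    fix u v assume u: "u \<in> ?B - W" and v: "v \<in> W" and uv: "(u, v) \<in> Eb"
    have "u \<in> D" using u nb btW Y(1) by blast
    moreover have "v \<notin> D" "v \<in> V" using v DW WV by blast+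
    ultimately show "v \<in> ?B" using uv unfolding nbr_def by blast
  qed
  have grow: "\<exists>n' p' b' g'. partial_decomposition n' p' b' g' (W \<union> ?B \<union> \<Union>\<C>) \<and> Suc n \<le> n' \<and>
      (\<forall>k<Suc n. b' k = ?b k \<and> g' k = ?g k)"
    if "finite \<C>" "\<C> \<subseteq> ?comp ` (D - Y)" for \<C>
    using that
  proof (induction \<C> rule: finite_induct)
    case empty
    have "partial_decomposition (Suc n) ?p ?b ?g (W \<union> ?B \<union> \<Union>{})"
      using d1 by (simp only: Union_empty Un_empty_right)
    then show ?case by blast
  next
    case (insert C \<C>)
    then obtain n' p' b' g' where d': "partial_decomposition n' p' b' g' (W \<union> ?B \<union> \<Union>\<C>)"
      "Suc n \<le> n'" "\<And>k. k < Suc n \<Longrightarrow> b' k = ?b k \<and> g' k = ?g k"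
      by auto
    obtain x where x: "x \<in> D - Y" "C = ?comp x" using insert.prems by auto
    have CD: "C \<subseteq> D - Y" unfolding x(2) by (rule component_of_subset)
    have "C \<inter> C' = {}" if C': "C' \<in> \<C>" for C'
    proof (rule ccontr)
      assume "C \<inter> C' \<noteq> {}"
      then obtain y where y: "y \<in> C" "y \<in> C'" by blast
      obtain x' where "C' = ?comp x'" using insert.prems C' by auto
      then have "C' = ?comp y" using y(2) component_of_eq[OF symb] by metis
      moreover have "C = ?comp y" using x(2) y(1) component_of_eq[OF symb] by metis
      ultimately show False using C' insert.hyps(2) by simp
    qed
    moreover have "C \<inter> nbr D = {}" using CD unfolding nbr_def by blast
    ultimately have dis: "C \<inter> (W \<union> ?B \<union> \<Union>\<C>) = {}" using CD DW by blast
    have bn: "b' n = ?B" "g' n = ?G" using d'(3)[of n] by simp_all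
    have nC: "nbr C \<subseteq> b' n"
      unfolding bn x(2) using nbr_component_subset[OF Y(1) x(1)] by blast
    have cC: "extendable C" "card (nbr C - g' n) \<le> 1" using comp[OF x(1)] unfolding bn x(2) by auto
    have "n < n'" using d'(2) by simp
    from cC(1)[unfolded extendable_def, rule_format, OF d'(1) dis this nC cC(2)]
    obtain n2 p2 b2 g2 where d2: "partial_decomposition n2 p2 b2 g2 (W \<union> ?B \<union> \<Union>\<C> \<union> C)"
      "n' \<le> n2" "\<forall>k<n'. b2 k = b' k \<and> g2 k = g' k" by blast
    have eq: "W \<union> ?B \<union> \<Union>\<C> \<union> C = W \<union> ?B \<union> \<Union>(insert C \<C>)" by blast
    have "b2 k = ?b k \<and> g2 k = ?g k" if "k < Suc n" for k
      using d'(2) d'(3)[of k] d2(3) that by auto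
    moreover have "Suc n \<le> n2" using d2(2) d'(2) by simp
    moreover have "partial_decomposition n2 p2 b2 g2 (W \<union> ?B \<union> \<Union>(insert C \<C>))"
      using d2(1) unfolding eq .
    ultimately show ?case by blast
  qed
  have "finite (?comp ` (D - Y))"
    using finite_subset[OF D finV] by blast
  from grow[OF this order_refl] obtain n' p' b' g' where
    d': "partial_decomposition n' p' b' g' (W \<union> ?B \<union> \<Union>(?comp ` (D - Y)))"
      "Suc n \<le> n'" "\<forall>k<Suc n. b' k = ?b k \<and> g' k = ?g k" by blast
  have "\<Union>(?comp ` (D - Y)) = D - Y"
  proof
    show "\<Union>(?comp ` (D - Y)) \<subseteq> D - Y"
      by (rule UN_least) (rule component_of_subset)
    show "D - Y \<subseteq> \<Union>(?comp ` (D - Y))"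
      by (rule subsetI, rule UN_I, assumption, rule component_of_self, assumption)
  qed
  then have eq: "W \<union> ?B \<union> \<Union>(?comp ` (D - Y)) = W \<union> D"
    using nb btW Y(1) by blast
  have "\<forall>k<n. b' k = b k \<and> g' k = g k" using d'(3) by auto
  moreover have "n \<le> n'" using d'(2) by simp
  moreover have "partial_decomposition n' p' b' g' (W \<union> D)" using d'(1) unfolding eq .
  ultimately show "\<exists>n' p' b' g'. partial_decomposition n' p' b' g' (W \<union> D) \<and> n \<le> n' \<and>
       (\<forall>k<n. b' k = b k \<and> g' k = g k)"
    by blast
qed

lemma partial_decomposition_exists:
  assumes "\<And>x. x \<in> V \<Longrightarrow> extendable (component_of Eb V x)"
  obtains n p b g where "partial_decomposition n p b g V"
proof -
  have nV: "nbr V = {}" by (auto simp: nbr_def)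
  have "extendable V"
  proof (rule extendable_step[where Y = "{}" and Y' = "{}"])
    fix x assume x: "x \<in> V - {}"
    have "nbr (component_of Eb V x) = {}"
      using nbr_component_subset[of "{}" V x] x nV by simp
    then show "extendable (component_of Eb (V - {}) x) \<and>
        card (nbr (component_of Eb (V - {}) x) - (nbr V \<union> {})) \<le> 1"
      using assms x by simp
  qed (auto simp: nV)
  \<comment> \<open>An empty root bag suffices to attach \<open>V\<close>, which has no
    neighbours.\<close>
  moreover have "partial_decomposition 1 (\<lambda>_. 0) (\<lambda>_. {}) (\<lambda>_. {}) {}"
    by (simp add: partial_decomposition_def)
  ultimately have "\<exists>n' p' b' g'. partial_decomposition n' p' b' g' ({} \<union> V)"
    unfolding extendable_def using nV by (metis Diff_empty Int_empty_right card.empty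
      empty_Diff empty_subsetI zero_le zero_less_one)
  then show ?thesis using that by auto
qed

end

lemma connected_in_Un_neighbours:
  assumes "connected_in E D" "sym E" "finite A" "\<And>a. a \<in> A \<Longrightarrow> \<exists>d\<in>D. (d, a) \<in> E"
  shows "connected_in E (D \<union> A)"
  using assms(3,4)
proof (induction A rule: finite_induct)
  case empty
  then show ?case using assms(1) by simp
next
  case (insert a A)
  then obtain d where "d \<in> D" "(d, a) \<in> E" by blast
  moreover have "connected_in E (D \<union> A)" using insert by blast
  ultimately have "connected_in E (insert a (D \<union> A))"
    using connected_in_insert[OF _ assms(2), of "D \<union> A" d a] by blast
  then show ?case by simp
qed

text \<open>The neighbourhood of the part still to be decomposed is kept small by a balanced separator
  of the class graph: only the hitting sets of its colors, one further vertex of each of them, and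
  half of the old neighbourhood survive.\<close>

locale class_hitting_sets = guarded_growth V Eh Eb col K
  for V :: "'a set" and Eh Eb :: "'a rel" and col :: "'a \<Rightarrow> 'c" and K :: nat +
  fixes S :: "'c \<Rightarrow> 'a set" and s c z n :: nat and p :: "nat \<Rightarrow> nat" and bag :: "nat \<Rightarrow> 'c set"
  assumes symh: "sym Eh" and irrh: "\<And>v. (v, v) \<notin> Eh"
    and Eb_iff: "\<And>u v. (u, v) \<in> Eb \<longleftrightarrow> (u, v) \<in> Eh \<or> u \<noteq> v \<and> u \<in> V \<and> v \<in> V \<and> col u = col v"
    and S: "\<And>i. i \<in> col ` V \<Longrightarrow> finite (S i) \<and> card (S i) \<le> s"
    and hit: "\<And>i D x y. i \<in> col ` V \<Longrightarrow> D \<subseteq> V - S i \<Longrightarrow>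
      connected_in (Eh \<union> {(u, v). u \<noteq> v \<and> u \<in> V \<and> v \<in> V \<and> col u = col v \<and> col u \<noteq> i}) D \<Longrightarrow>
      x \<in> D \<Longrightarrow> y \<in> D \<Longrightarrow> col x = i \<Longrightarrow> col y = i \<Longrightarrow> x = y"
    and pf: "parent_fun n p" and bag: "\<And>k. k < n \<Longrightarrow> finite (bag k) \<and> card (bag k) \<le> Suc c \<and> bag k \<subseteq> col ` V"
    and tau: "\<And>i. i \<in> col ` V \<Longrightarrow> subtree_set p (nodes n bag i)"
    and class_edge: "\<And>u v. (u, v) \<in> Eh \<Longrightarrow> col u \<noteq> col v \<Longrightarrow> \<exists>k<n. col u \<in> bag k \<and> col v \<in> bag k"
    and z: "z = 2 * ((c + 2) * s + (c + 2))"
    and K: "K = z + (c + 2) * s + (c + 2) + 1"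
begin

text \<open>The edges of \<open>bullet_except\<close> for color \<open>i\<close>, in which
  \<open>S i\<close> hits all paths between vertices of color \<open>i\<close>. On sets without that
  color they agree with \<open>Eb\<close>.\<close>

definition Ei :: "'c \<Rightarrow> 'a rel" where
  "Ei i = Eh \<union> {(u, v). u \<noteq> v \<and> u \<in> V \<and> v \<in> V \<and> col u = col v \<and> col u \<noteq> i}"

lemma sym_Ei: "sym (Ei i)"
  using symh unfolding Ei_def sym_def by auto

lemma finite_nbr: "finite (nbr D)"
  using finV unfolding nbr_def by auto

lemma connected_Ei:
  assumes "connected_in Eb D" "\<And>v. v \<in> D \<Longrightarrow> col v \<noteq> i"
  shows "connected_in (Ei i) D"
  by (rule connected_in_mono[OF assms(1)]) (use assms(2) Eb_iff in \<open>auto simp: Ei_def\<close>)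

text \<open>Otherwise \<open>D\<close> with \<open>u\<close> and \<open>v\<close> would be connected
  in \<open>Ei i\<close> and avoid \<open>S i\<close>, against \<open>hit\<close>. The edges from
  \<open>D\<close> to \<open>u\<close> and \<open>v\<close> belong to \<open>Eh\<close>, because no
  vertex of \<open>D\<close> has color \<open>i\<close>.\<close>

lemma nbr_unique:
  assumes D: "D \<subseteq> V" "connected_in Eb D" "\<And>v. v \<in> D \<Longrightarrow> col v \<noteq> i" "D \<inter> S i = {}"
    and u: "u \<in> nbr D" "u \<notin> S i" "col u = i" and v: "v \<in> nbr D" "v \<notin> S i" "col v = i"
  shows "u = v"
proof -
  have edge: "\<exists>d\<in>D. (d, w) \<in> Ei i" if w: "w \<in> nbr D" "col w = i" for w
  proof -
    obtain d where d: "d \<in> D" "(d, w) \<in> Eb" using w(1) unfolding nbr_def by blast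
    then have "(d, w) \<in> Eh" using Eb_iff[of d w] D(3)[OF d(1)] w(2) by simp
    then show ?thesis using d(1) by (auto simp: Ei_def)
  qed
  have con: "connected_in (Ei i) (D \<union> {u, v})"
  proof (rule connected_in_Un_neighbours[OF connected_Ei[OF D(2,3)] sym_Ei])
    fix a assume "a \<in> {u, v}"
    then show "\<exists>d\<in>D. (d, a) \<in> Ei i" using edge u v by blast
  qed auto
  have "u \<in> V" "v \<in> V" using u(1) v(1) by (auto simp: nbr_def)
  then have "D \<union> {u, v} \<subseteq> V - S i" using D(1,4) u(2) v(2) by blast
  moreover have "i \<in> col ` V" using \<open>u \<in> V\<close> u(3) by blast
  ultimately show ?thesis
    using hit[of i "D \<union> {u, v}" u v] con u(3) v(3) unfolding Ei_def by blast
qed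

text \<open>A neighbour outside \<open>Z\<close> and \<open>X\<close> has a color in
  \<open>I\<close>, and by \<open>nbr_unique\<close> each color accounts for at most one neighbour
  outside \<open>X\<close>.\<close>

lemma card_nbr_le:
  assumes D: "D \<subseteq> V" "connected_in Eb D"
    and I: "finite I" "\<And>i. i \<in> I \<Longrightarrow> D \<inter> S i = {} \<and> S i \<subseteq> X" "\<And>v. v \<in> D \<Longrightarrow> col v \<notin> I"
    and nb: "nbr D \<subseteq> Z \<union> X \<union> {v. col v \<in> I}" and fin: "finite Z" "finite X"
  shows "card (nbr D) \<le> card Z + card X + card I"
proof -
  define Y where "Y = {v \<in> nbr D. v \<notin> X \<and> col v \<in> I}"
  have "inj_on col Y"
  proof (rule inj_onI)
    fix u v assume uv: "u \<in> Y" "v \<in> Y" "col u = col v"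
    then have "col u \<in> I" "u \<notin> X" "v \<notin> X" "u \<in> nbr D" "v \<in> nbr D" by (auto simp: Y_def)
    note Y = this
    show "u = v"
    proof (rule nbr_unique[OF D, of "col u"])
      show "col w \<noteq> col u" if "w \<in> D" for w using I(3)[OF that] Y(1) by auto
      show "D \<inter> S (col u) = {}" "u \<notin> S (col u)" "v \<notin> S (col u)" using I(2)[OF Y(1)] Y by blast+
    qed (use Y uv(3) in auto)
  qed
  then have "card Y \<le> card I"
    using I(1) by (intro card_inj_on_le[of col]) (auto simp: Y_def)
  have "nbr D \<subseteq> Z \<union> X \<union> Y" using nb by (auto simp: Y_def)
  moreover have "finite Y" using finite_nbr by (simp add: Y_def)
  ultimately have "card (nbr D) \<le> card (Z \<union> X \<union> Y)" using fin by (intro card_mono) auto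
  also have "\<dots> \<le> card Z + card X + card Y"
    by (meson add_right_mono card_Un_le order_trans)
  finally show ?thesis using \<open>card Y \<le> card I\<close> by simp
qed

text \<open>\<open>J\<close> contains the colors of \<open>I\<close> still to be split off. For
  \<open>j\<close> in \<open>J\<close>, the next bag takes the whole class within \<open>D\<close>,
  with guard \<open>nbr D\<close>: away from \<open>S j\<close> this part is independent, and each
  remaining component has at most one new neighbour in it. Once \<open>J\<close> is empty,
  \<open>base\<close> takes over.\<close>

lemma extendable_classes:
  assumes I: "finite I" "I \<subseteq> col ` V" and X: "finite X" "\<And>i. i \<in> I \<Longrightarrow> S i \<subseteq> X"
    and Z: "finite Z" and size: "card Z + card X + card I < K"
    and base: "\<And>D'. D' \<subseteq> D0 \<Longrightarrow> connected_in Eb D' \<Longrightarrow> D' \<noteq> {} \<Longrightarrow> D' \<inter> X = {} \<Longrightarrow>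
      (\<And>v. v \<in> D' \<Longrightarrow> col v \<notin> I) \<Longrightarrow> nbr D' \<subseteq> Z \<union> X \<union> {v. col v \<in> I} \<Longrightarrow> extendable D'"
    and D0: "D0 \<subseteq> V"
  shows "J \<subseteq> I \<Longrightarrow> D \<subseteq> D0 \<Longrightarrow> connected_in Eb D \<Longrightarrow> D \<noteq> {} \<Longrightarrow> D \<inter> X = {} \<Longrightarrow>
    (\<And>v. v \<in> D \<Longrightarrow> col v \<notin> I - J) \<Longrightarrow> nbr D \<subseteq> Z \<union> X \<union> {v. col v \<in> I - J} \<Longrightarrow> extendable D"
proof (induction "card J" arbitrary: J D)
  case 0
  then have "J = {}" using I(1) by (metis card_0_eq finite_subset)
  with 0 show ?case using base[of D] by simp
next
  case (Suc m)
  then obtain j where j: "j \<in> J" by (metis card.empty ex_in_conv nat.distinct(1))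
  have finJ: "finite J" using Suc.prems(1) I(1) by (rule finite_subset)
  have jI: "j \<in> I" "j \<in> col ` V" using j Suc.prems(1) I(2) by auto
  have jX: "S j \<subseteq> X" using X(2) jI(1) by blast
  have DV: "D \<subseteq> V" using Suc.prems(2) D0 by blast
  define Y where "Y = {v \<in> D. col v = j}"
  \<comment> \<open>The strict inequality leaves room for the color \<open>j\<close>, which the bag
    may have in addition to the colors of \<open>nbr D\<close>.\<close>
  have card_nbr: "card (nbr D) < K"
  proof -
    have "card (nbr D) \<le> card Z + card X + card (I - J)"
    proof (rule card_nbr_le[OF DV Suc.prems(3)])
      show "D \<inter> S i = {} \<and> S i \<subseteq> X" if "i \<in> I - J" for i
        using X(2)[of i] that Suc.prems(5) by blast
    qed (use I(1) Suc.prems(6,7) Z X(1) in auto)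
    also have "\<dots> \<le> card Z + card X + card I" using I(1) by (simp add: card_mono)
    finally show ?thesis using size by simp
  qed
  show ?case
  proof (rule extendable_step[OF DV, of Y "{}"])
    show "Y \<subseteq> D" "{} \<subseteq> Y" by (auto simp: Y_def)
    show "card (nbr D \<union> {}) \<le> K" using card_nbr by simp
    have "card (col ` (nbr D \<union> Y)) \<le> card (insert j (col ` nbr D))"
      using finite_nbr by (intro card_mono) (auto simp: Y_def)
    also have "\<dots> \<le> Suc (card (col ` nbr D))" using finite_nbr by (simp add: card_insert_if)
    also have "\<dots> \<le> Suc (card (nbr D))" using card_image_le[OF finite_nbr] by simp
    finally show "card (col ` (nbr D \<union> Y)) \<le> K" using card_nbr by simp
    show "u \<in> {} \<or> v \<in> {}" if uv: "u \<in> Y" "v \<in> Y" "(u, v) \<in> Eh" for u v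
    proof -
      have e: "(u, v) \<in> Ei j" using uv(3) by (simp add: Ei_def)
      have "connected_in (Ei j) {v, u}"
        by (rule connected_in_insert[OF connected_in_singleton sym_Ei _ e]) simp
      moreover have "{v, u} \<subseteq> V - S j"
        using uv(1,2) DV Suc.prems(5) jX unfolding Y_def by blast
      ultimately have "u = v"
        using hit[OF jI(2), of "{v, u}" u v] uv(1,2) unfolding Ei_def Y_def by simp
      then show ?thesis using irrh uv(3) by simp
    qed
    fix x assume x: "x \<in> D - Y"
    let ?C = "component_of Eb (D - Y) x"
    have CD: "?C \<subseteq> D - Y" by (rule component_of_subset)
    have conC: "connected_in Eb ?C" using connected_in_component_of[OF symb x] .
    have neC: "?C \<noteq> {}" using component_of_self[OF x] by blast
    have CX: "?C \<inter> X = {}" using CD Suc.prems(5) by blast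
    have Yd: "Y \<subseteq> D" by (auto simp: Y_def)
    have nbC: "nbr ?C \<subseteq> nbr D \<union> Y" by (rule nbr_component_subset[OF Yd x])
    have "extendable ?C"
    proof (rule Suc.hyps(1)[of "J - {j}"])
      show "m = card (J - {j})" using Suc.hyps(2) j finJ by simp
      show "J - {j} \<subseteq> I" using Suc.prems(1) by blast
      show "?C \<subseteq> D0" using CD Suc.prems(2) by blast
      show "connected_in Eb ?C" "?C \<noteq> {}" "?C \<inter> X = {}" by (rule conC neC CX)+
      show "col v \<notin> I - (J - {j})" if "v \<in> ?C" for v
      proof -
        have "v \<in> D" "col v \<noteq> j" using that CD unfolding Y_def by auto
        then show ?thesis using Suc.prems(6) by blast
      qed
      show "nbr ?C \<subseteq> Z \<union> X \<union> {v. col v \<in> I - (J - {j})}"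
      proof
        fix v assume "v \<in> nbr ?C"
        then consider "v \<in> nbr D" | "col v = j" using nbC unfolding Y_def by blast
        then show "v \<in> Z \<union> X \<union> {v. col v \<in> I - (J - {j})}"
        proof cases
          case 1
          then show ?thesis using Suc.prems(7) by auto
        next
          case 2
          then show ?thesis using jI(1) by simp
        qed
      qed
    qed
    moreover have "card (nbr ?C - (nbr D \<union> {})) \<le> 1"
    proof -
      have "u = v" if uv: "u \<in> nbr ?C - (nbr D \<union> {})" "v \<in> nbr ?C - (nbr D \<union> {})" for u v
      proof (rule nbr_unique[of ?C j])
        show "?C \<subseteq> V" using CD DV by blast
        show "connected_in Eb ?C" by (rule conC)
        show "col w \<noteq> j" if "w \<in> ?C" for w using that CD unfolding Y_def by auto
        show "?C \<inter> S j = {}" using CX jX by blast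
        have "u \<in> Y" "v \<in> Y" using uv nbC by auto
        then have "u \<in> D" "v \<in> D" "col u = j" "col v = j" unfolding Y_def by auto
        then show "u \<notin> S j" "v \<notin> S j" "col u = j" "col v = j" using Suc.prems(5) jX by blast+
        show "u \<in> nbr ?C" "v \<in> nbr ?C" using uv by auto
      qed
      then show ?thesis using finite_nbr by (simp add: card_le_Suc0_iff_eq)
    qed
    ultimately show "extendable ?C \<and> card (nbr ?C - (nbr D \<union> {})) \<le> 1" by blast
  qed
qed

text \<open>A bag guarded by \<open>nbr D \<union> (D \<inter> X)\<close> removes the hitting sets,
  and \<open>extendable_classes\<close> removes the classes of \<open>I\<close>. What is left is
  smaller than \<open>D\<close> and again has at most \<open>z\<close> neighbours.\<close>

lemma extendable_small_nbr:
  "D \<subseteq> V \<Longrightarrow> connected_in Eb D \<Longrightarrow> D \<noteq> {} \<Longrightarrow> card (nbr D) \<le> z \<Longrightarrow> extendable D"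
proof (induction "card D" arbitrary: D rule: less_induct)
  case less
  define \<tau> where "\<tau> v = nodes n bag (col v)" for v
  have st: "subtree_set p (\<tau> v) \<and> \<tau> v \<subseteq> {..<n}" if "v \<in> V" for v
    using tau[of "col v"] that by (auto simp: \<tau>_def)
  have meet: "\<tau> u \<inter> \<tau> v \<noteq> {}" if "(u, v) \<in> Eb" for u v
  proof (cases "col u = col v")
    case True
    have "u \<in> V" using that EbV by blast
    then have "\<tau> u \<noteq> {}" using st unfolding subtree_set_def by blast
    moreover have "\<tau> u = \<tau> v" using True by (simp add: \<tau>_def)
    ultimately show ?thesis by simp
  next
    case False
    then have "(u, v) \<in> Eh" using that Eb_iff[of u v] by simp
    then show ?thesis using class_edge[OF _ False] by (auto simp: \<tau>_def)
  qed
  have "\<And>v. v \<in> nbr D \<Longrightarrow> subtree_set p (\<tau> v) \<and> \<tau> v \<subseteq> {..<n}"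
    using st by (simp add: nbr_def)
  from balanced_node[OF pf finite_nbr[of D], of \<tau>, OF this] obtain t where t: "t < n"
    and bal: "\<forall>U. subtree_set p U \<longrightarrow> U \<subseteq> {..<n} \<longrightarrow> t \<notin> U \<longrightarrow>
      2 * card {v \<in> nbr D. \<tau> v \<subseteq> U} \<le> card (nbr D)" .
  obtain d where d: "d \<in> D" using less.prems(3) by blast
  \<comment> \<open>The color of some \<open>d\<close> in \<open>D\<close> is added so that every
    remaining part loses \<open>d\<close> and the induction advances, even if no vertex of
    \<open>D\<close> has a color in \<open>bag t\<close>.\<close>
  define I where "I = insert (col d) (bag t)"
  define X where "X = (\<Union>i\<in>I. S i)"
  have I: "finite I" "I \<subseteq> col ` V" "card I \<le> c + 2"
    using bag[OF t] d less.prems(1) by (auto simp: I_def card_insert_if)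
  have finX: "finite X" unfolding X_def using I S by blast
  have cardX: "card X \<le> (c + 2) * s"
  proof -
    have "card X \<le> (\<Sum>i\<in>I. card (S i))" unfolding X_def by (rule card_UN_le[OF I(1)])
    also have "\<dots> \<le> of_nat (card I) * s" using I(2) S by (intro sum_bounded_above) blast
    also have "\<dots> \<le> (c + 2) * s" using mult_le_mono1[OF I(3), of s] by simp
    finally show ?thesis .
  qed
  have inner: "extendable D'"
    if D': "D' \<subseteq> D" "connected_in Eb D'" "D' \<noteq> {}" "D' \<inter> X = {}" "\<And>v. v \<in> D' \<Longrightarrow> col v \<notin> I"
      and nb: "nbr D' \<subseteq> nbr D \<union> X \<union> {v. col v \<in> I}" for D'
  proof (rule less.hyps)
    have "d \<notin> D'" using D'(5)[of d] by (auto simp: I_def)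
    then have "D' \<subset> D" using D'(1) d by blast
    then show "card D' < card D"
      using finite_subset[OF less.prems(1) finV] by (rule psubset_card_mono[rotated])
    show D'V: "D' \<subseteq> V" using D'(1) less.prems(1) by blast
    show "connected_in Eb D'" "D' \<noteq> {}" by (rule D')+
    \<comment> \<open>The old neighbours that survive. Together with \<open>D'\<close> they are
      connected and avoid the colors of \<open>bag t\<close>, so the nodes of their colors form a
      subtree without \<open>t\<close>; balance bounds \<open>A\<close> by half of
      \<open>nbr D\<close>.\<close>
    define A where "A = {v \<in> nbr D'. v \<in> nbr D \<and> col v \<notin> I}"
    have finA: "finite A" using finite_nbr by (simp add: A_def)
    have AV: "D' \<union> A \<subseteq> V" using D'V by (auto simp: A_def nbr_def)
    define U where "U = (\<Union>v\<in>D' \<union> A. \<tau> v)"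
    have "connected_in Eb (D' \<union> A)"
      by (rule connected_in_Un_neighbours[OF D'(2) symb finA]) (auto simp: A_def nbr_def)
    then have "subtree_set p U"
      unfolding U_def using D'(3) st AV meet by (intro subtree_set_UN[of Eb]) blast+
    moreover have "U \<subseteq> {..<n}" unfolding U_def using st AV by blast
    moreover have "t \<notin> U"
    proof
      assume "t \<in> U"
      then obtain v where "v \<in> D' \<union> A" "col v \<in> I" unfolding U_def \<tau>_def I_def by blast
      then show False using D'(5) by (auto simp: A_def)
    qed
    ultimately have "2 * card {v \<in> nbr D. \<tau> v \<subseteq> U} \<le> card (nbr D)" using bal by blast
    moreover have "card A \<le> card {v \<in> nbr D. \<tau> v \<subseteq> U}"
      using finite_nbr by (intro card_mono) (auto simp: A_def U_def)
    ultimately have "2 * card A \<le> z" using less.prems(4) by simp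
    moreover have "card (nbr D') \<le> card A + card X + card I"
    proof (rule card_nbr_le[OF D'V D'(2) I(1)])
      show "D' \<inter> S i = {} \<and> S i \<subseteq> X" if "i \<in> I" for i using D'(4) that unfolding X_def by blast
      show "col v \<notin> I" if "v \<in> D'" for v using D'(5)[OF that] .
      show "nbr D' \<subseteq> A \<union> X \<union> {v. col v \<in> I}" using nb by (auto simp: A_def)
    qed (rule finA finX)+
    ultimately have "2 * card (nbr D') \<le> z + 2 * card X + 2 * card I" by presburger
    also have "\<dots> \<le> z + 2 * ((c + 2) * s) + 2 * (c + 2)"
      using cardX I(3) by (intro add_mono mult_le_mono2) simp_all
    \<comment> \<open>The contributions of \<open>X\<close> and \<open>I\<close> sum to at most
      \<open>z / 2\<close>, by the choice of \<open>z\<close>; the other half is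
      \<open>A\<close>.\<close>
    also have "\<dots> = 2 * z" unfolding z by simp
    finally show "card (nbr D') \<le> z" by simp
  qed
  show ?case
  proof (rule extendable_step[OF less.prems(1), of "D \<inter> X" "D \<inter> X"])
    have "card (nbr D \<union> (D \<inter> X)) \<le> card (nbr D) + card (D \<inter> X)" by (rule card_Un_le)
    also have "\<dots> \<le> z + card X" using less.prems(4) finX by (intro add_mono card_mono) auto
    finally have "card (nbr D \<union> (D \<inter> X)) \<le> z + (c + 2) * s" using cardX by linarith
    then show *: "card (nbr D \<union> (D \<inter> X)) \<le> K" unfolding K by simp
    have "card (col ` (nbr D \<union> (D \<inter> X))) \<le> card (nbr D \<union> (D \<inter> X))"
      using finite_nbr finX by (intro card_image_le) simp
    then show "card (col ` (nbr D \<union> (D \<inter> X))) \<le> K" using * by simp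
    fix x assume x: "x \<in> D - D \<inter> X"
    let ?C = "component_of Eb (D - D \<inter> X) x"
    have CD: "?C \<subseteq> D - D \<inter> X" by (rule component_of_subset)
    have nbC: "nbr ?C \<subseteq> nbr D \<union> D \<inter> X" by (rule nbr_component_subset[OF _ x]) simp
    have "extendable ?C"
    proof (rule extendable_classes[of I X "nbr D" D I])
      have "card (nbr D) + card X + card I \<le> z + (c + 2) * s + (c + 2)"
        using less.prems(4) cardX I(3) by (intro add_mono)
      then show "card (nbr D) + card X + card I < K" unfolding K by simp
      show "S i \<subseteq> X" if "i \<in> I" for i using that unfolding X_def by blast
      show "extendable D'" if "D' \<subseteq> D" "connected_in Eb D'" "D' \<noteq> {}" "D' \<inter> X = {}"
        "\<And>v. v \<in> D' \<Longrightarrow> col v \<notin> I" "nbr D' \<subseteq> nbr D \<union> X \<union> {v. col v \<in> I}" for D'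
        by (rule inner) (use that in auto)
      show "connected_in Eb ?C" using connected_in_component_of[OF symb x] .
      show "?C \<noteq> {}" using component_of_self[OF x] by blast
      show "?C \<subseteq> D" "?C \<inter> X = {}" using CD by blast+
      show "nbr ?C \<subseteq> nbr D \<union> X \<union> {v. col v \<in> I - I}" using nbC by blast
    qed (use I finX finite_nbr less.prems(1) in auto)
    moreover have e: "nbr ?C - (nbr D \<union> D \<inter> X) = {}" using nbC by blast
    have "card (nbr ?C - (nbr D \<union> D \<inter> X)) \<le> 1" unfolding e by simp
    ultimately show "extendable ?C \<and> card (nbr ?C - (nbr D \<union> D \<inter> X)) \<le> 1" by blast
  qed auto
qed

lemma full_decomposition_exists:
  obtains n' p' b g where "partial_decomposition n' p' b g V"
proof (rule partial_decomposition_exists)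
  fix x assume x: "x \<in> V"
  have "nbr (component_of Eb V x) = {}"
    using nbr_component_subset[of "{}" V x] x by (auto simp: nbr_def)
  then show "extendable (component_of Eb V x)"
    using component_of_subset[of Eb V x] connected_in_component_of[OF symb x] component_of_self[OF x]
    by (intro extendable_small_nbr) auto
qed

end

section \<open>The equivalence\<close>

lemma parcs_bullet_except:
  "parcs (bullet_except H i) = parcs (ugraph H) \<union>
     {(u, v). u \<noteq> v \<and> u \<in> pverts (ugraph H) \<and> v \<in> pverts (ugraph H) \<and>
       color H u = color H v \<and> color H u \<noteq> i}"
  unfolding bullet_except_def parcs_make_cliques by (auto simp: colors_def)

lemma guarded_decomposition_of_partial_decomposition:
  assumes H: "colored_graph H"
    and d: "guarded_growth.partial_decomposition (pverts (ugraph H)) (parcs (ugraph H))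
      (parcs (bullet H)) (color H) K n p b g (pverts (ugraph H))"
  shows "guarded_cutvertex_decomposition H (index_tree n p) 0 b g \<and>
    guard_size (index_tree n p) g \<le> K \<and> (\<forall>t\<in>pverts (index_tree n p). card (color H ` b t) \<le> K)"
proof -
  let ?V = "pverts (ugraph H)" and ?T = "index_tree n p"
  have "finite ?V" "sym (parcs (bullet H))" "parcs (bullet H) \<subseteq> ?V \<times> ?V"
    using H pair_graph_make_cliques[OF H, of "colors H"]
    by (auto simp: pair_graph_iff bullet_def)
  then interpret guarded_growth ?V "parcs (ugraph H)" "parcs (bullet H)" "color H" K
    by unfold_locales
  note d' = d[unfolded partial_decomposition_def]
  note n = d'[THEN conjunct1]
  note W = d'[THEN conjunct2, THEN conjunct1]
  note tree = d'[THEN conjunct2, THEN conjunct2, THEN conjunct2, THEN conjunct1]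
  note node = d'[THEN conjunct2, THEN conjunct2, THEN conjunct2, THEN conjunct2, THEN conjunct1]
  note edges = d'[THEN conjunct2, THEN conjunct2, THEN conjunct2, THEN conjunct2, THEN conjunct2]
  have pf: "parent_fun n p" using n tree by (simp add: parent_fun_def)
  have pv: "pverts ?T = {..<n}" by (simp add: index_tree_def)
  have enum: "tree_enumeration ?T n id p" by (rule tree_enumeration_index_tree[OF pf])
  have st: "subtree_set p (nodes n b v)" if v: "v \<in> ?V" for v
  proof -
    let ?S = "nodes n b v"
    define m where "m = (LEAST k. k \<in> ?S)"
    have "\<exists>k. k \<in> ?S" using v W by auto
    then have m: "m \<in> ?S" unfolding m_def by (rule LeastI_ex)
    \<comment> \<open>The first node \<open>m\<close> of \<open>v\<close> comes before
      \<open>k\<close>, so running intersection puts \<open>v\<close> into the bag of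
      \<open>p k\<close>.\<close>
    have "p k \<in> ?S \<and> p k < k" if k: "k \<in> ?S" "k \<noteq> m" for k
    proof -
      have "m \<le> k" unfolding m_def by (rule Least_le) (rule k(1))
      then have mk: "m < k" "0 < k" "k < n" using k by auto
      then have pk: "p k < k" "b k \<inter> (\<Union>l<k. b l) \<subseteq> b (p k)" using tree by auto
      have "v \<in> b k" "v \<in> (\<Union>l<k. b l)" using k(1) m mk(1) by auto
      then show ?thesis using pk mk(3) by auto
    qed
    then show ?thesis using m unfolding subtree_set_def by blast
  qed
  have "parent_decomposition n p b (pverts (bullet H)) (parcs (bullet H))"
    unfolding parent_decomposition_def
  proof (intro conjI allI impI ballI)
    show "parent_fun n p" by (rule pf)
    show "b k \<subseteq> pverts (bullet H)" if "k < n" for k using W that by auto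
    show "subtree_set p (nodes n b v)" if "v \<in> pverts (bullet H)" for v
      using st that by simp
    show "\<exists>k<n. u \<in> b k \<and> v \<in> b k" if "(u, v) \<in> parcs (bullet H)" for u v
      using edges that EbV by blast
  qed
  then have td: "tree_decomposition (bullet H) ?T b" by (rule tree_decomposition_index_tree)
  have adh: "adhesion ?T 0 b k = (if k = 0 then {} else b k \<inter> b (p k))" if "k < n" for k
    using adhesion_enumeration[OF enum that, of b] by simp
  have "guarded_cutvertex_decomposition H ?T 0 b g"
    unfolding guarded_cutvertex_decomposition_def
  proof (intro conjI ballI impI)
    show "tree_decomposition (bullet H) ?T b" by (rule td)
    show "0 \<in> pverts ?T" using n pv by simp
    show "adhesion ?T 0 b t \<subseteq> g t" if "t \<in> pverts ?T" for t
      using that tree adh[of t] by (auto simp: pv)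
    show "g t \<subseteq> b t" if "t \<in> pverts ?T" for t using that node by (simp add: pv)
    show "vertex_cover (with_proj (ugraph H) \<restriction> b t) (g t)" if "t \<in> pverts ?T" for t
      using that node unfolding vertex_cover_def by (auto simp: pv)
    show "card (adhesion ?T 0 b t' - g t) \<le> 1"
      if t: "t \<in> pverts ?T" "t' \<in> pverts ?T" "is_parent ?T 0 t t'" for t t'
    proof -
      have "0 < t' \<and> t' < n \<and> t = p t'" using is_parent_iff[OF enum] t(3) by auto
      then show ?thesis using tree adh[of t'] by simp
    qed
  qed
  moreover have "guard_size ?T g \<le> K"
    unfolding guard_size_def pv using n node by (subst Max_le_iff) auto
  ultimately show ?thesis using node by (simp add: pv)
qed

text \<open>A packing of \<open>c\<close> sets would give a flower, so
  \<open>packing_or_hitting_set\<close> with \<open>k = c\<close> provides hitting sets of size at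
  most \<open>4 * c\<close>. \<open>K\<close> is the constant of \<open>class_hitting_sets\<close>
  for this \<open>s\<close>.\<close>

lemma flower_free_imp_guarded_decomposition:
  assumes H: "colored_graph H" and tw: "treewidth (class_graph H) \<le> c"
    and free: "\<forall>i\<in>colors H. \<not> (\<exists>P. flower c H i P)"
    and K: "K = 2 * ((c + 2) * (4 * c) + (c + 2)) + (c + 2) * (4 * c) + (c + 2) + 1"
  obtains T :: "nat pair_pre_digraph" and r \<beta> g where
    "guarded_cutvertex_decomposition H T r \<beta> g" "guard_size T g \<le> K"
    "\<forall>t\<in>pverts T. card (color H ` \<beta> t) \<le> K"
proof -
  let ?V = "pverts (ugraph H)" and ?E = "parcs (ugraph H)"
  have fin: "finite ?V" and E: "?E \<subseteq> ?V \<times> ?V" and sy: "sym ?E" and irr: "\<And>u. (u, u) \<notin> ?E"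
    using H by (auto simp: colored_graph_iff)
  have bul: "sym (parcs (bullet H))" "parcs (bullet H) \<subseteq> ?V \<times> ?V"
    using pair_graph_make_cliques[OF H, of "colors H"]
    by (auto simp: pair_graph_iff bullet_def)
  have "\<exists>S. finite S \<and> card S \<le> 4 * c \<and> (\<forall>D x y. D \<subseteq> ?V - S \<longrightarrow>
      connected_in (parcs (bullet_except H i)) D \<longrightarrow> x \<in> D \<longrightarrow> y \<in> D \<longrightarrow>
      color H x = i \<longrightarrow> color H y = i \<longrightarrow> x = y)" if i: "i \<in> color H ` ?V" for i
  proof -
    have "\<not> packing (parcs (bullet_except H i)) (color_class H i) ?V c"
      using packing_imp_flower[of H i c] free i by (auto simp: colors_def)
    moreover have "sym (parcs (bullet_except H i))"
      using pair_graph_make_cliques[OF H, of "colors H - {i}"]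
      by (simp add: pair_graph_iff bullet_except_def)
    ultimately show ?thesis
    proof (rule_tac packing_or_hitting_set[of "parcs (bullet_except H i)" "color_class H i" ?V c])
      fix U assume U: "finite U" "card U \<le> 4 * c"
        and hit: "\<And>D x y. D \<subseteq> ?V - U \<Longrightarrow> connected_in (parcs (bullet_except H i)) D \<Longrightarrow>
          x \<in> D \<inter> color_class H i \<Longrightarrow> y \<in> D \<inter> color_class H i \<Longrightarrow> x = y"
      have "x = y" if D: "D \<subseteq> ?V - U" "connected_in (parcs (bullet_except H i)) D"
        "x \<in> D" "y \<in> D" "color H x = i" "color H y = i" for D x y
        by (rule hit[OF D(1,2)]) (use D in \<open>auto simp: color_class_def\<close>)
      then show ?thesis using U by blast
    qed
  qed
  then obtain S where S: "\<And>i. i \<in> color H ` ?V \<Longrightarrow> finite (S i) \<and> card (S i) \<le> 4 * c"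
    and hit: "\<And>i D x y. i \<in> color H ` ?V \<Longrightarrow> D \<subseteq> ?V - S i \<Longrightarrow>
      connected_in (parcs (bullet_except H i)) D \<Longrightarrow> x \<in> D \<Longrightarrow> y \<in> D \<Longrightarrow>
      color H x = i \<Longrightarrow> color H y = i \<Longrightarrow> x = y"
    by metis
  obtain n p bag where
    d: "parent_decomposition n p bag (pverts (class_graph H)) (parcs (class_graph H))"
      "\<forall>k<n. card (bag k) \<le> Suc c"
    using tw treewidth_le_iff[OF pair_graph_class_graph[OF H], of c] by blast
  have pc: "pverts (class_graph H) = color H ` ?V" by (simp add: class_graph_def colors_def)
  interpret class_hitting_sets ?V ?E "parcs (bullet H)" "color H" K S "4 * c" c
    "2 * ((c + 2) * (4 * c) + (c + 2))" n p bag
  proof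
    show "finite ?V" "sym (parcs (bullet H))" "parcs (bullet H) \<subseteq> ?V \<times> ?V" "sym ?E"
      by (rule fin bul sy)+
    show "(v, v) \<notin> ?E" for v by (rule irr)
    show "(u, v) \<in> parcs (bullet H) \<longleftrightarrow>
        (u, v) \<in> ?E \<or> u \<noteq> v \<and> u \<in> ?V \<and> v \<in> ?V \<and> color H u = color H v" for u v
      by (auto simp: parcs_bullet)
    show "finite (S i) \<and> card (S i) \<le> 4 * c" if "i \<in> color H ` ?V" for i by (rule S[OF that])
    show "x = y" if "i \<in> color H ` ?V" "D \<subseteq> ?V - S i"
      "connected_in (?E \<union> {(u, v). u \<noteq> v \<and> u \<in> ?V \<and> v \<in> ?V \<and>
        color H u = color H v \<and> color H u \<noteq> i}) D"
      "x \<in> D" "y \<in> D" "color H x = i" "color H y = i" for i D x y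
      using hit[of i D x y] that unfolding parcs_bullet_except by blast
    show "parent_fun n p" using d(1) by (simp add: parent_decomposition_def)
    show "finite (bag k) \<and> card (bag k) \<le> Suc c \<and> bag k \<subseteq> color H ` ?V" if k: "k < n" for k
    proof -
      have sub: "bag k \<subseteq> color H ` ?V"
        using d(1) k unfolding parent_decomposition_def pc by blast
      then have "finite (bag k)" using fin by (meson finite_imageI finite_subset)
      then show ?thesis using sub d(2) k by blast
    qed
    show "subtree_set p (nodes n bag i)" if "i \<in> color H ` ?V" for i
      using d(1) that unfolding parent_decomposition_def pc by blast
    show "\<exists>k<n. color H u \<in> bag k \<and> color H v \<in> bag k"
      if uv: "(u, v) \<in> ?E" "color H u \<noteq> color H v" for u v
    proof -
      have "u \<in> ?V" "v \<in> ?V" using uv(1) E by auto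
      then have "(color H u, color H v) \<in> parcs (class_graph H)"
        using uv by (auto simp: class_graph_def color_class_def)
      then show ?thesis using d(1) unfolding parent_decomposition_def by blast
    qed
  qed (simp_all add: K)
  from full_decomposition_exists obtain n' p' b g where "partial_decomposition n' p' b g ?V" .
  from guarded_decomposition_of_partial_decomposition[OF H this] show ?thesis
    using that by blast
qed

theorem theorem6p2:
  fixes \<H> :: "('a, 'c) colored_graph set"
  assumes "\<forall>H\<in>\<H>. colored_graph H"
  shows
    "((\<exists>c::nat. \<forall>H\<in>\<H>. \<forall>F\<in>Spasm H. treewidth (ugraph F) \<le> c)
      \<longleftrightarrow>
      (\<exists>c::nat. \<forall>H\<in>\<H>. treewidth (class_graph H) \<le> c \<and>
        (\<forall>i\<in>colors H. \<not> (\<exists>P. flower c H i P))))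
     \<and>
     ((\<exists>c::nat. \<forall>H\<in>\<H>. treewidth (class_graph H) \<le> c \<and>
        (\<forall>i\<in>colors H. \<not> (\<exists>P. flower c H i P)))
      \<longleftrightarrow>
      (\<exists>c::nat. \<forall>H\<in>\<H>. \<exists>(T :: nat pair_pre_digraph) r \<beta> g.
        guarded_cutvertex_decomposition H T r \<beta> g \<and> guard_size T g \<le> c \<and>
        (\<forall>t\<in>pverts T. card (color H ` \<beta> t) \<le> c)))"
  (is "(?spasm \<longleftrightarrow> ?flower) \<and> (?flower \<longleftrightarrow> ?guarded)")
proof -
  have "?flower" if s: ?spasm
  proof -
    from s obtain c where c: "\<forall>H\<in>\<H>. \<forall>F\<in>Spasm H. treewidth (ugraph F) \<le> c" ..
    \<comment> \<open>The flower size excluded by \<open>no_large_flower\<close>; being at least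
      \<open>c\<close>, it also bounds the treewidth of the class graph.\<close>
    let ?N = "(c + 2) * (c + 2) * (Suc c * Suc c)"
    have "treewidth (class_graph H) \<le> ?N \<and> (\<forall>i\<in>colors H. \<not> (\<exists>P. flower ?N H i P))"
      if H: "H \<in> \<H>" for H
    proof -
      have cg: "colored_graph H" and tw: "\<forall>F\<in>Spasm H. treewidth (ugraph F) \<le> c"
        using assms c H by auto
      have "treewidth (class_graph H) \<le> c" by (rule treewidth_class_graph_le[OF cg tw])
      also have "c \<le> ?N" by simp
      finally show ?thesis using no_large_flower[OF cg tw] by blast
    qed
    then show ?flower by blast
  qed
  moreover have "?guarded" if f: ?flower
  proof -
    from f obtain c where c: "\<forall>H\<in>\<H>. treewidth (class_graph H) \<le> c \<and>
        (\<forall>i\<in>colors H. \<not> (\<exists>P. flower c H i P))" ..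
    define K where "K = 2 * ((c + 2) * (4 * c) + (c + 2)) + (c + 2) * (4 * c) + (c + 2) + 1"
    have "\<exists>(T :: nat pair_pre_digraph) r \<beta> g.
        guarded_cutvertex_decomposition H T r \<beta> g \<and> guard_size T g \<le> K \<and>
        (\<forall>t\<in>pverts T. card (color H ` \<beta> t) \<le> K)" if H: "H \<in> \<H>" for H
    proof -
      have "colored_graph H" "treewidth (class_graph H) \<le> c"
        "\<forall>i\<in>colors H. \<not> (\<exists>P. flower c H i P)"
        using assms c H by auto
      from flower_free_imp_guarded_decomposition[OF this K_def]
      obtain T :: "nat pair_pre_digraph" and r \<beta> g where
        "guarded_cutvertex_decomposition H T r \<beta> g" "guard_size T g \<le> K"
        "\<forall>t\<in>pverts T. card (color H ` \<beta> t) \<le> K" .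
      then show ?thesis by blast
    qed
    then show ?guarded by blast
  qed
  moreover have "?spasm" if g: ?guarded
  proof -
    from g obtain c where c: "\<forall>H\<in>\<H>. \<exists>(T :: nat pair_pre_digraph) r \<beta> g.
        guarded_cutvertex_decomposition H T r \<beta> g \<and> guard_size T g \<le> c \<and>
        (\<forall>t\<in>pverts T. card (color H ` \<beta> t) \<le> c)" ..
    have "treewidth (ugraph F) \<le> c" if HF: "H \<in> \<H>" "F \<in> Spasm H" for H F
    proof -
      from c HF(1) obtain T :: "nat pair_pre_digraph" and r \<beta> g where
        T: "guarded_cutvertex_decomposition H T r \<beta> g" "guard_size T g \<le> c" by blast
      have "colored_graph H" using assms HF(1) by blast
      then show ?thesis using HF(2) T by (rule spasm_treewidth_le_guard_size)
    qed
    then show ?spasm by blast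
  qed
  ultimately show ?thesis by argo
qed

end
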